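(* Let $d\ge2$, $\ell>0$, and let $I=(0,\ell)^d$ be a cube in $\mathbb{R}^d$. Suppose that there exists $c_0>0$ such that $$\|\theta(t)\|_{H^{-1}}\ \ge\ B(\theta_0)\exp\left(\frac{-c_0}{\ell^{d/p}}\int_0^t\|\nabla u(s)\|_{L^p}\,ds\right)\qquad\text{for all }t\ge0$$ for some $p\in[1,d]$, all smooth incompressible (time-dependent) vector fields $u$ which vanish on $\partial I$, and all mean-zero initial data $\theta_0\in C_c^\infty(I)$, where $\theta$ solves $\partial_t\theta+u\cdot\nabla\theta=0$ in $I$ with $\theta(\cdot,0)=\theta_0$, and the pre-factor $B(\theta_0)$ is a real number depending on $\theta_0$. Assume that there exists $\gamma\in\mathbb{R}$ such that the pre-factor satisfies $$B(A\theta_0)=A\,B(\theta_0)\quad\text{and}\quad B(\theta_{0,a})=a^{-\gamma}B(\theta_0)$$ for $A>0$ and $a\in(0,1)$, where $\theta_{0,a}(x)=\theta_0(x/a)$ for $x\in(0,a\ell)^d$ and $\theta_{0,a}(x)=0$ otherwise. Then, for any mean-zero $\theta_0\in C_c^\infty(I)$ and any smooth (time-dependent) velocity field $u$ such that $$\limsup_{t\to\infty}\frac1t\int_0^t\|\nabla u(s)\|_{L^p}\,ds<\infty,\qquad \nabla\cdot u=0,\qquad\text{and}\qquad u=0\text{ on }\partial I,$$ the decay of $\|\theta(t)\|_{H^{-1}}$ as $t\to\infty$ is bounded below by an algebraic function of time, where $\theta$ is the solution of $\partial_t\theta+u\cdot\nabla\theta=0$ in $I$ with $\theta(\cdot,0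)=\theta_0$.
   Context: $L^p$ norms are over $I$. $\|\cdot\|_{H^{-1}}$ is the homogeneous Sobolev norm of order $-1$ in the periodic setting: a mean-zero function $f$ compactly supported in $I$ is regarded as a function on the torus $\mathbb{R}^d/(\ell\mathbb{Z})^d$ of side length $\ell$, and $\|f\|_{H^{-1}}=\sup\{|\int f g\,dx| : g \text{ a smooth function on the torus},\ \|\nabla g\|_{L^2}\le1\}$. Saying that $\|\theta(t)\|_{H^{-1}}$ is bounded below by an algebraic function of time means that there exist $C>0$, $\alpha\ge0$ and $t_0>0$ with $\|\theta(t)\|_{H^{-1}}\ge C\,t^{-\alpha}$ for all $t\ge t_0$.
   Formalization: The conclusion is stated only for initial data with pre-factor B(θ_0) > 0; for an arbitrary real B it is false, e.g. B ≡ 0 satisfies all hypotheses while θ_0 = 0 gives θ = 0, which has no positive algebraic lower bound. *)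

theory Defs
  imports "HOL-Analysis.Analysis"
begin

(* C^k in the sense of Frechet derivatives; meant for open S. *)
primrec Ck_on :: "nat \<Rightarrow> 'a::real_normed_vector set \<Rightarrow> ('a \<Rightarrow> 'b::real_normed_vector) \<Rightarrow> bool" where
  "Ck_on 0 S f \<longleftrightarrow> continuous_on S f"
| "Ck_on (Suc k) S f \<longleftrightarrow>
     (\<forall>x\<in>S. f differentiable (at x)) \<and> (\<forall>v. Ck_on k S (\<lambda>x. frechet_derivative f (at x) v))"

(* On a set that is not open (such as a closed cube), smooth means: restriction of a function
   that is smooth on an open neighbourhood. *)
definition smooth_on :: "'a::real_normed_vector set \<Rightarrow> ('a \<Rightarrow> 'b::real_normed_vector) \<Rightarrow> bool" where
  "smooth_on S f \<longleftrightarrow> (\<exists>W g. open W \<and> S \<subseteq> W \<and> (\<forall>k. Ck_on k W g) \<and> (\<forall>x\<in>S. f x = g x))"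

definition cube :: "real \<Rightarrow> (real^'n) set" where
  "cube l = {x. \<forall>i. 0 < x $ i \<and> x $ i < l}"

(* Bochner integrals are 0 when the integrand is not integrable; below this is only applied to
   functions that extend continuously to the closure of the bounded set S. *)
definition Lp_norm :: "real \<Rightarrow> (real^'n) set \<Rightarrow> (real^'n \<Rightarrow> 'b::real_normed_vector) \<Rightarrow> real" where
  "Lp_norm p S F = (LINT x:S|lborel. norm (F x) powr p) powr (1 / p)"

definition grad :: "(real^'n \<Rightarrow> real) \<Rightarrow> real^'n \<Rightarrow> real^'n" where
  "grad f x = (\<chi> i. frechet_derivative f (at x) (axis i 1))"

(* The norm of a matrix in real^'n^'n is the Euclidean (Frobenius) norm. *)
definition grad_Lp :: "real \<Rightarrow> real \<Rightarrow> (real^'n \<Rightarrow> real^'n) \<Rightarrow> real" where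
  "grad_Lp l p v = Lp_norm p (cube l) (\<lambda>x. jacobian v (at x))"

definition divergence :: "(real^'n \<Rightarrow> real^'n) \<Rightarrow> real^'n \<Rightarrow> real" where
  "divergence v x = trace (jacobian v (at x))"

(* Time-dependent fields are total functions of t and x, of which only the values for t \<ge> 0 and
   x in the closed cube matter. *)
definition admissible_velocity :: "real \<Rightarrow> (real \<Rightarrow> real^'n \<Rightarrow> real^'n) \<Rightarrow> bool" where
  "admissible_velocity l u \<longleftrightarrow>
     smooth_on ({0..} \<times> closure (cube l)) (\<lambda>(t, x). u t x) \<and>
     (\<forall>t\<ge>0. \<forall>x\<in>cube l. divergence (u t) x = 0) \<and>
     (\<forall>t\<ge>0. \<forall>x\<in>frontier (cube l). u t x = 0)"

(* Mean-zero elements of the space of smooth functions with compact support in the cube; they are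
   represented by their extensions by zero to the whole space. *)
definition mean_zero_data :: "real \<Rightarrow> (real^'n \<Rightarrow> real) set" where
  "mean_zero_data l = {f. smooth_on UNIV f \<and> compact (closure {x. f x \<noteq> 0}) \<and>
     closure {x. f x \<noteq> 0} \<subseteq> cube l \<and> (LINT x:cube l|lborel. f x) = 0}"

definition rescale :: "real \<Rightarrow> real \<Rightarrow> (real^'n \<Rightarrow> real) \<Rightarrow> real^'n \<Rightarrow> real" where
  "rescale l a f x = (if x \<in> cube (a * l) then f ((1 / a) *\<^sub>R x) else 0)"

(* Classical solutions. Such a solution is constant along the characteristics of u and hence
   determined by u and the initial datum, so the class of solutions would be the same if more
   regularity were asked for. *)
definition transport_solution ::
  "real \<Rightarrow> (real \<Rightarrow> real^'n \<Rightarrow> real^'n) \<Rightarrow> (real^'n \<Rightarrow> real) \<Rightarrow> (real \<Rightarrow> real^'n \<Rightarrow> real) \<Rightarrow> bool" where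
  "transport_solution l u \<theta>0 \<theta> \<longleftrightarrow>
     continuous_on ({0..} \<times> cube l) (\<lambda>(t, x). \<theta> t x) \<and>
     (\<forall>t>0. \<forall>x\<in>cube l.
        (\<lambda>(s, y). \<theta> s y) differentiable (at (t, x)) \<and>
        deriv (\<lambda>s. \<theta> s x) t + u t x \<bullet> grad (\<theta> t) x = 0) \<and>
     (\<forall>x\<in>cube l. \<theta> 0 x = \<theta>0 x)"

(* Functions on the torus of side length l are l-periodic functions on the whole space. *)
definition torus_smooth :: "real \<Rightarrow> (real^'n \<Rightarrow> real) set" where
  "torus_smooth l = {g. smooth_on UNIV g \<and> (\<forall>x i. g (x + axis i l) = g x)}"

(* Extended-real valued, so that the supremum is meaningful without a boundedness proof. *)
definition Hm1_norm :: "real \<Rightarrow> (real^'n \<Rightarrow> real) \<Rightarrow> ereal" where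
  "Hm1_norm l f = (SUP g \<in> {g \<in> torus_smooth l. Lp_norm 2 (cube l) (grad g) \<le> 1}.
     ereal \<bar>LINT x:cube l|lborel. f x * g x\<bar>)"

definition algebraic_lower_bound :: "(real \<Rightarrow> ereal) \<Rightarrow> bool" where
  "algebraic_lower_bound N \<longleftrightarrow>
     (\<exists>C \<alpha> t0. C > 0 \<and> \<alpha> \<ge> 0 \<and> t0 > 0 \<and> (\<forall>t\<ge>t0. N t \<ge> ereal (C * t powr (- \<alpha>))))"

end

(*
Let theta be transported by u, and let T > 0. Rescale space: theta(t, x/a) is transported by
a u(t, x/a) on the small cube (0, a l)^d, and the time integral of the L^p norm of the velocity
gradient picks up a factor a^(d/p). With a = T^(-p/d) it stays bounded up to time T, so the assumed
bound for the rescaled data gives a lower bound for the rescaled solution that is a power of T.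

Two points need care. The extension of a u(t, x/a) by zero is not smooth. By the maximum principle
theta vanishes near the boundary up to time T, so u may be changed there: it is replaced by its pull-back,
as a flux, under a product map Phi that is the identity inside and collapses a layer to the boundary.
This field is again divergence free, it is smooth and compactly supported, and its gradient exceeds that
of u only on a thin layer. After time T the flow is brought to rest by a change of the time variable.

Secondly, the H^-1 norms on the small and the large torus are not comparable. But theta is bounded,
so cutting test functions off in a layer of width delta, together with the Poincare inequality, bounds the
norm of the rescaled function by a^(d/2) (||theta|| / delta + sqrt delta). Choosing delta
a power of T loses only a power of T. If theta(T) did not have mean zero, its norm would be infinite.
*)

theory Submission
  imports Defs "HOL-Computational_Algebra.Polynomial"
begin

section \<open>Calculus of \<open>C\<^sup>k\<close> functions\<close>

text \<open>Multiplying the velocity by a cutoff would destroy incompressibility. The flux pull-back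
  keeps it because the trace of its Jacobian is det D\<open>\<Phi>\<close> times the old divergence.
  Its gradient contains a second derivative of the collapsing map, of size 1/e for a layer of width
  e, but the velocity vanishes on the boundary and is O(e) at the relevant points. So the gradient
  is bounded in the layer uniformly in e. The layer has volume O(e); for e small, depending on T,
  the integral of the p-th power grows by at most 1, which costs a term linear in T in the time
  integral.

  The hypothesis speaks of a field and a solution for all times, whereas the support is controlled
  on bounded time intervals. The change of the time variable settles this and yields an explicit
  solution for the new field.

  The lower bound for the rescaled function, divided by the factor a^(d/2) of the norm estimate, is
  a power T^m. With sqrt \<open>\<delta>\<close> proportional to T^(-|m|) the error is absorbed into
  half of it; solving for the norm costs another factor \<open>\<delta>\<close>.\<close>

lemma Ck_on_subset: "Ck_on k S f \<Longrightarrow> T \<subseteq> S \<Longrightarrow> Ck_on k T f"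
proof (induction k arbitrary: f)
  case 0 then show ?case by (auto intro: continuous_on_subset)
next
  case (Suc k) then show ?case by auto
qed

text \<open>On an open set, equality of functions passes to their Frechet derivatives, which
  \<open>Ck_on\<close> takes in the whole space.\<close>

lemma Ck_on_cong:
  assumes "open S" "\<And>x. x \<in> S \<Longrightarrow> f x = g x" "Ck_on k S f"
  shows "Ck_on k S g"
  using assms(2,3)
proof (induction k arbitrary: f g)
  case 0 then show ?case using continuous_on_cong[of S S f g] by simp
next
  case (Suc k)
  have D: "(g has_derivative frechet_derivative f (at x)) (at x)" if "x \<in> S" for x
  proof -
    have "(f has_derivative frechet_derivative f (at x)) (at x)"
      using Suc.prems(2) that by (simp add: frechet_derivative_works)
    then show ?thesis
      using has_derivative_transform_within_open[OF _ \<open>open S\<close> that] Suc.prems(1) by auto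
  qed
  have "frechet_derivative f (at x) v = frechet_derivative g (at x) v" if "x \<in> S" for x v
    using frechet_derivative_at[OF D[OF that]] by simp
  then have "Ck_on k S (\<lambda>x. frechet_derivative g (at x) v)" for v
    using Suc.IH[of "\<lambda>x. frechet_derivative f (at x) v" "\<lambda>x. frechet_derivative g (at x) v"] Suc.prems(2) by simp
  then show ?case using D by (auto simp: differentiable_def)
qed

text \<open>Meant for a periodised function, which has a simple formula only on small balls, and one
  that varies with the ball.\<close>

lemma Ck_on_local:
  assumes "\<And>x. x \<in> S \<Longrightarrow> \<exists>U. open U \<and> x \<in> U \<and> Ck_on k U f"
  shows "Ck_on k S f"
  using assms
proof (induction k arbitrary: f)
  case 0
  then show ?case
    by (metis Ck_on.simps(1) continuous_at_imp_continuous_on continuous_on_eq_continuous_at)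
next
  case (Suc k) then show ?case by (metis Ck_on.simps(2))
qed

lemma Ck_on_lower: "Ck_on (Suc k) S f \<Longrightarrow> Ck_on k S f"
proof (induction k arbitrary: f)
  case 0
  then show ?case
    by (simp add: continuous_at_imp_continuous_on differentiable_imp_continuous_within)
next
  case (Suc k)
  then show ?case by (metis Ck_on.simps(2))
qed

text \<open>\<open>frechet_derivative\<close> is given by a choice operator; this rule lets any
  explicit formula for the derivative take its place.\<close>

lemma Ck_onI:
  assumes "open S" "\<And>x. x \<in> S \<Longrightarrow> (f has_derivative f' x) (at x)"
    "\<And>v. Ck_on k S (\<lambda>x. f' x v)"
  shows "Ck_on (Suc k) S f"
proof -
  have "f' x v = frechet_derivative f (at x) v" if "x \<in> S" for x v
    using frechet_derivative_at[OF assms(2)[OF that]] by simp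
  then have "Ck_on k S (\<lambda>x. frechet_derivative f (at x) v)" for v
    by (rule Ck_on_cong[OF assms(1) _ assms(3)]) blast
  then show ?thesis using assms(2) by (auto simp: differentiable_def)
qed

declare Ck_on.simps(2) [simp del]

lemma Ck_on_const [simp]: "open S \<Longrightarrow> Ck_on k S (\<lambda>x. c)"
proof (induction k arbitrary: c)
  case (Suc k) then show ?case by (intro Ck_onI[where f'="\<lambda>x v. 0"]) auto
qed auto

lemma Ck_on_linear: assumes "open S" "bounded_linear f" shows "Ck_on k S f"
proof (cases k)
  case 0 then show ?thesis using assms by (simp add: linear_continuous_on)
next
  case (Suc m)
  have "Ck_on (Suc m) S f"
    by (rule Ck_onI[where f'="\<lambda>x. f"]) (use assms in \<open>auto intro: bounded_linear_imp_has_derivative\<close>)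
  then show ?thesis using Suc by simp
qed

lemma Ck_on_bounded_linear:
  assumes "open S" "bounded_linear L" "Ck_on k S f" shows "Ck_on k S (\<lambda>x. L (f x))"
  using assms(3)
proof (induction k arbitrary: f)
  case 0 then show ?case
    using bounded_linear.continuous_on[OF assms(2)] by simp
next
  case (Suc k)
  then show ?case
    by (intro Ck_onI[where f'="\<lambda>x v. L (frechet_derivative f (at x) v)"] assms(1)
        bounded_linear.has_derivative[OF assms(2)])
      (simp_all add: Ck_on.simps(2) frechet_derivative_works)
qed

lemma Ck_on_add:
  assumes "open S" "Ck_on k S f" "Ck_on k S g" shows "Ck_on k S (\<lambda>x. f x + g x)"
  using assms(2,3)
proof (induction k arbitrary: f g)
  case 0 then show ?case by (simp add: continuous_on_add)
next
  case (Suc k)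
  then show ?case
    by (intro Ck_onI[where f'="\<lambda>x v. frechet_derivative f (at x) v + frechet_derivative g (at x) v"] assms(1))
      (auto intro!: has_derivative_add simp: Ck_on.simps(2) frechet_derivative_works)
qed

lemma Ck_on_bilinear:
  assumes "open S" "bounded_bilinear b" "Ck_on k S f" "Ck_on k S g"
  shows "Ck_on k S (\<lambda>x. b (f x) (g x))"
  using assms(3,4)
proof (induction k arbitrary: f g)
  case 0 then show ?case
    using bounded_bilinear.continuous_on[OF assms(2)] by auto
next
  case (Suc k)
  have 1: "Ck_on k S f" "Ck_on k S g" using Suc.prems Ck_on_lower by blast+
  show ?case
    by (rule Ck_onI[where f'="\<lambda>x v. b (f x) (frechet_derivative g (at x) v) + b (frechet_derivative f (at x) v) (g x)"])
      (use Suc 1 in \<open>auto intro!: assms Ck_on_add bounded_bilinear.FDERIV[OF assms(2)] simp: Ck_on.simps(2) frechet_derivative_works\<close>)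
qed

lemmas Ck_on_mult = Ck_on_bilinear[OF _ bounded_bilinear_mult]
lemmas Ck_on_scaleR = Ck_on_bilinear[OF _ bounded_bilinear_scaleR]

lemma Ck_on_sum:
  assumes "open S" "\<And>i. i \<in> I \<Longrightarrow> Ck_on k S (f i)" shows "Ck_on k S (\<lambda>x. \<Sum>i\<in>I. f i x)"
  using assms(2) by (induction I rule: infinite_finite_induct) (simp_all add: assms(1) Ck_on_add)

lemma Ck_on_prod:
  fixes f :: "'i \<Rightarrow> 'a::real_normed_vector \<Rightarrow> real"
  assumes "open S" "\<And>i. i \<in> I \<Longrightarrow> Ck_on k S (f i)" shows "Ck_on k S (\<lambda>x. \<Prod>i\<in>I. f i x)"
  using assms(2) by (induction I rule: infinite_finite_induct) (simp_all add: assms(1) Ck_on_mult)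

lemma Ck_on_compose:
  fixes f :: "'a::real_normed_vector \<Rightarrow> 'b::euclidean_space" and g :: "'b \<Rightarrow> 'c::real_normed_vector"
  assumes "open S" "open W" "f ` S \<subseteq> W" "Ck_on k S f" "Ck_on k W g"
  shows "Ck_on k S (\<lambda>x. g (f x))"
  using assms(4,5)
proof (induction k arbitrary: g)
  case 0 then show ?case
    using continuous_on_compose2[of W g S f] assms(3) by auto
next
  case (Suc k)
  \<comment> \<open>By the chain rule Dg at f(x) is applied to a direction that depends on x, while
    \<open>Ck_on\<close> speaks about fixed directions. Expanding that direction in the basis leaves
    fixed-direction derivatives with scalar coefficients.\<close>
  define F where "F x v = (\<Sum>b\<in>Basis. (frechet_derivative f (at x) v \<bullet> b) *\<^sub>R frechet_derivative g (at (f x)) b)" for x v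
  have D: "((\<lambda>x. g (f x)) has_derivative F x) (at x)" if "x \<in> S" for x
  proof -
    have df: "(f has_derivative frechet_derivative f (at x)) (at x)"
      using Suc.prems(1) that by (simp add: Ck_on.simps(2) frechet_derivative_works)
    have dg: "(g has_derivative frechet_derivative g (at (f x))) (at (f x))"
      using Suc.prems(2) that assms(3) by (auto simp: Ck_on.simps(2) frechet_derivative_works image_subset_iff)
    have "F x v = frechet_derivative g (at (f x)) (frechet_derivative f (at x) v)" for v
    proof -
      have l: "linear (frechet_derivative g (at (f x)))" using dg has_derivative_linear by blast
      show ?thesis unfolding F_def
        by (subst (2) euclidean_representation[symmetric])
          (simp add: linear_sum[OF l] linear_scale[OF l])
    qed
    then have "F x = (\<lambda>v. frechet_derivative g (at (f x)) (frechet_derivative f (at x) v))" by (rule ext)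
    then show ?thesis using has_derivative_compose[OF df dg] by simp
  qed
  have "Ck_on k S (\<lambda>x. F x v)" for v
    unfolding F_def
  proof (intro Ck_on_sum Ck_on_scaleR assms(1))
    fix b :: 'b
    show "Ck_on k S (\<lambda>x. frechet_derivative f (at x) v \<bullet> b)"
      using Suc.prems(1) by (intro Ck_on_bounded_linear[OF assms(1) bounded_linear_inner_left]) (simp add: Ck_on.simps(2))
    show "Ck_on k S (\<lambda>x. frechet_derivative g (at (f x)) b)"
      using Suc.prems Ck_on_lower[OF Suc.prems(1)]
      by (intro Suc.IH[of "\<lambda>y. frechet_derivative g (at y) b"]) (simp_all add: Ck_on.simps(2))
  qed
  then show ?case using D by (intro Ck_onI[where f'=F] assms(1))
qed

lemma Ck_on_real_derivI:
  fixes f :: "real \<Rightarrow> real"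
  assumes "\<And>x. (f has_real_derivative f' x) (at x)" "Ck_on k UNIV f'"
  shows "Ck_on (Suc k) UNIV f"
proof (rule Ck_onI[where f'="\<lambda>x v. f' x * v"])
  show "\<And>x. (f has_derivative (*) (f' x)) (at x)" using assms(1) by (simp add: has_field_derivative_def)
  show "\<And>v. Ck_on k UNIV (\<lambda>x. f' x * v)" by (intro Ck_on_mult assms(2) Ck_on_const) auto
qed auto

lemma Ck_on_real_deriv:
  fixes f :: "real \<Rightarrow> real"
  assumes "\<And>x. (f has_real_derivative f' x) (at x)" "Ck_on (Suc k) UNIV f"
  shows "Ck_on k UNIV f'"
proof -
  have "frechet_derivative f (at x) 1 = f' x" for x
    using frechet_derivative_at[OF assms(1)[of x, unfolded has_field_derivative_def]] by (metis mult.right_neutral)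
  then have "f' = (\<lambda>x. frechet_derivative f (at x) 1)" by auto
  then show ?thesis using assms(2) by (simp add: Ck_on.simps(2))
qed

section \<open>Smooth cutoffs\<close>

lemma poly_times_exp_minus_tendsto_0: "((\<lambda>y::real. poly P y * exp (- y)) \<longlongrightarrow> 0) at_top"
proof -
  have "((\<lambda>y. \<Sum>i\<le>degree P. coeff P i * (y ^ i / exp y)) \<longlongrightarrow> (\<Sum>i\<le>degree P. coeff P i * 0)) at_top"
    by (intro tendsto_sum tendsto_mult tendsto_const tendsto_power_div_exp_0)
  then show ?thesis
    by (simp add: poly_altdef sum_divide_distrib exp_minus divide_inverse sum_distrib_right mult.assoc)
qed

text \<open>The functions P(1/x) exp(-1/x), extended by zero: a family closed under differentiation
  that contains the standard flat function \<open>flat_fun 1\<close>.\<close>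

definition flat_fun :: "real poly \<Rightarrow> real \<Rightarrow> real" where
  "flat_fun P x = (if x > 0 then poly P (1 / x) * exp (- (1 / x)) else 0)"

text \<open>With y = 1/x the operator d/dx is -y^2 d/dy, which sends P(y) exp(-y) to y^2 (P - P')
  exp(-y); \<open>[:0, 0, 1:]\<close> is the polynomial y^2.\<close>

lemma flat_fun_has_derivative:
  "(flat_fun P has_real_derivative flat_fun ([:0, 0, 1:] * (P - pderiv P)) x) (at x)"
proof -
  consider "x < 0" | "x = 0" | "x > 0" by linarith
  then show ?thesis
  proof cases
    case 1
    have "((\<lambda>x. 0) has_real_derivative 0) (at x)" by simp
    then have "(flat_fun P has_real_derivative 0) (at x)"
      by (rule DERIV_cong_ev[THEN iffD1, rotated 3])
        (use 1 in \<open>auto simp: flat_fun_def eventually_nhds intro!: exI[of _ "{..<0}"]\<close>)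
    then show ?thesis using 1 by (simp add: flat_fun_def)
  next
    case 2
    \<comment> \<open>The difference quotient at 0 divides P(1/h) exp(-1/h) by h, hence the
      additional factor 1/h in \<open>pCons 0 P\<close>.\<close>
    have "((\<lambda>h. poly (pCons 0 P) (inverse h) * exp (- inverse h)) \<longlongrightarrow> 0) (at_right (0::real))"
      by (rule filterlim_compose[OF poly_times_exp_minus_tendsto_0 filterlim_inverse_at_top_right])
    then have R: "((\<lambda>h. (flat_fun P (0 + h) - flat_fun P 0) / h) \<longlongrightarrow> 0) (at_right 0)"
      by (rule filterlim_cong[THEN iffD1, OF refl refl, rotated])
        (auto simp: flat_fun_def eventually_at_filter field_simps)
    have L: "((\<lambda>h. (flat_fun P (0 + h) - flat_fun P 0) / h) \<longlongrightarrow> 0) (at_left 0)"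
      by (rule tendsto_eventually) (auto simp: flat_fun_def eventually_at_filter)
    show ?thesis
      using filterlim_split_at[OF L R] 2 by (simp add: DERIV_def flat_fun_def)
  next
    case 3
    have "((\<lambda>x. poly P (1 / x) * exp (- (1 / x))) has_real_derivative
        poly ([:0, 0, 1:] * (P - pderiv P)) (1 / x) * exp (- (1 / x))) (at x)"
      using 3 by (auto intro!: derivative_eq_intros simp: field_simps power2_eq_square)
    then have "(flat_fun P has_real_derivative
        poly ([:0, 0, 1:] * (P - pderiv P)) (1 / x) * exp (- (1 / x))) (at x)"
      by (rule DERIV_cong_ev[THEN iffD1, rotated 3])
        (use 3 in \<open>auto simp: flat_fun_def eventually_nhds intro!: exI[of _ "{0<..}"]\<close>)
    then show ?thesis using 3 by (simp add: flat_fun_def)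
  qed
qed

lemma Ck_on_flat_fun: "Ck_on k UNIV (flat_fun P)"
proof (induction k arbitrary: P)
  case 0 then show ?case
    using DERIV_isCont[OF flat_fun_has_derivative] by (simp add: continuous_at_imp_continuous_on)
next
  case (Suc k) then show ?case by (intro Ck_on_real_derivI[OF flat_fun_has_derivative])
qed

text \<open>Nesting the flat function in itself makes the only denominator a constant, so smoothness
  reduces to compositions. The inner difference is at most 0 for x >= 1 and equals
  \<open>flat_fun 1 1\<close> for x <= 0.\<close>

definition smooth_step :: "real \<Rightarrow> real" where
  "smooth_step x = 1 - flat_fun 1 (flat_fun 1 1 - flat_fun 1 x) / flat_fun 1 (flat_fun 1 1)"

lemma flat_fun_1_mono: "x \<le> y \<Longrightarrow> flat_fun 1 x \<le> flat_fun 1 y"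
  by (auto simp: flat_fun_def field_simps)

lemma flat_fun_1_nonneg: "0 \<le> flat_fun 1 x"
  by (auto simp: flat_fun_def)

lemma smooth_step_0: "x \<le> 0 \<Longrightarrow> smooth_step x = 0"
  by (auto simp: smooth_step_def flat_fun_def)

lemma smooth_step_1: "x \<ge> 1 \<Longrightarrow> smooth_step x = 1"
  using flat_fun_1_mono[of 1 x] by (auto simp: smooth_step_def flat_fun_def[of _ "_ - _"])

lemma smooth_step_range: "0 \<le> smooth_step x" "smooth_step x \<le> 1"
proof -
  have p: "flat_fun 1 (flat_fun 1 1) > 0" by (auto simp: flat_fun_def)
  have "flat_fun 1 (flat_fun 1 1 - flat_fun 1 x) \<le> flat_fun 1 (flat_fun 1 1)"
    using flat_fun_1_nonneg[of x] by (intro flat_fun_1_mono) simp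
  then show "0 \<le> smooth_step x" using p by (simp add: smooth_step_def)
  show "smooth_step x \<le> 1"
    using p flat_fun_1_nonneg by (simp add: smooth_step_def)
qed

lemma Ck_on_minus:
  "open S \<Longrightarrow> Ck_on k S f \<Longrightarrow> Ck_on k S g \<Longrightarrow> Ck_on k S (\<lambda>x. f x - g x)"
  using Ck_on_add[of S k f "\<lambda>x. - g x"] Ck_on_bounded_linear[of S uminus k g]
  by (simp add: bounded_linear_minus bounded_linear_ident)

lemma Ck_on_ident: "open S \<Longrightarrow> Ck_on k S (\<lambda>x. x)"
  by (simp add: Ck_on_linear bounded_linear_ident)

lemma Ck_on_compose_UNIV:
  fixes f :: "'a::real_normed_vector \<Rightarrow> 'b::euclidean_space" and g :: "'b \<Rightarrow> 'c::real_normed_vector"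
  shows "open S \<Longrightarrow> Ck_on k S f \<Longrightarrow> Ck_on k UNIV g \<Longrightarrow> Ck_on k S (\<lambda>x. g (f x))"
  by (rule Ck_on_compose[of S UNIV]) auto

lemma Ck_on_divide_const:
  fixes f :: "'a::real_normed_vector \<Rightarrow> real"
  shows "open S \<Longrightarrow> Ck_on k S f \<Longrightarrow> Ck_on k S (\<lambda>x. f x / c)"
  using Ck_on_bounded_linear[of S "\<lambda>x. x / c" k f] bounded_linear_divide[of c] by simp

lemmas Ck_on_intros = Ck_on_const Ck_on_ident Ck_on_add Ck_on_minus Ck_on_mult Ck_on_divide_const

lemma Ck_on_smooth_step: "Ck_on k UNIV smooth_step"
  unfolding smooth_step_def[abs_def]
  by (intro Ck_on_intros Ck_on_compose_UNIV[OF _ _ Ck_on_flat_fun] open_UNIV)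

section \<open>Maps that collapse the ends of an interval\<close>

lemma smooth_deriv:
  fixes f :: "real \<Rightarrow> real"
  assumes "\<And>k. Ck_on k UNIV f"
  shows "(f has_real_derivative deriv f x) (at x)" and "Ck_on k UNIV (deriv f)"
proof -
  have "f differentiable at x" for x
    using assms[of "Suc 0"] by (simp add: Ck_on.simps(2))
  then show D: "(f has_real_derivative deriv f x) (at x)" for x
    by (metis DERIV_deriv_iff_real_differentiable)
  show "Ck_on k UNIV (deriv f)"
    using Ck_on_real_deriv[OF D assms] .
qed

text \<open>\<open>\<phi>\<close> collapses the two ends of [0, l] to the end points;
  \<open>\<phi>1\<close> and \<open>\<phi>2\<close> are its derivatives. The constant C is meant to
  be independent of e and l. The last bound pairs the size 1/e of \<open>\<phi>2\<close> with the
  distance of \<open>\<phi> x\<close> to the end points, where a velocity vanishing on the boundary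
  gains a factor e. The derivative \<open>\<phi>1\<close> also serves as a cutoff: it is 1 in the
  core and 0 near the ends, with slope at most C / e.\<close>

definition cutoff_map :: "real \<Rightarrow> real \<Rightarrow> real \<Rightarrow> (real \<Rightarrow> real) \<Rightarrow> (real \<Rightarrow> real) \<Rightarrow> (real \<Rightarrow> real) \<Rightarrow> bool" where
  "cutoff_map C l e \<phi> \<phi>1 \<phi>2 \<longleftrightarrow>
    (\<forall>k. Ck_on k UNIV \<phi>) \<and> (\<forall>k. Ck_on k UNIV \<phi>1) \<and>
    (\<forall>x. (\<phi> has_real_derivative \<phi>1 x) (at x)) \<and> (\<forall>x. (\<phi>1 has_real_derivative \<phi>2 x) (at x)) \<and>
    (\<forall>x. 0 \<le> \<phi> x \<and> \<phi> x \<le> l) \<and>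
    (\<forall>x. 2 * e \<le> x \<and> x \<le> l - 2 * e \<longrightarrow> \<phi> x = x \<and> \<phi>1 x = 1 \<and> \<phi>2 x = 0) \<and>
    (\<forall>x\<le>e. \<phi> x = 0 \<and> \<phi>1 x = 0 \<and> \<phi>2 x = 0) \<and>
    (\<forall>x\<ge>l - e. \<phi> x = l \<and> \<phi>1 x = 0 \<and> \<phi>2 x = 0) \<and>
    (\<forall>x. \<bar>\<phi>1 x\<bar> \<le> C \<and> \<bar>\<phi>2 x\<bar> \<le> C / e \<and> \<bar>\<phi>2 x\<bar> * min (\<phi> x) (l - \<phi> x) \<le> C)"

text \<open>Derivatives are first computed on open half-lines; continuity carries their value to the
  end point.\<close>

lemma continuous_eq_extend:
  fixes f :: "real \<Rightarrow> real"
  assumes "continuous_on UNIV f"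
  shows "(\<And>y. y < b \<Longrightarrow> f y = c) \<Longrightarrow> f b = c" and "(\<And>y. y > b \<Longrightarrow> f y = c) \<Longrightarrow> f b = c"
proof -
  have cl: "closed {y. f y = c}"
    using assms by (intro closed_Collect_eq) auto
  show "f b = c" if "\<And>y. y < b \<Longrightarrow> f y = c"
  proof -
    have "closure {..<b} \<subseteq> {y. f y = c}" using that cl by (intro closure_minimal) auto
    then show ?thesis by (auto simp: closure_lessThan)
  qed
  show "f b = c" if "\<And>y. y > b \<Longrightarrow> f y = c"
  proof -
    have "closure {b<..} \<subseteq> {y. f y = c}" using that cl by (intro closure_minimal) auto
    then show ?thesis by (auto simp: closure_greaterThan)
  qed
qed

lemma deriv_on_open:
  fixes f g :: "real \<Rightarrow> real"
  assumes "open U" "x \<in> U" "\<And>y. y \<in> U \<Longrightarrow> f y = g y"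
  shows "deriv f x = deriv g x"
  using assms by (intro deriv_cong_ev) (auto simp: eventually_nhds)

text \<open>A fixed profile P, zero up to 1 and the identity from 2 on, is rescaled to e P(x/e). The
  bound on its slope does not depend on e, and its second derivative scales like 1/e.\<close>

lemma cutoff_map_exists:
  obtains C where "C \<ge> (1::real)"
    "\<And>l e. 0 < e \<Longrightarrow> 4 * e < l \<Longrightarrow> \<exists>\<phi> \<phi>1 \<phi>2. cutoff_map C l e \<phi> \<phi>1 \<phi>2"
proof -
  define P where "P y = y * smooth_step (y - 1)" for y
  define P1 where "P1 = deriv P"
  define P2 where "P2 = deriv P1"
  have smP: "Ck_on k UNIV P" for k
    unfolding P_def[abs_def]
    by (intro Ck_on_intros Ck_on_compose_UNIV[OF _ _ Ck_on_smooth_step] open_UNIV)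
  have smP1: "Ck_on k UNIV P1" for k unfolding P1_def using smooth_deriv(2)[OF smP] .
  have smP2: "Ck_on k UNIV P2" for k unfolding P2_def using smooth_deriv(2)[OF smP1] .
  have dP [derivative_intros]: "(P has_real_derivative P1 x) (at x)" for x
    unfolding P1_def using smooth_deriv(1)[OF smP] .
  have dP1 [derivative_intros]: "(P1 has_real_derivative P2 x) (at x)" for x
    unfolding P2_def using smooth_deriv(1)[OF smP1] .
  have cP1: "continuous_on UNIV P1" and cP2: "continuous_on UNIV P2" using smP1[of 0] smP2[of 0] by auto
  have P0: "P y = 0" if "y \<le> 1" for y using that by (simp add: P_def smooth_step_0)
  have Pid: "P y = y" if "y \<ge> 2" for y using that by (simp add: P_def smooth_step_1)
  have Pr: "0 \<le> P y \<and> P y \<le> y" if "y \<ge> 0" for y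
    using that smooth_step_range[of "y - 1"] by (auto simp: P_def mult_left_le)
  have "P1 y = 0" if "y < 1" for y
    unfolding P1_def using deriv_on_open[of "{..<1}" y P "\<lambda>y. 0"] that P0 by auto
  then have P10: "P1 y = 0" if "y \<le> 1" for y using continuous_eq_extend(1)[OF cP1, of 1 0] that
    by (cases "y = 1") auto
  have "P1 y = 1" if "y > 2" for y
    unfolding P1_def using deriv_on_open[of "{2<..}" y P "\<lambda>y. y"] that Pid by auto
  then have P11: "P1 y = 1" if "y \<ge> 2" for y using continuous_eq_extend(2)[OF cP1, of 2 1] that
    by (cases "y = 2") auto
  have "P2 y = 0" if "y < 1" for y
    unfolding P2_def using deriv_on_open[of "{..<1}" y P1 "\<lambda>y. 0"] that P10 by auto
  then have P20: "P2 y = 0" if "y \<le> 1" for y using continuous_eq_extend(1)[OF cP2, of 1 0] that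
    by (cases "y = 1") auto
  have "P2 y = 0" if "y > 2" for y
    unfolding P2_def using deriv_on_open[of "{2<..}" y P1 "\<lambda>y. 1"] that P11 by auto
  then have P21: "P2 y = 0" if "y \<ge> 2" for y using continuous_eq_extend(2)[OF cP2, of 2 0] that
    by (cases "y = 2") auto
  have "bounded (P1 ` {1..2})"
    by (intro compact_imp_bounded compact_continuous_image continuous_on_subset[OF cP1]) auto
  then obtain A where "\<forall>y\<in>{1..2}. \<bar>P1 y\<bar> \<le> A"
    by (auto simp: bounded_iff)
  then have A: "\<And>y. y \<in> {1..2} \<Longrightarrow> \<bar>P1 y\<bar> \<le> A" by blast
  have "bounded (P2 ` {1..2})"
    by (intro compact_imp_bounded compact_continuous_image continuous_on_subset[OF cP2]) auto
  then obtain B where "\<forall>y\<in>{1..2}. \<bar>P2 y\<bar> \<le> B"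
    by (auto simp: bounded_iff)
  then have B: "\<And>y. y \<in> {1..2} \<Longrightarrow> \<bar>P2 y\<bar> \<le> B" by blast
  define D where "D = max 1 (max A B)"
  have D: "D \<ge> 1" "\<bar>P1 y\<bar> \<le> D" "\<bar>P2 y\<bar> \<le> D" for y
    using A[of y] B[of y] P10[of y] P11[of y] P20[of y] P21[of y]
    unfolding D_def by (auto, (smt (verit))+)
  have "\<exists>\<phi> \<phi>1 \<phi>2. cutoff_map (4 * D + 1) l e \<phi> \<phi>1 \<phi>2" if e: "0 < e" "4 * e < l" for l e
  proof -
    \<comment> \<open>In the left half the last two terms cancel and e P(x/e) remains; in the right
      half the first term is x, and the result is l minus the mirror image. Since 4 e < l, the two
      transition zones are disjoint.\<close>
    define \<phi> where "\<phi> x = e * P (x / e) + (l - x) - e * P ((l - x) / e)" for x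
    define \<phi>1 where "\<phi>1 x = P1 (x / e) - 1 + P1 ((l - x) / e)" for x
    define \<phi>2 where "\<phi>2 x = (P2 (x / e) - P2 ((l - x) / e)) / e" for x
    have 1: "Ck_on k UNIV \<phi>" "Ck_on k UNIV \<phi>1" for k
      unfolding \<phi>_def[abs_def] \<phi>1_def[abs_def]
      by (intro Ck_on_intros Ck_on_compose_UNIV[OF _ _ smP] Ck_on_compose_UNIV[OF _ _ smP1] open_UNIV)+
    have 2: "(\<phi> has_real_derivative \<phi>1 x) (at x)" for x
      unfolding \<phi>_def[abs_def] \<phi>1_def using e
      by (auto intro!: derivative_eq_intros DERIV_chain2[OF dP] simp: field_simps)
    have 3: "(\<phi>1 has_real_derivative \<phi>2 x) (at x)" for x
      unfolding \<phi>1_def[abs_def] \<phi>2_def using e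
      by (auto intro!: derivative_eq_intros DERIV_chain2[OF dP1] simp: field_simps)
    have 4: "\<phi> x = x \<and> \<phi>1 x = 1 \<and> \<phi>2 x = 0" if "2 * e \<le> x" "x \<le> l - 2 * e" for x
      using that e by (auto simp: \<phi>_def \<phi>1_def \<phi>2_def Pid P11 P21 field_simps)
    have 5: "\<phi> x = 0 \<and> \<phi>1 x = 0 \<and> \<phi>2 x = 0" if "x \<le> e" for x
      using that e by (auto simp: \<phi>_def \<phi>1_def \<phi>2_def Pid P11 P21 P0 P10 P20 field_simps)
    have 6: "\<phi> x = l \<and> \<phi>1 x = 0 \<and> \<phi>2 x = 0" if "x \<ge> l - e" for x
      using that e by (auto simp: \<phi>_def \<phi>1_def \<phi>2_def Pid P11 P21 P0 P10 P20 field_simps)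
    have Pe: "0 \<le> e * P (z / e) \<and> e * P (z / e) \<le> z" if "z \<ge> 0" for z
      using Pr[of "z / e"] that e by (auto simp: field_simps)
    have 7: "0 \<le> \<phi> x \<and> \<phi> x \<le> l" for x
      using 5[of x] 6[of x] Pe[of x] Pe[of "l - x"] e unfolding \<phi>_def by (smt (verit))
    have 8: "\<bar>\<phi>1 x\<bar> \<le> 4 * D + 1" for x
      using D(1) D(2)[of "x / e"] D(2)[of "(l - x) / e"] unfolding \<phi>1_def by linarith
    have 9: "\<bar>\<phi>2 x\<bar> \<le> 2 * D / e" for x
    proof -
      have "\<bar>P2 (x / e) - P2 ((l - x) / e)\<bar> \<le> 2 * D"
        using D(3)[of "x / e"] D(3)[of "(l - x) / e"] by linarith
      then show ?thesis using e unfolding \<phi>2_def abs_divide by (simp add: divide_right_mono)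
    qed
    have 10: "\<bar>\<phi>2 x\<bar> \<le> (4 * D + 1) / e" for x
      using D(1) e by (intro order_trans[OF 9] divide_right_mono) auto
    have 11: "\<bar>\<phi>2 x\<bar> * min (\<phi> x) (l - \<phi> x) \<le> 4 * D + 1" for x
    proof (cases "2 * e \<le> x \<and> x \<le> l - 2 * e")
      case True then show ?thesis using 4[of x] D(1) by auto
    next
      case False
      \<comment> \<open>Outside the core \<open>\<phi> x\<close> is within 2 e of an end point.
        Together with |\<open>\<phi>2\<close>| <= 2 D / e this gives 4 D; the constant 4 D + 1 also
        covers |\<open>\<phi>1\<close>| <= 2 D + 1.\<close>
      have "min (\<phi> x) (l - \<phi> x) \<le> 2 * e"
      proof (cases "x < 2 * e")
        case True
        then have "P ((l - x) / e) = (l - x) / e" using e by (intro Pid) (simp add: field_simps)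
        then have "\<phi> x = e * P (x / e)" using e by (simp add: \<phi>_def)
        then have "\<phi> x \<le> 2 * e" using Pe[of x] True 5[of x] e by (cases "x \<ge> 0"; linarith)
        then show ?thesis by linarith
      next
        case F2: False
        then have "P (x / e) = x / e" using e by (intro Pid) (simp add: field_simps)
        then have "l - \<phi> x = e * P ((l - x) / e)" using e by (simp add: \<phi>_def)
        then have "l - \<phi> x \<le> 2 * e" using Pe[of "l - x"] F2 False 6[of x] e by (cases "x \<le> l"; linarith)
        then show ?thesis by linarith
      qed
      then have "\<bar>\<phi>2 x\<bar> * min (\<phi> x) (l - \<phi> x) \<le> 2 * D / e * (2 * e)"
        using 9[of x] 7[of x] by (intro mult_mono) auto
      also have "\<dots> \<le> 4 * D + 1" using e by simp
      finally show ?thesis .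
    qed
    have "cutoff_map (4 * D + 1) l e \<phi> \<phi>1 \<phi>2"
      unfolding cutoff_map_def using 1 2 3 4 5 6 7 8 10 11 by blast
    then show ?thesis by blast
  qed
  then show ?thesis using that[of "4 * D + 1"] D(1) by auto
qed

section \<open>The maximum principle for the transport equation\<close>

lemma cube_eq_box: "cube l = box 0 (\<chi> i. l)"
  by (auto simp: cube_def mem_box_cart)

lemma open_cube: "open (cube l)"
  by (simp add: cube_eq_box open_box)

lemma closure_cube:
  assumes "l > 0" shows "closure (cube l) = cbox 0 ((\<chi> i. l)::real^'n)"
proof -
  have "(\<chi> i. l / 2) \<in> box 0 ((\<chi> i. l)::real^'n)" using assms by (simp add: mem_box_cart)
  then have "box 0 ((\<chi> i. l)::real^'n) \<noteq> {}" by blast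
  then show ?thesis unfolding cube_eq_box by (rule closure_box)
qed

lemma mem_closure_cube: "l > 0 \<Longrightarrow> x \<in> closure (cube l) \<longleftrightarrow> (\<forall>i. 0 \<le> x $ i \<and> x $ i \<le> l)"
  by (simp add: closure_cube mem_box_cart)

lemma mem_frontier_cube:
  assumes "x \<in> closure (cube l)" "x $ i = 0 \<or> x $ i = l"
  shows "x \<in> frontier (cube l)"
proof -
  have "x \<notin> cube l" using assms(2) unfolding cube_def by (metis (mono_tags) less_irrefl mem_Collect_eq)
  then show ?thesis using assms(1) by (simp add: frontier_def interior_open[OF open_cube])
qed

text \<open>Turns the slice-wise derivatives in \<open>transport_solution\<close> into values of one
  total derivative A, so that the equation says that A vanishes on the vector (1, u).\<close>

lemma spacetime_derivs:
  fixes \<theta> :: "real \<Rightarrow> real^'n \<Rightarrow> real"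
  assumes "((\<lambda>(s, y). \<theta> s y) has_derivative A) (at (t, x))"
  shows "((\<lambda>s. \<theta> s x) has_real_derivative A (1, 0)) (at t)"
    and "deriv (\<lambda>s. \<theta> s x) t = A (1, 0)"
    and "(\<theta> t has_derivative (\<lambda>w. A (0, w))) (at x)"
    and "w \<bullet> grad (\<theta> t) x = A (0, w)"
proof -
  interpret A: bounded_linear A using assms by (rule has_derivative_bounded_linear)
  have "((\<lambda>s. (s, x)) has_derivative (\<lambda>h. (h, 0))) (at t)"
    by (auto intro!: derivative_eq_intros)
  from has_derivative_compose[OF this] assms
  have 1: "((\<lambda>s. \<theta> s x) has_derivative (\<lambda>h. A (h, 0))) (at t)" by fastforce
  have "(\<lambda>h. A (h, 0)) = (*) (A (1, 0))"
  proof
    show "A (h, 0) = A (1, 0) * h" for h using A.scaleR[of h "(1, 0)"] by simp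
  qed
  with 1 show "((\<lambda>s. \<theta> s x) has_real_derivative A (1, 0)) (at t)"
    by (simp only: has_field_derivative_def)
  then show "deriv (\<lambda>s. \<theta> s x) t = A (1, 0)" by (rule DERIV_imp_deriv)
  have "((\<lambda>y. (t, y)) has_derivative (\<lambda>h. (0, h))) (at x)"
    by (auto intro!: derivative_eq_intros)
  from has_derivative_compose[OF this] assms
  show 2: "(\<theta> t has_derivative (\<lambda>w. A (0, w))) (at x)" by fastforce
  have l: "linear (\<lambda>w. A (0, w))" using 2 has_derivative_linear by blast
  have "A (0, w) = A (0, \<Sum>i\<in>UNIV. (w $ i) *\<^sub>R axis i 1)"
    by (simp add: basis_expansion flip: scalar_mult_eq_scaleR)
  also have "\<dots> = (\<Sum>i\<in>UNIV. w $ i * A (0, axis i 1))"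
    by (simp add: linear_sum[OF l] linear_scale[OF l])
  finally show "w \<bullet> grad (\<theta> t) x = A (0, w)"
    by (simp add: grad_def inner_vec_def frechet_derivative_at[OF 2, symmetric])
qed

text \<open>One backward step of length h for the distance z to a face, with speed q at most L z.
  The inequality (1 - L h) (1 + 2 L h) >= 1, valid for 0 <= L h <= 1/2, explains the factor 2 in the
  exponent: it leaves room for a straight step in place of an exact characteristic.\<close>

lemma expanding_bound_step:
  fixes L :: real
  assumes "\<bar>q\<bar> \<le> L * z" "0 \<le> h" "0 \<le> L" "L * h \<le> 1/2" "0 < z0" "0 < E" "z0 \<le> z * E" "z \<le> z0 * E"
  shows "z0 \<le> (z - h * q) * (E * exp (2 * L * h))" and "z - h * q \<le> z0 * (E * exp (2 * L * h))"
proof -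
  have z: "z > 0" using assms(5-7) by (meson less_le_trans zero_less_mult_pos2)
  have e: "1 + 2 * L * h \<le> exp (2 * L * h)" by (rule exp_ge_add_one_self)
  have hq: "h * q \<le> h * (L * z)" "- (h * (L * z)) \<le> h * q"
    using mult_left_mono[OF assms(1,2)] abs_ge_self[of q] abs_ge_minus_self[of q] assms(2)
    by (smt (verit) mult_left_mono mult_minus_right)+
  have Lh: "0 \<le> L * h" using assms by simp
  have "1 \<le> (1 - L * h) * (1 + 2 * L * h)"
    using mult_left_mono[OF assms(4) Lh] by (simp add: algebra_simps)
  also have "\<dots> \<le> (1 - L * h) * exp (2 * L * h)"
    using e assms(4) by (intro mult_left_mono) auto
  finally have "z * E * 1 \<le> z * E * ((1 - L * h) * exp (2 * L * h))"
    using z assms(6) by (intro mult_left_mono) auto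
  also have "\<dots> = (z - h * (L * z)) * (E * exp (2 * L * h))" by (simp add: algebra_simps)
  also have "\<dots> \<le> (z - h * q) * (E * exp (2 * L * h))"
    using hq assms(6) by (intro mult_right_mono) auto
  finally show "z0 \<le> (z - h * q) * (E * exp (2 * L * h))" using assms(7) by simp
  have "z - h * q \<le> z * (1 + L * h)" using hq by (simp add: algebra_simps)
  also have "\<dots> \<le> (z0 * E) * exp (2 * L * h)"
    using e Lh z assms by (intro mult_mono) (auto intro: order_trans[OF _ e])
  finally show "z - h * q \<le> z0 * (E * exp (2 * L * h))" by (simp add: mult.assoc)
qed

text \<open>The maximum principle on the backward domain of dependence of \<open>(T, x0)\<close>. It is invariant under
  moving backwards in time along the velocity, so a maximum of \<open>\<theta> t x - \<kappa> t\<close> with \<open>\<kappa> > 0\<close>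
  can only be attained at time 0.\<close>
lemma transport_max_principle:
  fixes u :: "real \<Rightarrow> real^'n \<Rightarrow> real^'n"
  assumes sol: "transport_solution l u \<theta>0 \<theta>" and "L \<ge> 0" "T \<ge> 0"
    and bound: "\<And>s x i. 0 \<le> s \<Longrightarrow> s \<le> T \<Longrightarrow> x \<in> cube l \<Longrightarrow> \<bar>u s x $ i\<bar> \<le> L * min (x $ i) (l - x $ i)"
    and x0: "x0 \<in> cube l"
  shows "\<exists>y\<in>cube l. (\<forall>i. y $ i \<le> x0 $ i * exp (2 * L * T) \<and> l - y $ i \<le> (l - x0 $ i) * exp (2 * L * T))
    \<and> \<theta> T x0 \<le> \<theta>0 y"
proof -
  define E where "E s = exp (2 * L * (T - s))" for s
  have Epos: "E s > 0" for s by (simp add: E_def)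
  \<comment> \<open>D compares the distances to all faces with those of \<open>x0\<close>, up to the
    factor E in both directions. The lower bounds on these distances keep D inside the open
    cube.\<close>
  define D where "D = {z. 0 \<le> fst z \<and> fst z \<le> T \<and>
    (\<forall>i. x0 $ i \<le> snd z $ i * E (fst z) \<and> snd z $ i \<le> x0 $ i * E (fst z) \<and>
      l - x0 $ i \<le> (l - snd z $ i) * E (fst z) \<and> l - snd z $ i \<le> (l - x0 $ i) * E (fst z))}"
  have x0p: "0 < x0 $ i" "0 < l - x0 $ i" for i using x0 by (auto simp: cube_def)
  have Dcube: "x \<in> cube l" "0 \<le> s" "s \<le> T" if "(s, x) \<in> D" for s x
  proof -
    have "0 < x $ i * E s" "0 < (l - x $ i) * E s" for i
      using that x0p[of i] unfolding D_def by (auto intro: less_le_trans[of 0 "x0 $ i"] less_le_trans[of 0 "l - x0 $ i"])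
    then have "0 < x $ i" "0 < l - x $ i" for i
      using Epos zero_less_mult_pos2 by blast+
    then show "x \<in> cube l" by (simp add: cube_def)
    show "0 \<le> s" "s \<le> T" using that by (auto simp: D_def)
  qed
  have "closed D"
    unfolding D_def E_def
    by (intro closed_Collect_conj closed_Collect_all closed_Collect_le continuous_intros)
  moreover have "D \<subseteq> {0..T} \<times> cbox 0 (\<chi> i. l)"
    using Dcube by (force simp: mem_box_cart cube_def less_imp_le)
  then have "bounded D" by (rule bounded_subset[rotated]) (intro bounded_Times bounded_cbox bounded_closed_interval)
  ultimately have cD: "compact D" by (simp add: compact_eq_bounded_closed)
  have TD: "(T, x0) \<in> D" using assms(3) by (simp add: D_def E_def)
  define D0 where "D0 = {y. (0, y) \<in> D}"
  have cont: "continuous_on ({0..} \<times> cube l) (\<lambda>(t, x). \<theta> t x)"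
    using sol by (simp add: transport_solution_def)
  have contD: "continuous_on D (\<lambda>(t, x). \<theta> t x)"
    by (rule continuous_on_subset[OF cont]) (use Dcube in auto)
  have step: "\<exists>y\<in>D0. \<theta> T x0 - \<kappa> * T \<le> \<theta>0 y" if "\<kappa> > 0" for \<kappa>
  proof -
    have "continuous_on D (\<lambda>z. (case z of (t, x) \<Rightarrow> \<theta> t x) - \<kappa> * fst z)"
      by (intro continuous_intros contD)
    from continuous_attains_sup[OF cD _ this] TD obtain s x where sx: "(s, x) \<in> D"
      and mx: "\<And>r y. (r, y) \<in> D \<Longrightarrow> \<theta> r y - \<kappa> * r \<le> \<theta> s x - \<kappa> * s"
      by fastforce
    have "s = 0"
    proof (rule ccontr)
      assume "s \<noteq> 0"
      then have s: "s > 0" "s \<le> T" using Dcube[OF sx] by auto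
      note xc = Dcube(1)[OF sx]
      define w where "w = u s x"
      obtain A where A: "((\<lambda>(s, y). \<theta> s y) has_derivative A) (at (s, x))"
        using sol s xc unfolding transport_solution_def differentiable_def by blast
      interpret A: bounded_linear A using A by (rule has_derivative_bounded_linear)
      have "A (1, w) = A (1, 0) + A (0, w)" by (simp add: A.add[symmetric])
      also have "\<dots> = deriv (\<lambda>s. \<theta> s x) s + w \<bullet> grad (\<theta> s) x"
        by (simp add: spacetime_derivs(2,4)[OF A])
      also have "\<dots> = 0" using sol s xc unfolding transport_solution_def w_def by blast
      finally have A0: "A (1, w) = 0" .
      \<comment> \<open>The step runs backwards along the tangent of the characteristic. To first
        order \<open>\<theta>\<close> does not change while -\<open>\<kappa>\<close> s grows, which
        contradicts maximality as long as the step stays in D.\<close>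
      have "((\<lambda>h::real. (s - h, x - h *\<^sub>R w)) has_derivative (\<lambda>h. (- h, - (h *\<^sub>R w)))) (at 0)"
        by (auto intro!: derivative_eq_intros)
      from has_derivative_compose[OF this, of "\<lambda>(s, y). \<theta> s y" A] A
      have "((\<lambda>h. \<theta> (s - h) (x - h *\<^sub>R w)) has_derivative (\<lambda>h. A (- h, - (h *\<^sub>R w)))) (at 0)"
        by simp
      moreover have "A (- h, - (h *\<^sub>R w)) = 0" for h
        using A.scaleR[of "- h" "(1, w)"] A0 by simp
      ultimately have 1: "((\<lambda>h. \<theta> (s - h) (x - h *\<^sub>R w)) has_real_derivative 0) (at 0)"
        by (simp add: has_field_derivative_def lambda_zero)
      have "((\<lambda>h. \<kappa> * (s - h)) has_real_derivative - \<kappa>) (at 0)"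
        by (auto intro!: derivative_eq_intros)
      from DERIV_diff[OF 1 this]
      have "((\<lambda>h. \<theta> (s - h) (x - h *\<^sub>R w) - \<kappa> * (s - h)) has_real_derivative \<kappa>) (at 0)"
        by simp
      from DERIV_pos_inc_right[OF this \<open>\<kappa> > 0\<close>] obtain d where d: "d > 0"
        "\<And>h. h > 0 \<Longrightarrow> h < d \<Longrightarrow> \<theta> s x - \<kappa> * s < \<theta> (s - h) (x - h *\<^sub>R w) - \<kappa> * (s - h)"
        by auto
      \<comment> \<open>The three bounds ensure the strict increase, a nonnegative time and L h <=
        1/2; the denominator has L + 1 because L may be 0.\<close>
      define h where "h = min (d / 2) (min s (1 / (2 * (L + 1))))"
      have h: "h > 0" "h < d" "h \<le> s" using d(1) s assms(2) by (auto simp: h_def)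
      have "L * h \<le> (L + 1) * (1 / (2 * (L + 1)))"
        using assms(2) h(1) by (intro mult_mono) (auto simp: h_def)
      also have "\<dots> = 1 / 2" using assms(2) by (simp add: divide_simps)
      finally have Lh: "L * h \<le> 1 / 2" .
      have Eh: "E (s - h) = E s * exp (2 * L * h)"
        unfolding E_def mult_exp_exp by (simp add: algebra_simps)
      have "(s - h, x - h *\<^sub>R w) \<in> D"
      proof -
        have "x0 $ i \<le> (x - h *\<^sub>R w) $ i * E (s - h) \<and> (x - h *\<^sub>R w) $ i \<le> x0 $ i * E (s - h) \<and>
          l - x0 $ i \<le> (l - (x - h *\<^sub>R w) $ i) * E (s - h) \<and> l - (x - h *\<^sub>R w) $ i \<le> (l - x0 $ i) * E (s - h)" for i
        proof -
          have b: "\<bar>w $ i\<bar> \<le> L * (x $ i)" "\<bar>- (w $ i)\<bar> \<le> L * (l - x $ i)"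
            using bound[of s x i] s xc mult_left_mono[OF min.cobounded1[of "x $ i" "l - x $ i"] assms(2)]
              mult_left_mono[OF min.cobounded2[of "x $ i" "l - x $ i"] assms(2)] by (auto simp: w_def)
          have d: "x0 $ i \<le> x $ i * E s" "x $ i \<le> x0 $ i * E s"
            "l - x0 $ i \<le> (l - x $ i) * E s" "l - x $ i \<le> (l - x0 $ i) * E s"
            using sx by (auto simp: D_def)
          have eq: "l - (x - h *\<^sub>R w) $ i = (l - x $ i) - h * (- (w $ i))" by simp
          show ?thesis
            unfolding eq Eh
            using expanding_bound_step[OF b(1) less_imp_le[OF h(1)] assms(2) Lh x0p(1) Epos d(1,2)]
              expanding_bound_step[OF b(2) less_imp_le[OF h(1)] assms(2) Lh x0p(2) Epos d(3,4)]
            by simp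
        qed
        then show ?thesis using h s by (simp add: D_def)
      qed
      from mx[OF this] d(2)[OF h(1,2)] show False by simp
    qed
    then have "x \<in> D0" "\<theta> 0 x = \<theta>0 x" using sx Dcube[OF sx] sol by (auto simp: D0_def transport_solution_def)
    moreover have "\<theta> T x0 - \<kappa> * T \<le> \<theta> s x - \<kappa> * s" using mx[OF TD] .
    ultimately show ?thesis using \<open>s = 0\<close> by auto
  qed
  have D0im: "D0 = snd ` (D \<inter> {0} \<times> UNIV)" by (force simp: D0_def)
  have "compact D0" unfolding D0im
    by (intro compact_continuous_image continuous_intros compact_Int_closed cD closed_Times)
  moreover have "D0 \<noteq> {}" using step[of 1] by auto
  moreover have "continuous_on D0 (\<lambda>y. (case (0, y) of (t, x) \<Rightarrow> \<theta> t x))"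
    by (rule continuous_on_compose2[OF contD continuous_on_Pair[OF continuous_on_const continuous_on_id]])
      (auto simp: D0_def)
  ultimately obtain y where y: "y \<in> D0" "\<And>z. z \<in> D0 \<Longrightarrow> \<theta> 0 z \<le> \<theta> 0 y"
    using continuous_attains_sup[of D0 "\<lambda>y. \<theta> 0 y"] by (simp, blast)
  have D0c: "z \<in> cube l" if "z \<in> D0" for z using that Dcube by (auto simp: D0_def)
  have eq0: "\<theta> 0 z = \<theta>0 z" if "z \<in> D0" for z
    using sol D0c[OF that] by (auto simp: transport_solution_def)
  \<comment> \<open>y maximises the datum on the compact slice \<open>D0\<close>, so it does not
    depend on \<open>\<kappa>\<close>, which can now tend to 0.\<close>
  have "\<theta> T x0 \<le> \<theta>0 y"
  proof (rule field_le_epsilon)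
    fix e :: real assume "e > 0"
    define \<kappa> where "\<kappa> = e / (T + 1)"
    have k: "\<kappa> > 0" "\<kappa> * T \<le> e" using \<open>e > 0\<close> assms(3) by (auto simp: \<kappa>_def field_simps)
    from step[OF k(1)] obtain z where "z \<in> D0" "\<theta> T x0 - \<kappa> * T \<le> \<theta>0 z" by blast
    then show "\<theta> T x0 \<le> \<theta>0 y + e" using y(2)[of z] eq0[of z] eq0[OF y(1)] k by simp
  qed
  moreover have "y $ i \<le> x0 $ i * exp (2 * L * T) \<and> l - y $ i \<le> (l - x0 $ i) * exp (2 * L * T)" for i
    using y(1) by (auto simp: D0_def D_def E_def)
  ultimately show ?thesis using D0c[OF y(1)] by blast
qed

text \<open>Gives the minimum principle, and so a bound for |\<open>\<theta>\<close>|, from the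
  maximum principle.\<close>

lemma transport_solution_minus:
  fixes u :: "real \<Rightarrow> real^'n \<Rightarrow> real^'n"
  assumes "transport_solution l u \<theta>0 \<theta>"
  shows "transport_solution l u (\<lambda>x. - \<theta>0 x) (\<lambda>t x. - \<theta> t x)"
  unfolding transport_solution_def
proof (intro conjI allI impI ballI)
  have "continuous_on ({0..} \<times> cube l) (\<lambda>z. - (case z of (t, x) \<Rightarrow> \<theta> t x))"
    using assms by (intro continuous_intros) (simp add: transport_solution_def)
  then show "continuous_on ({0..} \<times> cube l) (\<lambda>(t, x). - \<theta> t x)"
    by (simp add: case_prod_unfold)
next
  fix t :: real and x :: "real^'n" assume t: "t > 0" "x \<in> cube l"
  obtain A where A: "((\<lambda>(s, y). \<theta> s y) has_derivative A) (at (t, x))"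
    using assms t unfolding transport_solution_def differentiable_def by blast
  have mA: "((\<lambda>(s, y). - \<theta> s y) has_derivative (\<lambda>h. - A h)) (at (t, x))"
    using has_derivative_minus[OF A] by (simp add: case_prod_unfold)
  then show "(\<lambda>(s, y). - \<theta> s y) differentiable at (t, x)" by (auto simp: differentiable_def)
  have "deriv (\<lambda>s. \<theta> s x) t + u t x \<bullet> grad (\<theta> t) x = 0"
    using assms t unfolding transport_solution_def by blast
  then show "deriv (\<lambda>s. - \<theta> s x) t + u t x \<bullet> grad (\<lambda>x. - \<theta> t x) x = 0"
    by (simp add: spacetime_derivs(2,4)[OF A] spacetime_derivs(2,4)[OF mA])
next
  show "\<And>x. x \<in> cube l \<Longrightarrow> - \<theta> 0 x = - \<theta>0 x" using assms by (auto simp: transport_solution_def)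
qed

section \<open>The Poincare inequality on the cube\<close>

lemma lborel_scale:
  assumes "c > 0"
  shows "(lborel::(real^'n) measure) = density (distr lborel borel (\<lambda>x. t + c *\<^sub>R x)) (\<lambda>_. ennreal (c ^ CARD('n)))"
  using lborel_affine[where 'a="real^'n" and c=c and t=t] assms by simp

lemma nn_integral_scale:
  fixes f :: "real^'n \<Rightarrow> ennreal"
  assumes [measurable]: "f \<in> borel_measurable borel" and "c > 0"
  shows "(\<integral>\<^sup>+x. f x \<partial>lborel) = ennreal (c ^ CARD('n)) * (\<integral>\<^sup>+x. f (t + c *\<^sub>R x) \<partial>lborel)"
  by (subst lborel_scale[OF assms(2), of t])
    (simp add: nn_integral_density nn_integral_distr nn_integral_cmult)

lemma nn_integral_scale_le:
  fixes f :: "real^'n \<Rightarrow> ennreal"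
  assumes [measurable]: "f \<in> borel_measurable borel" and "c \<ge> 1 / 2"
  shows "(\<integral>\<^sup>+x. f (t + c *\<^sub>R x) \<partial>lborel) \<le> 2 ^ CARD('n) * (\<integral>\<^sup>+x. f x \<partial>lborel)"
proof -
  let ?I = "\<integral>\<^sup>+x. f (t + c *\<^sub>R x) \<partial>lborel"
  have "1 \<le> (2 * c) ^ CARD('n)" using assms(2) by (intro one_le_power) simp
  then have "?I \<le> ennreal ((2 * c) ^ CARD('n)) * ?I"
    using mult_right_mono[of 1 "ennreal ((2 * c) ^ CARD('n))" ?I] by simp
  also have "\<dots> = 2 ^ CARD('n) * (ennreal (c ^ CARD('n)) * ?I)"
    using assms(2) by (simp add: power_mult_distrib ennreal_mult mult.assoc flip: ennreal_power)
  also have "\<dots> = 2 ^ CARD('n) * (\<integral>\<^sup>+x. f x \<partial>lborel)"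
    using nn_integral_scale[OF assms(1), of c t] assms(2) by simp
  finally show ?thesis .
qed

lemma integral_scale:
  fixes f :: "real^'n \<Rightarrow> real"
  assumes [measurable]: "f \<in> borel_measurable borel" and "c > 0"
  shows "(\<integral>x. f x \<partial>lborel) = c ^ CARD('n) * (\<integral>x. f (t + c *\<^sub>R x) \<partial>lborel)"
  by (subst lborel_scale[OF assms(2), of t])
    (use assms(2) in \<open>simp add: integral_density integral_distr\<close>)

lemma convex_cube: "convex (cube l)"
  by (simp add: cube_eq_box convex_box)

lemma emeasure_cube: "l > 0 \<Longrightarrow> emeasure lborel (cube l :: (real^'n) set) = ennreal (l ^ CARD('n))"
proof -
  assume l: "l > 0"
  have "emeasure lborel (box 0 ((\<chi> i. l)::real^'n)) = ennreal (\<Prod>b\<in>Basis. ((\<chi> i. l)::real^'n) \<bullet> b)"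
    using l by (subst emeasure_lborel_box) (auto simp: Basis_vec_def inner_axis)
  also have "(\<Prod>b\<in>Basis. ((\<chi> i. l)::real^'n) \<bullet> b) = (\<Prod>b\<in>(Basis::(real^'n) set). l)"
    by (intro prod.cong) (auto simp: Basis_vec_def inner_axis)
  finally show ?thesis by (simp add: cube_eq_box)
qed

lemma cube_borel [measurable]: "cube l \<in> sets borel"
  by (rule borel_open[OF open_cube])

text \<open>For fixed s the point y + s (x - y) is affine in x with factor s and in y with factor 1
  - s. One of the two factors is at least 1/2; integrating first in that variable costs a Jacobian
  of at most 2^n, and the other variable contributes the volume l^n. Convexity keeps the point in
  the cube.\<close>

lemma nn_integral_two_point:
  fixes F :: "real^'n \<Rightarrow> ennreal"
  assumes [measurable]: "F \<in> borel_measurable borel" and l: "l > 0" and s: "0 \<le> s" "s \<le> 1"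
  shows "(\<integral>\<^sup>+y. \<integral>\<^sup>+x. indicator (cube l) x * indicator (cube l) y * F (y + s *\<^sub>R (x - y)) \<partial>lborel \<partial>lborel)
    \<le> ennreal ((2 * l) ^ CARD('n)) * (\<integral>\<^sup>+x. indicator (cube l) x * F x \<partial>lborel)"
    (is "?I \<le> _ * ?N")
proof -
  let ?F = "\<lambda>x. indicator (cube l) x * F x"
  have split: "indicator (cube l) x * indicator (cube l) y * F (y + s *\<^sub>R (x - y))
    \<le> indicator (cube l) x * indicator (cube l) y * ?F (y + s *\<^sub>R (x - y))" for x y
  proof (cases "x \<in> cube l \<and> y \<in> cube l")
    case True
    have "(1 - s) *\<^sub>R y + s *\<^sub>R x \<in> cube l"
      using convexD[OF convex_cube[of l], of y x "1 - s" s] True s by auto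
    then have "y + s *\<^sub>R (x - y) \<in> cube l" by (simp add: algebra_simps)
    then show ?thesis using True by simp
  qed (auto simp: indicator_def)
  have *: "(\<integral>\<^sup>+y. indicator (cube l) y * (2 ^ CARD('n) * ?N) \<partial>(lborel::(real^'n) measure)) = ennreal ((2 * l) ^ CARD('n)) * ?N"
    using l by (simp add: nn_integral_multc emeasure_cube power_mult_distrib ennreal_mult mult_ac flip: ennreal_power)
  have eq1: "y + s *\<^sub>R (x - y) = (1 - s) *\<^sub>R y + s *\<^sub>R x" for x y :: "real^'n" by (simp add: algebra_simps)
  have eq2: "y + s *\<^sub>R (x - y) = s *\<^sub>R x + (1 - s) *\<^sub>R y" for x y :: "real^'n" by (simp add: algebra_simps)
  show ?thesis
  proof (cases "s \<ge> 1 / 2")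
    case True
    have "?I \<le> (\<integral>\<^sup>+y. indicator (cube l :: (real^'n) set) y * (2 ^ CARD('n) * ?N) \<partial>lborel)"
    proof (intro nn_integral_mono)
      fix y :: "real^'n"
      have "(\<integral>\<^sup>+x. indicator (cube l) x * indicator (cube l) y * F (y + s *\<^sub>R (x - y)) \<partial>lborel)
        \<le> (\<integral>\<^sup>+x. indicator (cube l) y * ?F ((1 - s) *\<^sub>R y + s *\<^sub>R x) \<partial>lborel)"
        unfolding eq1[symmetric] by (intro nn_integral_mono order_trans[OF split]) (auto simp: indicator_def)
      also have "\<dots> = indicator (cube l) y * (\<integral>\<^sup>+x. ?F ((1 - s) *\<^sub>R y + s *\<^sub>R x) \<partial>lborel)"
        by (rule nn_integral_cmult) simp
      also have "\<dots> \<le> indicator (cube l) y * (2 ^ CARD('n) * ?N)"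
        using True by (intro mult_left_mono nn_integral_scale_le) auto
      finally show "(\<integral>\<^sup>+x. indicator (cube l) x * indicator (cube l) y * F (y + s *\<^sub>R (x - y)) \<partial>lborel)
        \<le> indicator (cube l) y * (2 ^ CARD('n) * ?N)" .
    qed
    then show ?thesis unfolding * .
  next
    case False
    have "?I = (\<integral>\<^sup>+x. \<integral>\<^sup>+y. indicator (cube l) x * indicator (cube l) y * F (y + s *\<^sub>R (x - y)) \<partial>lborel \<partial>lborel)"
      by (rule lborel_pair.Fubini') measurable
    also have "\<dots> \<le> (\<integral>\<^sup>+x. indicator (cube l :: (real^'n) set) x * (2 ^ CARD('n) * ?N) \<partial>lborel)"
    proof (intro nn_integral_mono)
      fix x :: "real^'n"
      have "(\<integral>\<^sup>+y. indicator (cube l) x * indicator (cube l) y * F (y + s *\<^sub>R (x - y)) \<partial>lborel)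
        \<le> (\<integral>\<^sup>+y. indicator (cube l) x * ?F (s *\<^sub>R x + (1 - s) *\<^sub>R y) \<partial>lborel)"
        unfolding eq2[symmetric] by (intro nn_integral_mono order_trans[OF split]) (auto simp: indicator_def)
      also have "\<dots> = indicator (cube l) x * (\<integral>\<^sup>+y. ?F (s *\<^sub>R x + (1 - s) *\<^sub>R y) \<partial>lborel)"
        by (rule nn_integral_cmult) simp
      also have "\<dots> \<le> indicator (cube l) x * (2 ^ CARD('n) * ?N)"
        using False by (intro mult_left_mono nn_integral_scale_le) auto
      finally show "(\<integral>\<^sup>+y. indicator (cube l) x * indicator (cube l) y * F (y + s *\<^sub>R (x - y)) \<partial>lborel)
        \<le> indicator (cube l) x * (2 ^ CARD('n) * ?N)" .
    qed
    finally show ?thesis unfolding * .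
  qed
qed

lemma segment_increment_le:
  fixes g :: "real^'n \<Rightarrow> real" and G :: "real^'n \<Rightarrow> real^'n"
  assumes dg: "\<And>x. (g has_derivative (\<lambda>w. w \<bullet> G x)) (at x)" and cG: "continuous_on UNIV G"
  shows "ennreal ((g x - g y)\<^sup>2) \<le>
    ennreal ((norm (x - y))\<^sup>2) * (\<integral>\<^sup>+s. indicator {0..1} s * ennreal ((norm (G (y + s *\<^sub>R (x - y))))\<^sup>2) \<partial>lborel)"
proof -
  define q where "q s = (x - y) \<bullet> G (y + s *\<^sub>R (x - y))" for s
  have cq: "continuous_on S q" for S
    unfolding q_def[abs_def]
    by (intro continuous_intros continuous_on_compose2[OF cG]) auto
  have "(q has_integral g (y + 1 *\<^sub>R (x - y)) - g (y + 0 *\<^sub>R (x - y))) {0..1}"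
  proof (rule fundamental_theorem_of_calculus)
    fix s :: real
    have "((\<lambda>s. y + s *\<^sub>R (x - y)) has_derivative (\<lambda>h. h *\<^sub>R (x - y))) (at s)"
      by (auto intro!: derivative_eq_intros)
    from has_derivative_compose[OF this dg]
    have "((\<lambda>s. g (y + s *\<^sub>R (x - y))) has_derivative (\<lambda>h. h *\<^sub>R q s)) (at s)"
      by (simp add: q_def)
    then show "((\<lambda>s. g (y + s *\<^sub>R (x - y))) has_vector_derivative q s) (at s within {0..1})"
      unfolding has_vector_derivative_def by (rule has_derivative_at_withinI)
  qed simp
  then have q1: "(q has_integral g x - g y) {0..1}" by simp
  define m where "m = g x - g y"
  define Q where "Q = integral {0..1} (\<lambda>s. (q s)\<^sup>2)"
  have q2: "((\<lambda>s. (q s)\<^sup>2) has_integral Q) {0..1}"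
    unfolding Q_def by (intro integrable_integral integrable_continuous_interval continuous_intros cq)
  \<comment> \<open>Integrating (q - m)^2 >= 0, where m is the mean of q over [0, 1], is
    Cauchy-Schwarz on the segment.\<close>
  have "((\<lambda>s. (q s)\<^sup>2 - 2 * m * q s + m\<^sup>2) has_integral (Q - 2 * m * m + m\<^sup>2)) {0..1}"
    using q1 q2 has_integral_const_real[of "m\<^sup>2" 0 1] unfolding m_def
    by (intro has_integral_add has_integral_diff has_integral_mult_right) auto
  then have "0 \<le> Q - 2 * m * m + m\<^sup>2"
    by (rule has_integral_nonneg) (use zero_le_power2[of "q _ - m"] in \<open>simp add: power2_diff algebra_simps\<close>)
  then have mQ: "m\<^sup>2 \<le> Q" by (simp add: power2_eq_square)
  have q2': "((\<lambda>s. indicator {0..1} s * (q s)\<^sup>2) has_integral Q) UNIV"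
  proof -
    have "(\<lambda>s. indicator {0..1} s * (q s)\<^sup>2) = (\<lambda>s. if s \<in> {0..1} then (q s)\<^sup>2 else 0)"
      by (auto simp: indicator_def)
    then show ?thesis using q2 by (simp only: has_integral_restrict_UNIV)
  qed
  have [measurable]: "q \<in> borel_measurable borel"
    by (rule borel_measurable_continuous_onI[OF cq])
  have [measurable]: "G \<in> borel_measurable borel"
    by (rule borel_measurable_continuous_onI[OF cG])
  have "ennreal (m\<^sup>2) \<le> ennreal Q" using mQ by (rule ennreal_leI)
  also have "\<dots> = (\<integral>\<^sup>+s. ennreal (indicator {0..1} s * (q s)\<^sup>2) \<partial>lborel)"
    using nn_integral_has_integral_lborel[OF _ _ q2'] by simp
  also have "\<dots> \<le> (\<integral>\<^sup>+s. ennreal ((norm (x - y))\<^sup>2) * (indicator {0..1} s * ennreal ((norm (G (y + s *\<^sub>R (x - y))))\<^sup>2)) \<partial>lborel)"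
  proof (rule nn_integral_mono)
    fix s :: real
    have "\<bar>q s\<bar> \<le> norm (x - y) * norm (G (y + s *\<^sub>R (x - y)))"
      unfolding q_def by (rule Cauchy_Schwarz_ineq2)
    then have "\<bar>q s\<bar>\<^sup>2 \<le> (norm (x - y) * norm (G (y + s *\<^sub>R (x - y))))\<^sup>2"
      by (intro power_mono) auto
    then have "(q s)\<^sup>2 \<le> (norm (x - y))\<^sup>2 * (norm (G (y + s *\<^sub>R (x - y))))\<^sup>2"
      by (simp add: power_mult_distrib)
    then show "ennreal (indicator {0..1} s * (q s)\<^sup>2)
      \<le> ennreal ((norm (x - y))\<^sup>2) * (indicator {0..1} s * ennreal ((norm (G (y + s *\<^sub>R (x - y))))\<^sup>2))"
      by (auto simp: indicator_def ennreal_leI simp flip: ennreal_mult)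
  qed
  also have "\<dots> = ennreal ((norm (x - y))\<^sup>2) * (\<integral>\<^sup>+s. indicator {0..1} s * ennreal ((norm (G (y + s *\<^sub>R (x - y))))\<^sup>2) \<partial>lborel)"
    by (rule nn_integral_cmult) measurable
  finally show ?thesis unfolding m_def .
qed

lemma norm_diff_cube:
  assumes "x \<in> cube l" "y \<in> cube l"
  shows "(norm (x - y :: real^'n))\<^sup>2 \<le> real CARD('n) * l\<^sup>2"
proof -
  have "(norm (x - y))\<^sup>2 = (\<Sum>i\<in>UNIV. (x $ i - y $ i)\<^sup>2)"
    unfolding power2_norm_eq_inner inner_vec_def by (simp add: power2_eq_square)
  also have "\<dots> \<le> (\<Sum>i\<in>(UNIV::'n set). l\<^sup>2)"
  proof (rule sum_mono)
    fix i
    have "\<bar>x $ i - y $ i\<bar> \<le> \<bar>l\<bar>" using assms[unfolded cube_def, simplified, rule_format, of i] by auto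
    then show "(x $ i - y $ i)\<^sup>2 \<le> l\<^sup>2" by (simp add: abs_le_square_iff)
  qed
  finally show ?thesis by simp
qed

text \<open>Averages (g x - g y)^2 over all pairs and takes for c a value g y at which the inner
  integral is at most twice its average. Such a c serves as well as the mean, because test functions
  are later paired with a function of mean zero.\<close>

lemma poincare_cube:
  fixes g :: "real^'n \<Rightarrow> real" and G :: "real^'n \<Rightarrow> real^'n"
  assumes dg: "\<And>x. (g has_derivative (\<lambda>w. w \<bullet> G x)) (at x)" and cG: "continuous_on UNIV G"
    and l: "l > 0" and N: "(\<integral>\<^sup>+x. indicator (cube l) x * ennreal ((norm (G x))\<^sup>2) \<partial>lborel) \<le> 1"
  shows "\<exists>c. (\<integral>\<^sup>+x. indicator (cube l) x * ennreal ((g x - c)\<^sup>2) \<partial>lborel) \<le> ennreal (2 ^ (CARD('n) + 1) * real CARD('n) * l\<^sup>2)"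
proof -
  let ?n = "CARD('n)"
  define H where "H y = (\<integral>\<^sup>+x. indicator (cube l) x * ennreal ((g x - g y)\<^sup>2) \<partial>lborel)" for y
  define F where "F x = ennreal ((norm (G x))\<^sup>2)" for x
  have cg: "continuous_on UNIV g"
    using dg by (meson continuous_at_imp_continuous_on has_derivative_continuous)
  have [measurable]: "g \<in> borel_measurable borel" by (rule borel_measurable_continuous_onI[OF cg])
  have [measurable]: "G \<in> borel_measurable borel" by (rule borel_measurable_continuous_onI[OF cG])
  have [measurable]: "F \<in> borel_measurable borel" unfolding F_def[abs_def] by measurable
  let ?A = "real ?n * l\<^sup>2"
  let ?J = "\<lambda>s y x. indicator (cube l) x * indicator (cube l) y * F (y + s *\<^sub>R (x - y))"
  have "(\<integral>\<^sup>+y. indicator (cube l) y * H y \<partial>lborel)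
    \<le> (\<integral>\<^sup>+y. \<integral>\<^sup>+x. ennreal ?A * (\<integral>\<^sup>+s. indicator {0..1::real} s * ?J s y x \<partial>lborel) \<partial>lborel \<partial>lborel)"
  proof (rule nn_integral_mono)
    fix y :: "real^'n"
    have "indicator (cube l) y * H y = (\<integral>\<^sup>+x. indicator (cube l) y * (indicator (cube l) x * ennreal ((g x - g y)\<^sup>2)) \<partial>lborel)"
      unfolding H_def by (rule nn_integral_cmult[symmetric]) measurable
    also have "\<dots> \<le> (\<integral>\<^sup>+x. ennreal ?A * (\<integral>\<^sup>+s. indicator {0..1::real} s * ?J s y x \<partial>lborel) \<partial>lborel)"
    proof (rule nn_integral_mono)
      fix x :: "real^'n"
      show "indicator (cube l) y * (indicator (cube l) x * ennreal ((g x - g y)\<^sup>2))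
        \<le> ennreal ?A * (\<integral>\<^sup>+s. indicator {0..1::real} s * ?J s y x \<partial>lborel)"
      proof (cases "x \<in> cube l \<and> y \<in> cube l")
        case True
        have "ennreal ((g x - g y)\<^sup>2) \<le> ennreal ((norm (x - y))\<^sup>2) * (\<integral>\<^sup>+s. indicator {0..1} s * F (y + s *\<^sub>R (x - y)) \<partial>lborel)"
          unfolding F_def by (rule segment_increment_le[OF dg cG])
        also have "\<dots> \<le> ennreal ?A * (\<integral>\<^sup>+s. indicator {0..1} s * F (y + s *\<^sub>R (x - y)) \<partial>lborel)"
          using norm_diff_cube[of x l y] True by (intro mult_right_mono ennreal_leI) auto
        finally show ?thesis using True by simp
      qed (auto simp: indicator_def)
    qed
    finally show "indicator (cube l) y * H y \<le> (\<integral>\<^sup>+x. ennreal ?A * (\<integral>\<^sup>+s. indicator {0..1::real} s * ?J s y x \<partial>lborel) \<partial>lborel)" .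
  qed
  also have "\<dots> = ennreal ?A * (\<integral>\<^sup>+y. \<integral>\<^sup>+x. \<integral>\<^sup>+s. indicator {0..1::real} s * ?J s y x \<partial>lborel \<partial>lborel \<partial>lborel)"
    by (simp add: nn_integral_cmult)
  also have "(\<integral>\<^sup>+y. \<integral>\<^sup>+x. \<integral>\<^sup>+s. indicator {0..1::real} s * ?J s y x \<partial>lborel \<partial>lborel \<partial>lborel)
    = (\<integral>\<^sup>+y. \<integral>\<^sup>+s. \<integral>\<^sup>+x. indicator {0..1::real} s * ?J s y x \<partial>lborel \<partial>lborel \<partial>lborel)"
    by (intro nn_integral_cong lborel_pair.Fubini') measurable
  also have "\<dots> = (\<integral>\<^sup>+s. \<integral>\<^sup>+y. \<integral>\<^sup>+x. indicator {0..1::real} s * ?J s y x \<partial>lborel \<partial>lborel \<partial>lborel)"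
    by (rule lborel_pair.Fubini') measurable
  also have "\<dots> = (\<integral>\<^sup>+s. indicator {0..1::real} s * (\<integral>\<^sup>+y. \<integral>\<^sup>+x. ?J s y x \<partial>lborel \<partial>lborel) \<partial>lborel)"
    by (simp add: nn_integral_cmult)
  also have "\<dots> \<le> (\<integral>\<^sup>+s. indicator {0..1::real} s * ennreal ((2 * l) ^ ?n) \<partial>lborel)"
  proof (rule nn_integral_mono)
    fix s :: real
    show "indicator {0..1::real} s * (\<integral>\<^sup>+y. \<integral>\<^sup>+x. ?J s y x \<partial>lborel \<partial>lborel) \<le> indicator {0..1::real} s * ennreal ((2 * l) ^ ?n)"
    proof (cases "s \<in> {0..1}")
      case True
      have "(\<integral>\<^sup>+y. \<integral>\<^sup>+x. ?J s y x \<partial>lborel \<partial>lborel) \<le> ennreal ((2 * l) ^ ?n) * (\<integral>\<^sup>+x. indicator (cube l) x * F x \<partial>lborel)"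
        using True l by (intro nn_integral_two_point) auto
      also have "\<dots> \<le> ennreal ((2 * l) ^ ?n) * 1"
        using N by (intro mult_left_mono) (auto simp: F_def)
      finally show ?thesis using True by simp
    qed simp
  qed
  also have "\<dots> = ennreal ((2 * l) ^ ?n)"
    by (simp add: nn_integral_multc)
  finally have HI: "(\<integral>\<^sup>+y. indicator (cube l) y * H y \<partial>lborel) \<le> ennreal ?A * ennreal ((2 * l) ^ ?n)"
    by (simp add: mult_left_mono)
  \<comment> \<open>The average of H over the cube is at most n l^2 2^n; the additional factor 2
    makes the contradiction strict.\<close>
  define K where "K = 2 ^ (?n + 1) * real ?n * l\<^sup>2"
  have "\<exists>y\<in>cube l. H y \<le> ennreal K"
  proof (rule ccontr)
    assume "\<not> ?thesis"
    then have "ennreal K * indicator (cube l) y \<le> indicator (cube l) y * H y" for y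
      by (auto simp: indicator_def not_le less_imp_le)
    then have "(\<integral>\<^sup>+y. ennreal K * indicator (cube l :: (real^'n) set) y \<partial>lborel) \<le> (\<integral>\<^sup>+y. indicator (cube l :: (real^'n) set) y * H y \<partial>lborel)"
      by (intro nn_integral_mono)
    then have "ennreal K * ennreal (l ^ ?n) \<le> ennreal ?A * ennreal ((2 * l) ^ ?n)"
      using HI l by (simp add: nn_integral_cmult emeasure_cube)
    then have "K * l ^ ?n \<le> ?A * (2 * l) ^ ?n"
      using l by (simp add: K_def flip: ennreal_mult)
    then have "2 * (?A * (2 * l) ^ ?n) \<le> ?A * (2 * l) ^ ?n"
      by (simp add: K_def power_mult_distrib mult_ac)
    moreover have "0 < ?A * (2 * l) ^ ?n" using l by simp
    ultimately show False by linarith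
  qed
  then show ?thesis unfolding H_def K_def by blast
qed

section \<open>Test functions on the torus\<close>

lemma smooth_on_UNIV: "smooth_on UNIV f \<longleftrightarrow> (\<forall>k. Ck_on k UNIV f)"
proof
  assume "smooth_on UNIV f"
  then obtain W g where "UNIV \<subseteq> W" "\<forall>k. Ck_on k W g" "\<forall>x. f x = g x"
    unfolding smooth_on_def by auto
  then show "\<forall>k. Ck_on k UNIV f" using Ck_on_cong[of UNIV g f] by (metis UNIV_I open_UNIV top.extremum_uniqueI)
next
  assume "\<forall>k. Ck_on k UNIV f"
  then show "smooth_on UNIV f" unfolding smooth_on_def by (intro exI[of _ UNIV] exI[of _ f]) auto
qed

lemma Ck_on_component: "open S \<Longrightarrow> Ck_on k S f \<Longrightarrow> Ck_on k S (\<lambda>x. f x $ i)"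
  by (rule Ck_on_bounded_linear[OF _ bounded_linear_vec_nth])

lemma Ck_on_vec:
  fixes f :: "'n::finite \<Rightarrow> 'a::real_normed_vector \<Rightarrow> real"
  assumes "open S" "\<And>i. Ck_on k S (f i)"
  shows "Ck_on k S (\<lambda>x. \<chi> i. f i x)"
proof -
  have "(\<lambda>x. \<chi> i. f i x) = (\<lambda>x. \<Sum>i\<in>UNIV. f i x *\<^sub>R axis i 1)"
    by (auto simp: vec_eq_iff axis_def if_distrib cong: if_cong)
  then show ?thesis using assms by (simp add: Ck_on_sum Ck_on_scaleR)
qed

lemma Ck_on_scaleR_const:
  "open S \<Longrightarrow> Ck_on k S f \<Longrightarrow> Ck_on k S (\<lambda>x. c *\<^sub>R f x)"
  by (intro Ck_on_scaleR Ck_on_const)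

lemma linear_eq_inner_axis:
  fixes D :: "real^'n \<Rightarrow> real"
  assumes "linear D" shows "D w = w \<bullet> (\<chi> i. D (axis i 1))"
proof -
  have "D w = D (\<Sum>i\<in>UNIV. (w $ i) *\<^sub>R axis i 1)"
    by (simp add: basis_expansion flip: scalar_mult_eq_scaleR)
  also have "\<dots> = (\<Sum>i\<in>UNIV. w $ i * D (axis i 1))"
    by (simp add: linear_sum[OF assms] linear_scale[OF assms])
  finally show ?thesis by (simp add: inner_vec_def)
qed

lemma grad_works:
  fixes g :: "real^'n \<Rightarrow> real"
  assumes "g differentiable at x" shows "(g has_derivative (\<lambda>w. w \<bullet> grad g x)) (at x)"
proof -
  have D: "(g has_derivative frechet_derivative g (at x)) (at x)"
    using assms by (simp add: frechet_derivative_works)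
  have "frechet_derivative g (at x) = (\<lambda>w. w \<bullet> grad g x)"
    unfolding grad_def using linear_eq_inner_axis[OF has_derivative_linear[OF D]] by blast
  then show ?thesis using D by simp
qed

lemma grad_eqI:
  fixes g :: "real^'n \<Rightarrow> real"
  assumes "(g has_derivative (\<lambda>w. w \<bullet> v)) (at x)" shows "grad g x = v"
  by (simp add: grad_def frechet_derivative_at[OF assms, symmetric] inner_axis' vec_eq_iff)

lemma Ck_1_grad:
  fixes g :: "real^'n \<Rightarrow> real"
  assumes "Ck_on (Suc 0) UNIV g"
  shows "(g has_derivative (\<lambda>w. w \<bullet> grad g x)) (at x)" "continuous_on UNIV (grad g)"
proof -
  show "(g has_derivative (\<lambda>w. w \<bullet> grad g x)) (at x)"
    using assms by (intro grad_works) (simp add: Ck_on.simps(2))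
  show "continuous_on UNIV (grad g)"
    unfolding grad_def[abs_def] using assms by (intro continuous_on_vec_lambda) (simp add: Ck_on.simps(2))
qed

lemma grad_cong_open:
  assumes "open U" "x \<in> U" "\<And>y. y \<in> U \<Longrightarrow> f y = g y"
  shows "grad f x = grad g x"
proof (cases "f differentiable at x")
  case True
  have "(f has_derivative (\<lambda>w. w \<bullet> grad f x)) (at x)" using True by (rule grad_works)
  then have "(g has_derivative (\<lambda>w. w \<bullet> grad f x)) (at x)"
    using has_derivative_transform_within_open[OF _ assms(1,2)] assms(3) by blast
  then show ?thesis using grad_eqI by metis
next
  case False
  \<comment> \<open>Without differentiability the gradient is an unspecified choice, but for both
    functions it is a choice from the same predicate.\<close>
  have "(f has_derivative D) (at x) \<longleftrightarrow> (g has_derivative D) (at x)" for D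
    using has_derivative_transform_within_open[OF _ assms(1,2), of f D UNIV g]
      has_derivative_transform_within_open[OF _ assms(1,2), of g D UNIV f] assms(3) by auto
  then show ?thesis by (simp add: grad_def frechet_derivative_def)
qed

text \<open>For l > 0, the representative of x modulo the lattice with all coordinates in [0,
  l).\<close>

definition mod_lattice :: "real \<Rightarrow> real^'n \<Rightarrow> real^'n" where
  "mod_lattice l x = (\<chi> i. x $ i - l * \<lfloor>x $ i / l\<rfloor>)"

lemma mod_lattice_cube: "x \<in> cube l \<Longrightarrow> mod_lattice l x = x"
proof -
  assume "x \<in> cube l"
  then have "0 < x $ i \<and> x $ i < l" for i by (simp add: cube_def)
  then have "0 \<le> x $ i / l \<and> x $ i / l < 1" for i
    by (smt (verit) divide_less_eq_1_pos divide_nonneg_nonneg)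
  then have "\<lfloor>x $ i / l\<rfloor> = 0" for i by (simp add: floor_eq_iff)
  then show ?thesis by (simp add: mod_lattice_def vec_eq_iff)
qed

text \<open>On a small ball the composition agrees with a single translate of F: where the ball
  leaves the cell of its centre, both are zero, since F vanishes near the faces and beyond
  them.\<close>

lemma periodization_torus_smooth:
  fixes F :: "real^'n \<Rightarrow> real"
  assumes l: "l > 0" and d: "d > 0" and smF: "\<And>k. Ck_on k UNIV F"
    and F0: "\<And>x i. x $ i < d \<or> x $ i > l - d \<Longrightarrow> F x = 0"
  shows "(\<lambda>x. F (mod_lattice l x)) \<in> torus_smooth l"
proof -
  have "F (mod_lattice l (x + axis i l)) = F (mod_lattice l x)" for x i
  proof -
    have "mod_lattice l (x + axis i l) = mod_lattice l x"
      using l by (auto simp: mod_lattice_def vec_eq_iff axis_def add_divide_distrib algebra_simps)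
    then show ?thesis by simp
  qed
  moreover have "Ck_on k UNIV (\<lambda>x. F (mod_lattice l x))" for k
  proof (rule Ck_on_local)
    fix x0 :: "real^'n"
    define m where "m = (\<chi> i. l * of_int \<lfloor>x0 $ i / l\<rfloor>)"
    \<comment> \<open>At most l, so that each coordinate reaches only an adjacent cell; at most d,
      so that a point beyond the face still lands in the layer where F vanishes.\<close>
    define e where "e = min d l"
    have e: "e > 0" "e \<le> d" "e \<le> l" using d l by (auto simp: e_def)
    have z: "0 \<le> x0 $ i - m $ i" "x0 $ i - m $ i < l" for i
    proof -
      show "0 \<le> x0 $ i - m $ i" "x0 $ i - m $ i < l"
        using floor_divide_lower[OF l, of "x0 $ i"] floor_divide_upper[OF l, of "x0 $ i"]
        by (auto simp: m_def algebra_simps)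
    qed
    have fl: "mod_lattice l x $ i = x $ i - m $ i - l * of_int j"
      if "of_int j * l \<le> x $ i - m $ i" "x $ i - m $ i < (of_int j + 1) * l" for x i j
    proof -
      have "\<lfloor>x $ i / l\<rfloor> = \<lfloor>x0 $ i / l\<rfloor> + j"
        using that l by (intro floor_unique) (auto simp: m_def field_simps)
      then show ?thesis by (simp add: mod_lattice_def m_def algebra_simps)
    qed
    have eq: "F (x - m) = F (mod_lattice l x)" if x: "x \<in> ball x0 e" for x
    proof -
      have dx: "\<bar>x $ i - x0 $ i\<bar> < e" for i
        using x component_le_norm_cart[of "x - x0" i] by (simp add: dist_norm norm_minus_commute)
      show ?thesis
      proof (cases "\<forall>i. 0 \<le> x $ i - m $ i \<and> x $ i - m $ i < l")
        case True
        then have "mod_lattice l x = x - m" using fl[of 0 x] by (simp add: vec_eq_iff)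
        then show ?thesis by simp
      next
        case False
        then obtain i where "\<not> (0 \<le> x $ i - m $ i \<and> x $ i - m $ i < l)" by blast
        then have i: "x $ i - m $ i < 0 \<or> x $ i - m $ i \<ge> l" by linarith
        then have "F (x - m) = 0" using e d by (intro F0[of _ i]) auto
        moreover have "F (mod_lattice l x) = 0"
        proof (cases "x $ i - m $ i < 0")
          case True
          then have "mod_lattice l x $ i = x $ i - m $ i + l"
            using fl[of "-1" x i] dx[of i] z[of i] e by auto
          then show ?thesis using dx[of i] z[of i] e by (intro F0[of _ i]) auto
        next
          case False
          then have "mod_lattice l x $ i = x $ i - m $ i - l"
            using i fl[of 1 x i] dx[of i] z[of i] e by auto
          then show ?thesis using dx[of i] z[of i] e by (intro F0[of _ i]) auto
        qed
        ultimately show ?thesis by simp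
      qed
    qed
    have "Ck_on k (ball x0 e) (\<lambda>x. F (x - m))"
      by (intro Ck_on_compose_UNIV[OF _ _ smF] Ck_on_intros open_ball)
    then have "Ck_on k (ball x0 e) (\<lambda>x. F (mod_lattice l x))"
      by (rule Ck_on_cong[OF open_ball, rotated]) (rule eq)
    then show "\<exists>U. open U \<and> x0 \<in> U \<and> Ck_on k U (\<lambda>x. F (mod_lattice l x))"
      using e by (intro exI[of _ "ball x0 e"]) auto
  qed
  ultimately show ?thesis by (simp add: torus_smooth_def smooth_on_UNIV)
qed

lemma prod_cutoff_has_derivative:
  fixes \<phi>1 \<phi>2 :: "real \<Rightarrow> real"
  assumes "\<And>x. (\<phi>1 has_real_derivative \<phi>2 x) (at x)"
  shows "((\<lambda>y::real^'n. \<Prod>i\<in>UNIV. \<phi>1 (y $ i)) has_derivative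
    (\<lambda>w. w \<bullet> (\<chi> i. \<phi>2 (y $ i) * (\<Prod>j\<in>UNIV - {i}. \<phi>1 (y $ j))))) (at y)"
proof -
  have "((\<lambda>y::real^'n. \<phi>1 (y $ i)) has_derivative (\<lambda>w. \<phi>2 (y $ i) * w $ i)) (at y)" for i
  proof (rule has_derivative_compose[of "\<lambda>y. y $ i" "\<lambda>w. w $ i" y UNIV \<phi>1 "\<lambda>h. \<phi>2 (y $ i) * h", simplified])
    show "((\<lambda>y. y $ i) has_derivative (\<lambda>w. w $ i)) (at y)"
      by (rule bounded_linear_imp_has_derivative[OF bounded_linear_vec_nth])
    show "(\<phi>1 has_derivative (*) (\<phi>2 (y $ i))) (at (y $ i))"
      using assms by (simp add: has_field_derivative_def)
  qed
  from has_derivative_prod[of UNIV "\<lambda>i y. \<phi>1 (y $ i)" "\<lambda>i w. \<phi>2 (y $ i) * w $ i" y UNIV, OF this]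
  show ?thesis by (simp add: inner_vec_def mult_ac)
qed

lemma abs_prod_le_power:
  fixes f :: "'n::finite \<Rightarrow> real"
  assumes "\<And>i. \<bar>f i\<bar> \<le> C" "C \<ge> 1"
  shows "\<bar>\<Prod>i\<in>A. f i\<bar> \<le> C ^ CARD('n)"
proof -
  have "\<bar>\<Prod>i\<in>A. f i\<bar> \<le> (\<Prod>i\<in>A. C)" unfolding abs_prod using assms by (intro prod_mono) auto
  also have "\<dots> \<le> C ^ CARD('n)" using assms(2) by (simp add: power_increasing card_mono)
  finally show ?thesis .
qed

lemma set_integrable_cube_continuous:
  fixes q :: "real^'n \<Rightarrow> real"
  assumes "l > 0" "continuous_on UNIV q" shows "set_integrable lborel (cube l) q"
proof (rule set_integrable_subset)
  show "set_integrable lborel (cbox 0 (\<chi> i. l)) q"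
    unfolding set_integrable_def
    by (intro borel_integrable_compact compact_cbox continuous_on_subset[OF assms(2)]) auto
  show "cube l \<subseteq> cbox 0 ((\<chi> i. l)::real^'n)" by (auto simp: cube_eq_box box_subset_cbox subset_box)
qed auto

lemma set_integrable_cube_bounded_mult:
  fixes q f :: "real^'n \<Rightarrow> real"
  assumes "l > 0" "continuous_on UNIV q" "continuous_on (cube l) f" "\<And>x. x \<in> cube l \<Longrightarrow> \<bar>f x\<bar> \<le> M"
  shows "set_integrable lborel (cube l) (\<lambda>x. f x * q x)"
  unfolding set_integrable_def
proof (rule Bochner_Integration.integrable_bound)
  show "integrable lborel (\<lambda>x. M * (indicator (cube l) x *\<^sub>R q x))"
    using set_integrable_cube_continuous[OF assms(1,2)] by (simp add: set_integrable_def)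
  have [measurable]: "q \<in> borel_measurable borel"
    by (rule borel_measurable_continuous_onI[OF assms(2)])
  have [measurable]: "(\<lambda>x. indicator (cube l) x *\<^sub>R f x) \<in> borel_measurable borel"
    by (rule borel_measurable_continuous_on_indicator[OF _ assms(3)]) simp
  have "(\<lambda>x. (indicator (cube l) x *\<^sub>R f x) * q x) \<in> borel_measurable lborel" by measurable
  then show "(\<lambda>x. indicator (cube l) x *\<^sub>R (f x * q x)) \<in> borel_measurable lborel" by (simp add: mult.assoc)
  have "norm (indicator (cube l) x *\<^sub>R (f x * q x)) \<le> norm (M * (indicator (cube l) x *\<^sub>R q x))" for x
    using assms(4)[of x] by (auto simp: indicator_def abs_mult intro!: mult_right_mono)
  then show "AE x in lborel. norm (indicator (cube l) x *\<^sub>R (f x * q x)) \<le> norm (M * (indicator (cube l) x *\<^sub>R q x))"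
    by simp
qed

lemma Lp_norm_2_le_1:
  assumes "(LINT x:S|lborel. (norm (F x))\<^sup>2) \<le> 1" shows "Lp_norm 2 S F \<le> 1"
proof -
  have "0 \<le> (LINT x:S|lborel. (norm (F x))\<^sup>2)"
    unfolding set_lebesgue_integral_def by (intro Bochner_Integration.integral_nonneg) auto
  then show ?thesis using assms by (simp add: Lp_norm_def powr_half_sqrt)
qed

lemma Lp_norm_2_le_1D:
  assumes "Lp_norm 2 S F \<le> 1" shows "(LINT x:S|lborel. (norm (F x))\<^sup>2) \<le> 1"
proof -
  have "0 \<le> (LINT x:S|lborel. (norm (F x))\<^sup>2)"
    unfolding set_lebesgue_integral_def by (intro Bochner_Integration.integral_nonneg) auto
  then show ?thesis using assms by (simp add: Lp_norm_def powr_half_sqrt)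
qed

lemma cube_scale_iff: "a > 0 \<Longrightarrow> a *\<^sub>R x \<in> cube (a * l) \<longleftrightarrow> x \<in> cube l"
  by (simp add: cube_def zero_less_mult_iff)

lemma cube_mono: "l \<le> m \<Longrightarrow> cube l \<subseteq> cube m"
  unfolding cube_def by (blast intro: less_le_trans)

lemma rescale_scale: "a > 0 \<Longrightarrow> rescale l a f (a *\<^sub>R x) = (if x \<in> cube l then f x else 0)"
  by (simp add: rescale_def cube_scale_iff)

lemma core_subset_cube:
  assumes "d > 0" shows "cbox (\<chi> i. d) (\<chi> i. l - d) \<subseteq> (cube l :: (real^'n) set)"
proof
  fix x :: "real^'n" assume "x \<in> cbox (\<chi> i. d) (\<chi> i. l - d)"
  then have x: "d \<le> x $ i \<and> x $ i \<le> l - d" for i by (simp add: mem_box_cart)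
  have "0 < x $ i \<and> x $ i < l" for i using x[of i] assms by linarith
  then show "x \<in> cube l" by (simp add: cube_def)
qed

text \<open>Bernoulli's inequality bounds l^n - (l - 2 d)^n. That the bound is linear in d is what
  makes the contribution of thin layers small.\<close>

lemma measure_layer:
  assumes "0 < d" "2 * d \<le> l"
  shows "measure lborel (cube l - cbox (\<chi> i. d) (\<chi> i. l - d) :: (real^'n) set) \<le> 2 * real CARD('n) * l ^ (CARD('n) - 1) * d"
proof -
  let ?n = "CARD('n)"
  have l: "l > 0" using assms by linarith
  have ne: "cbox (\<chi> i. d) (\<chi> i. l - d) \<noteq> ({} :: (real^'n) set)"
    using assms by (simp add: interval_ne_empty_cart)
  have "measure lborel (cube l - cbox (\<chi> i. d) (\<chi> i. l - d) :: (real^'n) set)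
    = measure lborel (cube l :: (real^'n) set) - measure lborel (cbox (\<chi> i. d) (\<chi> i. l - d) :: (real^'n) set)"
    using l core_subset_cube[OF assms(1)] by (intro measure_Diff) (auto simp: emeasure_cube)
  also have "measure lborel (cube l :: (real^'n) set) = l ^ ?n"
    using l by (simp add: measure_def emeasure_cube)
  also have "measure lborel (cbox (\<chi> i. d) (\<chi> i. l - d) :: (real^'n) set) = (l - 2 * d) ^ ?n"
    using content_cbox_cart[OF ne] by simp
  also have "l ^ ?n - (l - 2 * d) ^ ?n \<le> 2 * real ?n * l ^ (?n - 1) * d"
  proof -
    have "1 + real ?n * (- 2 * d / l) \<le> (1 + (- 2 * d / l)) ^ ?n"
      using assms l by (intro Bernoulli_inequality) (simp add: divide_simps)
    then have "l ^ ?n * (1 + real ?n * (- 2 * d / l)) \<le> l ^ ?n * (1 + (- 2 * d / l)) ^ ?n"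
      using l by (intro mult_left_mono) auto
    also have "\<dots> = (l - 2 * d) ^ ?n" using l by (simp add: power_mult_distrib[symmetric] algebra_simps)
    finally have "l ^ ?n - (l - 2 * d) ^ ?n \<le> l ^ ?n * (real ?n * (2 * d / l))"
      by (simp add: algebra_simps)
    also have "\<dots> = l * l ^ (?n - 1) * (real ?n * (2 * d / l))"
      by (metis zero_less_card_finite power_minus_mult mult.commute)
    also have "\<dots> = 2 * real ?n * l ^ (?n - 1) * d" using l by (simp add: divide_simps)
    finally show ?thesis .
  qed
  finally show ?thesis .
qed

text \<open>The substitution turns the left side into an integral over the small cube in the corner,
  which is part of the large one.\<close>

lemma integral_dilation_le:
  fixes q :: "real^'n \<Rightarrow> real"
  assumes "l > 0" "0 < a" "a < 1" "continuous_on UNIV q" "\<And>x. 0 \<le> q x" "(LINT x:cube l|lborel. q x) \<le> A"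
  shows "a ^ CARD('n) * (LINT x:cube l|lborel. q (a *\<^sub>R x)) \<le> A"
proof -
  have [measurable]: "q \<in> borel_measurable borel"
    by (rule borel_measurable_continuous_onI[OF assms(4)])
  have "a ^ CARD('n) * (LINT x:cube l|lborel. q (a *\<^sub>R x))
    = a ^ CARD('n) * (\<integral>x. indicator (cube (a * l)) (0 + a *\<^sub>R x) * q (0 + a *\<^sub>R x) \<partial>lborel)"
    using assms(2) by (simp add: set_lebesgue_integral_def indicator_def cube_scale_iff)
  also have "\<dots> = (\<integral>x. indicator (cube (a * l)) x * q x \<partial>lborel)"
    by (rule integral_scale[symmetric]) (use assms in auto)
  also have "\<dots> = (LINT x:cube (a * l)|lborel. q x)" by (simp add: set_lebesgue_integral_def)
  also have "\<dots> \<le> (LINT x:cube l|lborel. q x)"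
  proof -
    have sub: "cube (a * l) \<subseteq> (cube l :: (real^'n) set)" using assms by (intro cube_mono) simp
    have i: "set_integrable lborel (cube l) q" by (rule set_integrable_cube_continuous[OF assms(1,4)])
    have "set_integrable lborel (cube (a * l)) q" by (rule set_integrable_subset[OF i]) (use sub in auto)
    then show ?thesis
      using i sub assms(5) unfolding set_lebesgue_integral_def set_integrable_def
      by (intro integral_mono) (auto simp: indicator_def)
  qed
  finally show ?thesis using assms(6) by simp
qed

text \<open>Multiplying by a cutoff and extending periodically turns a function on the cube into a test
  function for the torus.\<close>
lemma Hm1_norm_cutoff_le:
  fixes f k :: "real^'n \<Rightarrow> real"
  assumes l: "l > 0" and C: "C \<ge> 1" and d: "0 < d" "4 * d < l" "d \<le> 1"
    and cut: "cutoff_map C l d \<phi> \<phi>1 \<phi>2"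
    and smk: "\<And>j. Ck_on j UNIV k"
    and G: "(LINT x:cube l|lborel. (norm (grad k x))\<^sup>2) \<le> A"
    and K: "(LINT x:cube l|lborel. (k x)\<^sup>2) \<le> A * P" and P: "P \<ge> 0" and A: "A > 0"
    and H: "Hm1_norm l f \<le> ereal H"
  shows "\<bar>LINT x:cube l|lborel. f x * ((\<Prod>i\<in>UNIV. \<phi>1 (x $ i)) * k x)\<bar>
    \<le> sqrt (2 * C ^ (2 * CARD('n)) * (1 + real CARD('n) ^ 2 * C\<^sup>2 * P)) * sqrt A * H / d"
proof -
  let ?n = "CARD('n)"
  define \<zeta> where "\<zeta> x = (\<Prod>i\<in>UNIV. \<phi>1 (x $ i))" for x :: "real^'n"
  define X where "X y = (\<chi> i. \<phi>2 (y $ i) * (\<Prod>j\<in>UNIV - {i}. \<phi>1 (y $ j)))" for y :: "real^'n"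
  define h0 where "h0 x = \<zeta> x * k x" for x
  define h where "h x = h0 (mod_lattice l x)" for x
  have cm: "\<And>j. Ck_on j UNIV \<phi>1" "\<And>x. (\<phi>1 has_real_derivative \<phi>2 x) (at x)"
    "\<And>x. x \<le> d \<Longrightarrow> \<phi>1 x = 0" "\<And>x. x \<ge> l - d \<Longrightarrow> \<phi>1 x = 0" "\<And>x. \<bar>\<phi>1 x\<bar> \<le> C" "\<And>x. \<bar>\<phi>2 x\<bar> \<le> C / d"
    using cut unfolding cutoff_map_def by blast+
  have sm\<zeta>: "Ck_on j UNIV \<zeta>" for j
    unfolding \<zeta>_def[abs_def]
    by (intro Ck_on_prod Ck_on_compose_UNIV[OF _ _ cm(1)] Ck_on_component Ck_on_ident open_UNIV)
  have smh0: "Ck_on j UNIV h0" for j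
    unfolding h0_def[abs_def] by (intro Ck_on_mult sm\<zeta> smk open_UNIV)
  have h0z: "h0 x = 0" if "x $ i < d \<or> x $ i > l - d" for x i
  proof -
    have "\<phi>1 (x $ i) = 0" using that cm(3)[of "x $ i"] cm(4)[of "x $ i"] by auto
    then have "\<zeta> x = 0" unfolding \<zeta>_def by (intro prod_zero) auto
    then show ?thesis by (simp add: h0_def)
  qed
  have ht: "h \<in> torus_smooth l"
    unfolding h_def[abs_def] by (rule periodization_torus_smooth[OF l d(1) smh0 h0z])
  have heq: "h x = h0 x" if "x \<in> cube l" for x using that by (simp add: h_def mod_lattice_cube)
  have d\<zeta>: "(\<zeta> has_derivative (\<lambda>w. w \<bullet> X y)) (at y)" for y
    unfolding \<zeta>_def[abs_def] X_def by (rule prod_cutoff_has_derivative[OF cm(2)])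
  note dk = Ck_1_grad(1)[OF smk] and ck = Ck_1_grad(2)[OF smk]
  have gh0: "grad h0 y = \<zeta> y *\<^sub>R grad k y + k y *\<^sub>R X y" for y
  proof (rule grad_eqI)
    have "(h0 has_derivative (\<lambda>w. \<zeta> y * (w \<bullet> grad k y) + (w \<bullet> X y) * k y)) (at y)"
      unfolding h0_def[abs_def] by (rule has_derivative_mult[OF d\<zeta> dk])
    then show "(h0 has_derivative (\<lambda>w. w \<bullet> (\<zeta> y *\<^sub>R grad k y + k y *\<^sub>R X y))) (at y)"
      by (simp add: inner_add_right mult_ac)
  qed
  have gh: "grad h x = grad h0 x" if "x \<in> cube l" for x
    using grad_cong_open[OF open_cube that, of h h0] heq by blast
  have b\<zeta>: "\<bar>\<zeta> x\<bar> \<le> C ^ ?n" for x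
    unfolding \<zeta>_def by (rule abs_prod_le_power[OF cm(5) C])
  have bX: "norm (X x) \<le> real ?n * (C / d * C ^ ?n)" for x
  proof -
    have "norm (X x) \<le> (\<Sum>i\<in>UNIV. \<bar>X x $ i\<bar>)" by (rule norm_le_l1_cart)
    also have "\<dots> \<le> (\<Sum>i\<in>(UNIV::'n set). C / d * C ^ ?n)"
    proof (rule sum_mono)
      fix i :: 'n
      have "\<bar>\<Prod>j\<in>UNIV - {i}. \<phi>1 (x $ j)\<bar> \<le> C ^ ?n" by (rule abs_prod_le_power[OF cm(5) C])
      then show "\<bar>X x $ i\<bar> \<le> C / d * C ^ ?n"
        unfolding X_def using cm(6)[of "x $ i"] C d by (simp only: vec_lambda_beta abs_mult) (intro mult_mono, auto)
    qed
    finally show ?thesis by simp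
  qed
  define S where "S = 2 * C ^ (2 * ?n) * (1 + real ?n ^ 2 * C\<^sup>2 * P)"
  have Spos: "S > 0" using C P unfolding S_def by (intro mult_pos_pos add_pos_nonneg) auto
  have pt: "(norm (grad h0 x))\<^sup>2 \<le> 2 * C ^ (2 * ?n) * (norm (grad k x))\<^sup>2 + 2 * C ^ (2 * ?n) * (real ?n ^ 2 * C\<^sup>2 / d\<^sup>2) * (k x)\<^sup>2" for x
  proof -
    let ?p = "norm (\<zeta> x *\<^sub>R grad k x)" and ?q = "norm (k x *\<^sub>R X x)"
    have "(norm (grad h0 x))\<^sup>2 \<le> (?p + ?q)\<^sup>2"
      unfolding gh0 by (intro power_mono norm_triangle_ineq) auto
    also have "\<dots> \<le> 2 * ?p\<^sup>2 + 2 * ?q\<^sup>2"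
      using zero_le_power2[of "?p - ?q"] by (simp add: power2_eq_square algebra_simps)
    also have "?p \<le> C ^ ?n * norm (grad k x)" using b\<zeta>[of x] by (simp add: mult_right_mono)
    then have "?p\<^sup>2 \<le> (C ^ ?n * norm (grad k x))\<^sup>2" by (intro power_mono) auto
    moreover have "?q \<le> \<bar>k x\<bar> * (real ?n * (C / d * C ^ ?n))" 
      unfolding norm_scaleR by (intro mult_left_mono bX) auto
    then have "?q\<^sup>2 \<le> (\<bar>k x\<bar> * (real ?n * (C / d * C ^ ?n)))\<^sup>2" by (intro power_mono) auto
    moreover have "(C ^ ?n * norm (grad k x))\<^sup>2 = C ^ (2 * ?n) * (norm (grad k x))\<^sup>2"
      unfolding power_even_eq by (simp add: power_mult_distrib)
    moreover have "(\<bar>k x\<bar> * (real ?n * (C / d * C ^ ?n)))\<^sup>2 = C ^ (2 * ?n) * (real ?n ^ 2 * C\<^sup>2 / d\<^sup>2) * (k x)\<^sup>2"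
      unfolding power_even_eq by (simp add: power_mult_distrib power_divide)
    ultimately show ?thesis by linarith
  qed
  have ih0: "set_integrable lborel (cube l) (\<lambda>x. (norm (grad h0 x))\<^sup>2)"
    by (intro set_integrable_cube_continuous[OF l] continuous_intros Ck_1_grad(2)[OF smh0])
  have igk: "set_integrable lborel (cube l) (\<lambda>x. (norm (grad k x))\<^sup>2)"
    by (intro set_integrable_cube_continuous[OF l] continuous_intros ck)
  have ck0: "continuous_on UNIV k" using smk[of 0] by simp
  have ik: "set_integrable lborel (cube l) (\<lambda>x. (k x)\<^sup>2)"
    by (intro set_integrable_cube_continuous[OF l] continuous_intros ck0)
  have "(LINT x:cube l|lborel. (norm (grad h0 x))\<^sup>2)
    \<le> (LINT x:cube l|lborel. 2 * C ^ (2 * ?n) * (norm (grad k x))\<^sup>2 + 2 * C ^ (2 * ?n) * (real ?n ^ 2 * C\<^sup>2 / d\<^sup>2) * (k x)\<^sup>2)"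
    using ih0 igk ik pt by (intro set_integral_mono set_integral_add(1)) (auto intro!: set_integrable_mult_right)
  also have "\<dots> = 2 * C ^ (2 * ?n) * (LINT x:cube l|lborel. (norm (grad k x))\<^sup>2) + 2 * C ^ (2 * ?n) * (real ?n ^ 2 * C\<^sup>2 / d\<^sup>2) * (LINT x:cube l|lborel. (k x)\<^sup>2)"
    using igk ik by (subst set_integral_add(2)) (auto intro!: set_integrable_mult_right simp: set_integral_mult_right)
  also have "\<dots> \<le> 2 * C ^ (2 * ?n) * (A / d\<^sup>2) + 2 * C ^ (2 * ?n) * (real ?n ^ 2 * C\<^sup>2 / d\<^sup>2) * (A * P)"
  proof (intro add_mono mult_left_mono K)
    \<comment> \<open>d <= 1 allows the gradient term, which comes without a power of 1/d, to be put
      under the factor 1/d^2 of the other term.\<close>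
    have "A * d\<^sup>2 \<le> A * 1" using A d by (intro mult_left_mono) (auto simp: power_le_one)
    then have "A \<le> A / d\<^sup>2" using d by (simp add: field_simps)
    then show "(LINT x:cube l|lborel. (norm (grad k x))\<^sup>2) \<le> A / d\<^sup>2" using G by simp
  qed (use C in auto)
  also have "\<dots> = S * A / d\<^sup>2" by (simp add: S_def add_divide_distrib algebra_simps)
  finally have Ih0: "(LINT x:cube l|lborel. (norm (grad h0 x))\<^sup>2) \<le> S * A / d\<^sup>2" .
  \<comment> \<open>N bounds the L^2 norm of the gradient of h on the cube, so h / N is an
    admissible test function.\<close>
  define N where "N = sqrt S * sqrt A / d"
  have N: "N > 0" "N\<^sup>2 = S * A / d\<^sup>2" 
    using Spos A d by (simp_all add: N_def power_divide power_mult_distrib less_imp_le)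
  define g where "g x = h x / N" for x
  have smh: "Ck_on j UNIV h" for j using ht by (simp add: torus_smooth_def smooth_on_UNIV)
  have gt: "g \<in> torus_smooth l"
    using ht by (auto simp: torus_smooth_def smooth_on_UNIV g_def[abs_def] intro!: Ck_on_divide_const)
  have gg: "grad g x = (1 / N) *\<^sub>R grad h x" for x
  proof (rule grad_eqI)
    have "(g has_derivative (\<lambda>w. (w \<bullet> grad h x) / N)) (at x)"
      unfolding g_def[abs_def]
      by (rule bounded_linear.has_derivative[OF bounded_linear_divide Ck_1_grad(1)[OF smh]])
    then show "(g has_derivative (\<lambda>w. w \<bullet> ((1 / N) *\<^sub>R grad h x))) (at x)" by simp
  qed
  have "(LINT x:cube l|lborel. (norm (grad g x))\<^sup>2) = (LINT x:cube l|lborel. (1 / N\<^sup>2) * (norm (grad h0 x))\<^sup>2)"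
    by (rule set_lebesgue_integral_cong) (auto simp: gg gh power_mult_distrib power_divide)
  also have "\<dots> = (1 / N\<^sup>2) * (LINT x:cube l|lborel. (norm (grad h0 x))\<^sup>2)" by simp
  also have "\<dots> \<le> (1 / N\<^sup>2) * N\<^sup>2"
    using Ih0 unfolding N(2)[symmetric] by (intro mult_left_mono) auto
  also have "\<dots> = 1" using N(1) by simp
  finally have "Lp_norm 2 (cube l) (grad g) \<le> 1" by (rule Lp_norm_2_le_1)
  then have "ereal \<bar>LINT x:cube l|lborel. f x * g x\<bar> \<le> Hm1_norm l f"
    unfolding Hm1_norm_def using gt by (intro SUP_upper) auto
  also note H
  finally have "\<bar>LINT x:cube l|lborel. f x * g x\<bar> \<le> H" by simp
  moreover have "(LINT x:cube l|lborel. f x * g x) = (LINT x:cube l|lborel. (1 / N) * (f x * (\<zeta> x * k x)))"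
    by (rule set_lebesgue_integral_cong) (auto simp: g_def heq h0_def)
  moreover have "\<dots> = (1 / N) * (LINT x:cube l|lborel. f x * (\<zeta> x * k x))" by simp
  ultimately have "\<bar>LINT x:cube l|lborel. f x * (\<zeta> x * k x)\<bar> \<le> N * H"
    using N(1) by (simp add: abs_mult field_simps)
  then show ?thesis unfolding \<zeta>_def N_def S_def by simp
qed

section \<open>The negative Sobolev norm under rescaling\<close>

lemma nn_integral_cube_eq:
  fixes q :: "real^'n \<Rightarrow> real"
  assumes "l > 0" "continuous_on UNIV q" "\<And>x. 0 \<le> q x"
  shows "(\<integral>\<^sup>+x. indicator (cube l) x * ennreal (q x) \<partial>lborel) = ennreal (LINT x:cube l|lborel. q x)"
proof -
  have "(\<integral>\<^sup>+x. ennreal (indicator (cube l) x *\<^sub>R q x) \<partial>lborel) = ennreal (\<integral>x. indicator (cube l) x *\<^sub>R q x \<partial>lborel)"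
    using set_integrable_cube_continuous[OF assms(1,2)] assms(3)
    by (intro nn_integral_eq_integral) (auto simp: set_integrable_def)
  moreover have "ennreal (indicator (cube l) x *\<^sub>R q x) = indicator (cube l) x * ennreal (q x)" for x
    by (auto simp: indicator_def)
  ultimately show ?thesis by (simp add: set_lebesgue_integral_def)
qed

lemma poincare_cube_smooth:
  fixes g :: "real^'n \<Rightarrow> real"
  assumes l: "l > 0" and sm: "\<And>k. Ck_on k UNIV g" and G: "(LINT x:cube l|lborel. (norm (grad g x))\<^sup>2) \<le> 1"
  shows "\<exists>c. (LINT x:cube l|lborel. (g x - c)\<^sup>2) \<le> 2 ^ (CARD('n) + 1) * real CARD('n) * l\<^sup>2"
proof -
  have cG: "continuous_on UNIV (\<lambda>x. (norm (grad g x))\<^sup>2)"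
    by (intro continuous_intros Ck_1_grad(2)[OF sm])
  have "(\<integral>\<^sup>+x. indicator (cube l) x * ennreal ((norm (grad g x))\<^sup>2) \<partial>lborel) \<le> 1"
    using G by (subst nn_integral_cube_eq[OF l cG]) auto
  from poincare_cube[OF Ck_1_grad(1)[OF sm] Ck_1_grad(2)[OF sm] l this] obtain c
    where c: "(\<integral>\<^sup>+x. indicator (cube l) x * ennreal ((g x - c)\<^sup>2) \<partial>lborel) \<le> ennreal (2 ^ (CARD('n) + 1) * real CARD('n) * l\<^sup>2)"
    by blast
  have "continuous_on UNIV g" using sm[of 0] by simp
  then have cg: "continuous_on UNIV (\<lambda>x. (g x - c)\<^sup>2)" by (intro continuous_intros)
  have "ennreal (LINT x:cube l|lborel. (g x - c)\<^sup>2) \<le> ennreal (2 ^ (CARD('n) + 1) * real CARD('n) * l\<^sup>2)"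
    using c by (subst (asm) nn_integral_cube_eq[OF l cg]) auto
  then show ?thesis by (subst (asm) ennreal_le_iff) auto
qed

lemma integral_rescale_mult:
  fixes f g :: "real^'n \<Rightarrow> real"
  assumes "l > 0" "0 < a" "a < 1" "continuous_on (cube l) f" "continuous_on UNIV g"
  shows "(LINT x:cube l|lborel. rescale l a f x * g x) = a ^ CARD('n) * (LINT x:cube l|lborel. f x * g (a *\<^sub>R x))"
proof -
  have sub: "cube (a * l) \<subseteq> (cube l :: (real^'n) set)" using assms by (intro cube_mono) simp
  have [measurable]: "g \<in> borel_measurable borel"
    by (rule borel_measurable_continuous_onI[OF assms(5)])
  have "continuous_on (cube (a * l)) (\<lambda>x. f ((1 / a) *\<^sub>R x))"
  proof (rule continuous_on_compose2[OF assms(4)])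
    show "(\<lambda>x. (1 / a) *\<^sub>R x) ` cube (a * l) \<subseteq> cube l"
      using assms(2) by (auto simp: cube_def field_simps)
  qed (intro continuous_intros)
  then have "(\<lambda>x. indicator (cube (a * l)) x *\<^sub>R f ((1 / a) *\<^sub>R x)) \<in> borel_measurable borel"
    by (intro borel_measurable_continuous_on_indicator) auto
  moreover have "(\<lambda>x. indicator (cube (a * l)) x *\<^sub>R f ((1 / a) *\<^sub>R x)) = rescale l a f"
    by (auto simp: rescale_def indicator_def)
  ultimately have [measurable]: "rescale l a f \<in> borel_measurable borel" by simp
  have "(LINT x:cube l|lborel. rescale l a f x * g x) = (\<integral>x. indicator (cube l) x * (rescale l a f x * g x) \<partial>lborel)"
    by (simp add: set_lebesgue_integral_def)
  also have "\<dots> = a ^ CARD('n) * (\<integral>x. indicator (cube l) (0 + a *\<^sub>R x) * (rescale l a f (0 + a *\<^sub>R x) * g (0 + a *\<^sub>R x)) \<partial>lborel)"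
    by (rule integral_scale) (use assms in auto)
  also have "(\<integral>x. indicator (cube l) (0 + a *\<^sub>R x) * (rescale l a f (0 + a *\<^sub>R x) * g (0 + a *\<^sub>R x)) \<partial>lborel)
    = (LINT x:cube l|lborel. f x * g (a *\<^sub>R x))"
    unfolding set_lebesgue_integral_def
  proof (rule Bochner_Integration.integral_cong[OF refl])
    fix x :: "real^'n"
    have "x \<in> cube l \<Longrightarrow> a *\<^sub>R x \<in> cube l" using sub cube_scale_iff[OF assms(2), of x l] by blast
    then show "indicator (cube l) (0 + a *\<^sub>R x) * (rescale l a f (0 + a *\<^sub>R x) * g (0 + a *\<^sub>R x))
      = indicator (cube l) x *\<^sub>R (f x * g (a *\<^sub>R x))"
      by (auto simp: rescale_scale[OF assms(2)] indicator_def)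
  qed
  finally show ?thesis .
qed

text \<open>The torus norms of a function and of its rescaled copy in a corner are not comparable, because
  test functions on the large torus are not periodic on the small cube. Cutting a test function off in
  a layer of width \<open>\<delta>\<close> costs a factor \<open>1 / \<delta>\<close> and an error that the supremum bound makes small.\<close>
lemma Hm1_norm_rescale_le:
  fixes l :: real
  assumes l: "l > 0"
  obtains K \<delta>0 :: real where "K > 0" "\<delta>0 > 0"
    "\<And>(f::real^'n \<Rightarrow> real) M a \<delta> H. continuous_on (cube l) f \<Longrightarrow> (\<And>x. x \<in> cube l \<Longrightarrow> \<bar>f x\<bar> \<le> M) \<Longrightarrow> M \<ge> 0 \<Longrightarrow>
      0 < a \<Longrightarrow> a < 1 \<Longrightarrow> 0 < \<delta> \<Longrightarrow> \<delta> < \<delta>0 \<Longrightarrow> (LINT x:cube l|lborel. f x) = 0 \<Longrightarrow>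
      Hm1_norm l f \<le> ereal H \<Longrightarrow> H \<ge> 0 \<Longrightarrow>
      Hm1_norm l (rescale l a f) \<le> ereal (K * sqrt (a ^ CARD('n)) * (H / \<delta> + M * sqrt \<delta>))"
proof -
  let ?n = "CARD('n)"
  obtain C where C: "C \<ge> (1::real)"
    and cut: "\<And>l e. 0 < e \<Longrightarrow> 4 * e < l \<Longrightarrow> \<exists>\<phi> \<phi>1 \<phi>2. cutoff_map C l e \<phi> \<phi>1 \<phi>2"
    using cutoff_map_exists by metis
  define P where "P = 2 ^ (?n + 1) * real ?n * l\<^sup>2"
  define cl where "cl = 4 * real ?n * l ^ (?n - 1)"
  define K1 where "K1 = sqrt (2 * C ^ (2 * ?n) * (1 + real ?n ^ 2 * C\<^sup>2 * P))"
  define K2 where "K2 = (1 + C ^ ?n) / 2 * (cl + P)"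
  define \<delta>0 where "\<delta>0 = min 1 (l / 4)"
  have P: "P > 0" and cl: "cl > 0" using l by (auto simp: P_def cl_def)
  have K1: "K1 > 0" using C P unfolding K1_def by (simp add: add_pos_nonneg)
  have K2: "K2 > 0" using C P cl unfolding K2_def by (simp add: add_pos_pos)
  have main: "Hm1_norm l (rescale l a f) \<le> ereal ((K1 + K2) * sqrt (a ^ ?n) * (H / \<delta> + M * sqrt \<delta>))"
    if cf: "continuous_on (cube l) f" and fM: "\<And>x. x \<in> cube l \<Longrightarrow> \<bar>f x\<bar> \<le> M" and M: "M \<ge> 0"
      and a: "0 < a" "a < 1" and d: "0 < \<delta>" "\<delta> < \<delta>0" and f0: "(LINT x:cube l|lborel. f x) = 0"
      and H: "Hm1_norm l f \<le> ereal H" "H \<ge> 0" for f :: "real^'n \<Rightarrow> real" and M a \<delta> H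
  proof -
    have d': "4 * \<delta> < l" "\<delta> \<le> 1" using d by (auto simp: \<delta>0_def)
    obtain \<phi> \<phi>1 \<phi>2 where c: "cutoff_map C l \<delta> \<phi> \<phi>1 \<phi>2" using cut[OF d(1) d'(1)] by blast
    \<comment> \<open>Passing from g to its dilation x |-> g(a x) weakens bounds on squared L^2
      norms by at most this factor.\<close>
    define A where "A = 1 / a ^ ?n"
    have A: "A > 0" using a by (simp add: A_def)
    have bound: "\<bar>LINT x:cube l|lborel. rescale l a f x * g x\<bar> \<le> (K1 + K2) * sqrt (a ^ ?n) * (H / \<delta> + M * sqrt \<delta>)"
      if gt: "g \<in> torus_smooth l" and g1: "Lp_norm 2 (cube l) (grad g) \<le> 1" for g
    proof -
      have smg: "Ck_on j UNIV g" for j using gt by (simp add: torus_smooth_def smooth_on_UNIV)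
      have cg: "continuous_on UNIV g" using smg[of 0] by simp
      note G1 = Lp_norm_2_le_1D[OF g1]
      obtain m where m: "(LINT x:cube l|lborel. (g x - m)\<^sup>2) \<le> P"
        using poincare_cube_smooth[OF l smg G1] unfolding P_def by blast
      \<comment> \<open>The constant m from the Poincare inequality may be subtracted because f has
        mean zero. It makes k controlled in L^2, which pays for the derivative of the
        cutoff.\<close>
      define k where "k x = g (a *\<^sub>R x) - m" for x
      have smk: "Ck_on j UNIV k" for j
        unfolding k_def[abs_def]
        by (intro Ck_on_minus Ck_on_const Ck_on_compose_UNIV[OF _ _ smg] Ck_on_scaleR_const Ck_on_ident open_UNIV)
      have ck: "continuous_on UNIV k" using smk[of 0] by simp
      have gk: "grad k x = a *\<^sub>R grad g (a *\<^sub>R x)" for x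
      proof (rule grad_eqI)
        have "((\<lambda>x. a *\<^sub>R x) has_derivative (\<lambda>w. a *\<^sub>R w)) (at x)"
          by (auto intro!: derivative_eq_intros)
        from has_derivative_compose[OF this Ck_1_grad(1)[OF smg]]
        have "((\<lambda>x. g (a *\<^sub>R x)) has_derivative (\<lambda>w. a *\<^sub>R w \<bullet> grad g (a *\<^sub>R x))) (at x)" .
        from has_derivative_diff[OF this has_derivative_const[of m]]
        show "(k has_derivative (\<lambda>w. w \<bullet> (a *\<^sub>R grad g (a *\<^sub>R x)))) (at x)"
          by (simp add: k_def[abs_def])
      qed
      have Gk: "(LINT x:cube l|lborel. (norm (grad k x))\<^sup>2) \<le> A"
      proof -
        have "continuous_on UNIV (\<lambda>x. (norm (grad g x))\<^sup>2)"
          by (intro continuous_intros Ck_1_grad(2)[OF smg])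
        from integral_dilation_le[OF l a this _ G1]
        have "a ^ ?n * (LINT x:cube l|lborel. (norm (grad g (a *\<^sub>R x)))\<^sup>2) \<le> 1" by simp
        then have i: "(LINT x:cube l|lborel. (norm (grad g (a *\<^sub>R x)))\<^sup>2) \<le> A"
          using a by (simp add: A_def field_simps)
        have "(LINT x:cube l|lborel. (norm (grad k x))\<^sup>2) = a\<^sup>2 * (LINT x:cube l|lborel. (norm (grad g (a *\<^sub>R x)))\<^sup>2)"
          by (simp add: gk power_mult_distrib)
        also have "\<dots> \<le> a\<^sup>2 * A" using i by (intro mult_left_mono) auto
        also have "\<dots> \<le> 1 * A" using a A by (intro mult_right_mono) (auto simp: power_le_one)
        finally show ?thesis by simp
      qed
      have Kk: "(LINT x:cube l|lborel. (k x)\<^sup>2) \<le> A * P"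
      proof -
        have "continuous_on UNIV (\<lambda>x. (g x - m)\<^sup>2)" by (intro continuous_intros cg)
        from integral_dilation_le[OF l a this _ m]
        have "a ^ ?n * (LINT x:cube l|lborel. (g (a *\<^sub>R x) - m)\<^sup>2) \<le> P" by simp
        then show ?thesis using a by (simp add: A_def k_def field_simps)
      qed
      define \<zeta> where "\<zeta> x = (\<Prod>i\<in>UNIV. \<phi>1 (x $ i))" for x :: "real^'n"
      have cm: "\<And>j. Ck_on j UNIV \<phi>1" "\<And>x. 2 * \<delta> \<le> x \<Longrightarrow> x \<le> l - 2 * \<delta> \<Longrightarrow> \<phi>1 x = 1" "\<And>x. \<bar>\<phi>1 x\<bar> \<le> C"
        using c unfolding cutoff_map_def by blast+
      have c1: "continuous_on UNIV \<phi>1" using cm(1)[of 0] by simp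
      have c\<zeta>: "continuous_on UNIV \<zeta>"
        unfolding \<zeta>_def[abs_def]
        by (intro continuous_on_prod continuous_on_compose2[OF c1] continuous_on_component continuous_on_id) auto
      have part1: "\<bar>LINT x:cube l|lborel. f x * (\<zeta> x * k x)\<bar> \<le> K1 * sqrt A * H / \<delta>"
        unfolding \<zeta>_def K1_def
        by (rule Hm1_norm_cutoff_le[OF l C d(1) d' c smk Gk Kk less_imp_le[OF P] A H(1)])
      \<comment> \<open>The cutoff is known to be 1 from distance 2 \<open>\<delta>\<close> on,
        hence the width of the layer that carries the cutoff error.\<close>
      define Y where "Y = cube l - cbox (\<chi> i. 2 * \<delta>) ((\<chi> i. l - 2 * \<delta>)::real^'n)"
      \<comment> \<open>Weight in Young's inequality 2 |k| <= \<open>\<mu>\<close> + k^2 /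
        \<open>\<mu>\<close>. It balances the volume of the layer,
        \<open>\<mu> * (cl * \<delta>)\<close>, against the L^2 bound \<open>A * P / \<mu>\<close>:
        both become multiples of sqrt A sqrt \<open>\<delta>\<close>.\<close>
      define \<mu> where "\<mu> = sqrt A / sqrt \<delta>"
      have lam: "\<mu> > 0" using A d by (simp add: \<mu>_def)
      have Ym: "Y \<in> sets borel" unfolding Y_def by simp
      have Yfin: "emeasure lborel Y < \<infinity>"
        by (rule le_less_trans[OF emeasure_mono[of _ "cube l"]]) (use l in \<open>auto simp: Y_def emeasure_cube\<close>)
      have iY: "set_integrable lborel (cube l) (\<lambda>x. indicator Y x :: real)"
        unfolding set_integrable_def
      proof -
        have "(\<lambda>x. indicator (cube l) x *\<^sub>R indicator Y x) = (indicator Y :: real^'n \<Rightarrow> real)"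
          by (auto simp: indicator_def Y_def)
        then show "integrable lborel (\<lambda>x. indicator (cube l) x *\<^sub>R (indicator Y x :: real))"
          using Ym Yfin by (simp add: integrable_indicator_iff)
      qed
      have YI: "(LINT x:cube l|lborel. (indicator Y x :: real)) = measure lborel Y"
      proof -
        have "(\<lambda>x. indicator (cube l) x *\<^sub>R indicator Y x) = (indicator Y :: real^'n \<Rightarrow> real)"
          by (auto simp: indicator_def Y_def)
        then show ?thesis using Ym by (simp add: set_lebesgue_integral_def)
      qed
      have Yle: "measure lborel Y \<le> cl * \<delta>"
        using measure_layer[of "2 * \<delta>" l, where 'n='n] d d' by (simp add: Y_def cl_def)
      have ik2: "set_integrable lborel (cube l) (\<lambda>x. (k x)\<^sup>2)"
        by (intro set_integrable_cube_continuous[OF l] continuous_intros ck)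
      define R where "R = M * (1 + C ^ ?n) / 2"
      have R: "R \<ge> 0" using M C by (simp add: R_def)
      have ifz: "set_integrable lborel (cube l) (\<lambda>x. f x * (\<zeta> x * k x))"
        by (rule set_integrable_cube_bounded_mult[OF l _ cf fM]) (intro continuous_intros c\<zeta> ck)
      have ifz': "set_integrable lborel (cube l) (\<lambda>x. f x * ((1 - \<zeta> x) * k x))"
        by (rule set_integrable_cube_bounded_mult[OF l _ cf fM]) (intro continuous_intros c\<zeta> ck)
      have pt: "\<bar>f x * ((1 - \<zeta> x) * k x)\<bar> \<le> R * (\<mu> * indicator Y x + (k x)\<^sup>2 / \<mu>)" if x: "x \<in> cube l" for x
      proof (cases "x \<in> Y")
        case False
        then have "2 * \<delta> \<le> x $ i \<and> x $ i \<le> l - 2 * \<delta>" for i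
          using x by (simp add: Y_def mem_box_cart)
        then have "\<zeta> x = 1" using cm(2) by (simp add: \<zeta>_def)
        then show ?thesis using R lam by simp
      next
        case True
        have "\<bar>\<zeta> x\<bar> \<le> C ^ ?n" unfolding \<zeta>_def by (rule abs_prod_le_power[OF cm(3) C])
        then have z: "\<bar>1 - \<zeta> x\<bar> \<le> 1 + C ^ ?n" by linarith
        have "2 * \<mu> * \<bar>k x\<bar> \<le> \<mu>\<^sup>2 + (k x)\<^sup>2"
          using zero_le_power2[of "\<mu> - \<bar>k x\<bar>"] by (simp add: power2_diff)
        then have k: "\<bar>k x\<bar> \<le> (\<mu> + (k x)\<^sup>2 / \<mu>) / 2"
          using lam by (simp add: field_simps power2_eq_square)
        have "\<bar>f x * ((1 - \<zeta> x) * k x)\<bar> = \<bar>f x\<bar> * (\<bar>1 - \<zeta> x\<bar> * \<bar>k x\<bar>)" by (simp add: abs_mult)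
        also have "\<dots> \<le> M * ((1 + C ^ ?n) * ((\<mu> + (k x)\<^sup>2 / \<mu>) / 2))"
          using fM[OF x] z k M C by (intro mult_mono) auto
        finally show ?thesis using True by (simp add: R_def)
      qed
      have "\<bar>LINT x:cube l|lborel. f x * ((1 - \<zeta> x) * k x)\<bar> \<le> (LINT x:cube l|lborel. \<bar>f x * ((1 - \<zeta> x) * k x)\<bar>)"
        using set_integral_norm_bound[OF ifz'] by simp
      also have "\<dots> \<le> (LINT x:cube l|lborel. R * (\<mu> * indicator Y x + (k x)\<^sup>2 / \<mu>))"
      proof (rule set_integral_mono)
        show "set_integrable lborel (cube l) (\<lambda>x. \<bar>f x * ((1 - \<zeta> x) * k x)\<bar>)"
          using set_integrable_norm[OF ifz'] by simp
        show "set_integrable lborel (cube l) (\<lambda>x. R * (\<mu> * indicator Y x + (k x)\<^sup>2 / \<mu>))"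
          by (intro set_integrable_mult_right set_integral_add(1) set_integrable_divide iY ik2)
      qed (rule pt)
      also have "\<dots> = R * (\<mu> * measure lborel Y + (LINT x:cube l|lborel. (k x)\<^sup>2) / \<mu>)"
        using iY ik2 by (simp add: set_integral_add(2) YI)
      also have "\<dots> \<le> R * (\<mu> * (cl * \<delta>) + A * P / \<mu>)"
        using R lam Yle Kk by (intro mult_left_mono add_mono divide_right_mono) auto
      also have "\<mu> * (cl * \<delta>) + A * P / \<mu> = sqrt A * sqrt \<delta> * (cl + P)"
      proof -
        have "\<mu> * (cl * \<delta>) + A * P / \<mu> = sqrt A * (\<delta> / sqrt \<delta>) * cl + (A / sqrt A) * sqrt \<delta> * P"
          by (simp add: \<mu>_def mult_ac)
        also have "\<dots> = sqrt A * sqrt \<delta> * (cl + P)"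
          using A d by (simp add: real_div_sqrt algebra_simps)
        finally show ?thesis .
      qed
      also have "R * (sqrt A * sqrt \<delta> * (cl + P)) = K2 * sqrt A * (M * sqrt \<delta>)"
        by (simp add: R_def K2_def)
      finally have part2: "\<bar>LINT x:cube l|lborel. f x * ((1 - \<zeta> x) * k x)\<bar> \<le> K2 * sqrt A * (M * sqrt \<delta>)" .
      have "(LINT x:cube l|lborel. f x * g (a *\<^sub>R x)) = (LINT x:cube l|lborel. (f x * (\<zeta> x * k x) + f x * ((1 - \<zeta> x) * k x)) + f x * m)"
        by (rule set_lebesgue_integral_cong) (auto simp: k_def algebra_simps)
      also have "\<dots> = (LINT x:cube l|lborel. f x * (\<zeta> x * k x)) + (LINT x:cube l|lborel. f x * ((1 - \<zeta> x) * k x)) + (LINT x:cube l|lborel. f x * m)"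
        using ifz ifz' set_integrable_cube_bounded_mult[OF l continuous_on_const[of _ m] cf fM]
        by (simp add: set_integral_add)
      also have "(LINT x:cube l|lborel. f x * m) = 0" using f0 by simp
      finally have "\<bar>LINT x:cube l|lborel. f x * g (a *\<^sub>R x)\<bar> \<le> K1 * sqrt A * H / \<delta> + K2 * sqrt A * (M * sqrt \<delta>)"
        using part1 part2 by linarith
      also have "\<dots> \<le> (K1 + K2) * sqrt A * (H / \<delta> + M * sqrt \<delta>)"
        using K1 K2 A H(2) M d by (simp add: algebra_simps)
      finally have e: "\<bar>LINT x:cube l|lborel. f x * g (a *\<^sub>R x)\<bar> \<le> (K1 + K2) * sqrt A * (H / \<delta> + M * sqrt \<delta>)" .
      \<comment> \<open>The substitution gives a^n and the test function a^(-n/2), which leaves the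
        factor a^(n/2) of the statement.\<close>
      have sa: "a ^ ?n * sqrt A = sqrt (a ^ ?n)"
        using a by (simp add: A_def real_sqrt_divide real_div_sqrt)
      have "\<bar>LINT x:cube l|lborel. rescale l a f x * g x\<bar> = a ^ ?n * \<bar>LINT x:cube l|lborel. f x * g (a *\<^sub>R x)\<bar>"
        using a by (simp add: integral_rescale_mult[OF l a cf cg] abs_mult)
      also have "\<dots> \<le> a ^ ?n * ((K1 + K2) * sqrt A * (H / \<delta> + M * sqrt \<delta>))"
        using e a by (intro mult_left_mono) auto
      also have "\<dots> = (K1 + K2) * (a ^ ?n * sqrt A) * (H / \<delta> + M * sqrt \<delta>)" by simp
      finally show ?thesis unfolding sa .
    qed
    show ?thesis unfolding Hm1_norm_def
      by (rule SUP_least) (use bound in auto)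
  qed
  show ?thesis
  proof (rule that)
    show "K1 + K2 > 0" "\<delta>0 > 0" using K1 K2 l by (auto simp: \<delta>0_def)
  qed (rule main)
qed

text \<open>Constants have zero gradient, so arbitrarily large ones are admissible test
  functions.\<close>

lemma Hm1_norm_infinite:
  fixes f :: "real^'n \<Rightarrow> real"
  assumes "(LINT x:cube l|lborel. f x) \<noteq> 0"
  shows "Hm1_norm l f = \<infinity>"
proof -
  have g0: "grad (\<lambda>x. c) x = 0" for c :: real and x :: "real^'n"
    by (rule grad_eqI) simp
  have mem: "(\<lambda>x::real^'n. c) \<in> {g \<in> torus_smooth l. Lp_norm 2 (cube l) (grad g) \<le> 1}" for c :: real
    by (simp add: torus_smooth_def smooth_on_UNIV g0 Lp_norm_def)
  have "ereal B \<le> Hm1_norm l f" for B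
  proof -
    define c where "c = \<bar>B\<bar> / (LINT x:cube l|lborel. f x)"
    have "\<bar>LINT x:cube l|lborel. f x * c\<bar> = \<bar>B\<bar>" using assms by (simp add: c_def)
    then have "ereal \<bar>B\<bar> \<le> Hm1_norm l f"
      unfolding Hm1_norm_def using SUP_upper[OF mem[of c], of "\<lambda>g. ereal \<bar>LINT x:cube l|lborel. f x * g x\<bar>"] by simp
    then show ?thesis by (rule order_trans[rotated]) simp
  qed
  then show ?thesis by (rule ereal_top)
qed

lemma Hm1_norm_nonneg: "0 \<le> Hm1_norm l (f :: real^'n \<Rightarrow> real)"
proof -
  have g0: "grad (\<lambda>x. 0) x = 0" for x :: "real^'n"
    by (rule grad_eqI) simp
  have mem: "(\<lambda>x::real^'n. 0) \<in> {g \<in> torus_smooth l. Lp_norm 2 (cube l) (grad g) \<le> 1}"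
    by (simp add: torus_smooth_def smooth_on_UNIV g0 Lp_norm_def)
  show ?thesis
    unfolding Hm1_norm_def using SUP_upper[OF mem, of "\<lambda>g. ereal \<bar>LINT x:cube l|lborel. f x * g x\<bar>"]
    by (simp add: zero_ereal_def)
qed

section \<open>Smooth velocity fields on the cube\<close>

lemma has_derivative_jacobianI:
  fixes f :: "real^'n \<Rightarrow> real^'m"
  assumes "(f has_derivative D) (at x)" shows "jacobian f (at x) = (\<chi> i k. D (axis k 1) $ i)"
  by (simp add: jacobian_def matrix_def frechet_derivative_at[OF assms, symmetric])

lemma jacobian_cong_open:
  fixes f g :: "real^'n \<Rightarrow> real^'m"
  assumes "open U" "x \<in> U" "\<And>y. y \<in> U \<Longrightarrow> f y = g y" "f differentiable at x"
  shows "jacobian f (at x) = jacobian g (at x)"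
proof -
  have D: "(f has_derivative frechet_derivative f (at x)) (at x)"
    using assms(4) by (simp add: frechet_derivative_works)
  then have "(g has_derivative frechet_derivative f (at x)) (at x)"
    using has_derivative_transform_within_open[OF _ assms(1,2)] assms(3) by blast
  then show ?thesis by (simp add: has_derivative_jacobianI[OF D] has_derivative_jacobianI)
qed

lemma Ck_1_jacobian:
  fixes f :: "real^'n \<Rightarrow> real^'m"
  assumes "Ck_on (Suc 0) UNIV f" shows "continuous_on UNIV (\<lambda>x. jacobian f (at x))"
  unfolding jacobian_def matrix_def using assms
  by (intro continuous_on_vec_lambda continuous_on_component) (simp add: Ck_on.simps(2))

lemma norm_matrix_le:
  fixes A :: "real^'n^'m"
  assumes "\<And>i k. \<bar>A $ i $ k\<bar> \<le> b" shows "norm A \<le> real CARD('m) * (real CARD('n) * b)"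
proof -
  have "norm A \<le> (\<Sum>i\<in>UNIV. norm (A $ i))"
    unfolding norm_vec_def[of A] by (rule L2_set_le_sum) auto
  also have "\<dots> \<le> (\<Sum>i\<in>(UNIV::'m set). real CARD('n) * b)"
  proof (rule sum_mono)
    fix i
    have "norm (A $ i) \<le> (\<Sum>k\<in>UNIV. \<bar>A $ i $ k\<bar>)" by (rule norm_le_l1_cart)
    also have "\<dots> \<le> (\<Sum>k\<in>(UNIV::'n set). b)" by (rule sum_mono) (rule assms)
    finally show "norm (A $ i) \<le> real CARD('n) * b" by simp
  qed
  finally show ?thesis by simp
qed

lemma cube_closureI: "x \<in> cube l \<Longrightarrow> x \<in> closure (cube l)"
  using closure_subset by blast

text \<open>G is a smooth extension of u beyond the closed cube. Outside that cube u is arbitrary,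
  so derivatives up to the boundary are taken from G; in the open cube they agree with those of
  u.\<close>

locale smooth_velocity =
  fixes l :: real and u :: "real \<Rightarrow> real^'n \<Rightarrow> real^'n"
    and W :: "(real \<times> (real^'n)) set" and G :: "real \<times> (real^'n) \<Rightarrow> real^'n"
  assumes l: "l > 0" and oW: "open W" and sub: "{0..} \<times> closure (cube l) \<subseteq> W"
    and smG: "\<And>k. Ck_on k W G"
    and uG: "\<And>s x. s \<ge> 0 \<Longrightarrow> x \<in> closure (cube l) \<Longrightarrow> u s x = G (s, x)"
    and div0: "\<And>s x. s \<ge> 0 \<Longrightarrow> x \<in> cube l \<Longrightarrow> divergence (u s) x = 0"
    and bd0: "\<And>s x. s \<ge> 0 \<Longrightarrow> x \<in> frontier (cube l) \<Longrightarrow> u s x = 0"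
begin

definition "DG z = frechet_derivative G (at z)"

definition J :: "real \<times> (real^'n) \<Rightarrow> 'n \<Rightarrow> 'n \<Rightarrow> real" where
  "J z i k = DG z (0, axis k 1) $ i"

lemma DG: "z \<in> W \<Longrightarrow> (G has_derivative DG z) (at z)"
  using smG[of "Suc 0"] by (simp add: DG_def Ck_on.simps(2) frechet_derivative_works)

lemma cont_J: "continuous_on W (\<lambda>z. J z i k)"
  unfolding J_def DG_def using smG[of "Suc 0"]
  by (intro continuous_on_component) (simp add: Ck_on.simps(2))

lemma memW: "s \<ge> 0 \<Longrightarrow> x \<in> closure (cube l) \<Longrightarrow> (s, x) \<in> W"
  using sub by auto

lemma G_space_deriv:
  assumes "(s, x) \<in> W"
  shows "((\<lambda>y. G (s, y)) has_derivative (\<lambda>w. DG (s, x) (0, w))) (at x)"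
proof -
  have "((\<lambda>y. (s, y)) has_derivative (\<lambda>h. (0, h))) (at x)"
    by (auto intro!: derivative_eq_intros)
  from has_derivative_compose[OF this DG[OF assms]] show ?thesis .
qed

lemma jacobian_u:
  assumes "s \<ge> 0" "x \<in> cube l"
  shows "jacobian (u s) (at x) = (\<chi> i k. J (s, x) i k)"
proof -
  have xW: "(s, x) \<in> W" using assms closure_subset by (blast intro: memW)
  note D = G_space_deriv[OF xW]
  have "jacobian (\<lambda>y. G (s, y)) (at x) = jacobian (u s) (at x)"
    using D assms
    by (intro jacobian_cong_open[OF open_cube assms(2)]) (auto simp: uG cube_closureI differentiable_def)
  then show ?thesis by (simp add: has_derivative_jacobianI[OF D] J_def)
qed

lemma trace_J:
  assumes "s \<ge> 0" "x \<in> cube l"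
  shows "(\<Sum>k\<in>UNIV. J (s, x) k k) = 0"
  using div0[OF assms] by (simp add: divergence_def jacobian_u[OF assms] trace_def)

lemma G_frontier: "s \<ge> 0 \<Longrightarrow> x \<in> closure (cube l) \<Longrightarrow> x $ i = 0 \<or> x $ i = l \<Longrightarrow> G (s, x) = 0"
  using mem_frontier_cube[of x l i] bd0[of s x] uG[of s x] by simp

lemma J_bounded:
  obtains b where "b \<ge> 0" "\<And>s x i k. 0 \<le> s \<Longrightarrow> s \<le> T \<Longrightarrow> x \<in> closure (cube l) \<Longrightarrow> \<bar>J (s, x) i k\<bar> \<le> b"
proof -
  have c: "compact ({0..T} \<times> closure (cube l :: (real^'n) set))"
    by (intro compact_Times compact_Icc) (simp add: closure_cube[OF l])
  have "\<exists>b. \<forall>z\<in>{0..T} \<times> closure (cube l). \<bar>J z i k\<bar> \<le> b" for i k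
  proof -
    have s: "{0..T} \<times> closure (cube l) \<subseteq> W" using sub by auto
    have "bounded ((\<lambda>z. J z i k) ` ({0..T} \<times> closure (cube l)))"
      by (intro compact_imp_bounded compact_continuous_image c continuous_on_subset[OF cont_J s])
    then show ?thesis by (auto simp: bounded_iff)
  qed
  then obtain B where B: "\<And>i k z. z \<in> {0..T} \<times> closure (cube l) \<Longrightarrow> \<bar>J z i k\<bar> \<le> B i k" by metis
  define b where "b = (\<Sum>i\<in>UNIV. \<Sum>k\<in>UNIV. \<bar>B i k\<bar>)"
  have "B i k \<le> b" for i k
  proof -
    have "\<bar>B i k\<bar> \<le> (\<Sum>k\<in>UNIV. \<bar>B i k\<bar>)" by (rule member_le_sum) auto
    also have "\<dots> \<le> b" unfolding b_def by (rule member_le_sum[of i _ "\<lambda>i. \<Sum>k\<in>UNIV. \<bar>B i k\<bar>"]) (auto intro: sum_nonneg)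
    finally show ?thesis by simp
  qed
  then have "\<bar>J (s, x) i k\<bar> \<le> b" if "0 \<le> s" "s \<le> T" "x \<in> closure (cube l)" for s x i k
    using B[of "(s, x)" i k] that by (auto intro: order_trans)
  moreover have "b \<ge> 0" unfolding b_def by (intro sum_nonneg) auto
  ultimately show ?thesis using that by blast
qed

text \<open>Mean value theorem on the line through x in direction k, at whose ends on the two
  opposite faces G vanishes. All components vanish there, so i and k are independent: i = k serves
  the maximum principle, and distinct indices serve the product-rule terms in
  \<open>E_bound\<close>.\<close>

lemma G_boundary_bound:
  assumes b: "\<And>s x i k. 0 \<le> s \<Longrightarrow> s \<le> T \<Longrightarrow> x \<in> closure (cube l) \<Longrightarrow> \<bar>J (s, x) i k\<bar> \<le> b"
    and s: "0 \<le> s" "s \<le> T" and x: "x \<in> closure (cube l)"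
  shows "\<bar>G (s, x) $ i\<bar> \<le> b * min (x $ k) (l - x $ k)"
proof -
  define X where "X h = x + (h - x $ k) *\<^sub>R axis k 1" for h
  have Xk: "X h $ k = h" for h by (simp add: X_def)
  have Xc: "X h \<in> closure (cube l)" if "0 \<le> h" "h \<le> l" for h
    using x that by (auto simp: mem_closure_cube[OF l] X_def axis_def)
  have XX: "X (x $ k) = x" by (simp add: X_def)
  have xk: "0 \<le> x $ k" "x $ k \<le> l" using x by (auto simp: mem_closure_cube[OF l])
  define \<psi> where "\<psi> h = G (s, X h) $ i" for h
  have D: "(\<psi> has_real_derivative J (s, X h) i k) (at h)" if "0 \<le> h" "h \<le> l" for h
  proof -
    have "(X has_derivative (\<lambda>r. r *\<^sub>R axis k 1)) (at h)"
      unfolding X_def[abs_def] by (auto intro!: derivative_eq_intros)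
    from has_derivative_compose[OF this G_space_deriv[OF memW[OF s(1) Xc[OF that]]]]
    have "((\<lambda>h. G (s, X h)) has_derivative (\<lambda>r. DG (s, X h) (0, r *\<^sub>R axis k 1))) (at h)" .
    from bounded_linear.has_derivative[OF bounded_linear_vec_nth this]
    have 1: "(\<psi> has_derivative (\<lambda>r. DG (s, X h) (0, r *\<^sub>R axis k 1) $ i)) (at h)"
      unfolding \<psi>_def[abs_def] .
    interpret A: bounded_linear "DG (s, X h)"
      using DG[OF memW[OF s(1) Xc[OF that]]] by (rule has_derivative_bounded_linear)
    have "(\<lambda>r. DG (s, X h) (0, r *\<^sub>R axis k 1) $ i) = (*) (J (s, X h) i k)"
    proof
      fix r
      show "DG (s, X h) (0, r *\<^sub>R axis k 1) $ i = J (s, X h) i k * r"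
        using A.scaleR[of r "(0, axis k 1)"] by (simp add: J_def)
    qed
    with 1 show ?thesis by (simp only: has_field_derivative_def)
  qed
  have z0: "\<psi> 0 = 0" "\<psi> l = 0"
    using G_frontier[OF s(1) Xc, of 0 k] G_frontier[OF s(1) Xc, of l k] l by (auto simp: \<psi>_def Xk)
  have inc: "\<bar>\<psi> h2 - \<psi> h1\<bar> \<le> b * (h2 - h1)" if h: "0 \<le> h1" "h1 \<le> h2" "h2 \<le> l" for h1 h2
  proof (cases "h1 = h2")
    case False
    then have "h1 < h2" using h by simp
    then obtain z where z: "z > h1" "z < h2" "\<psi> h2 - \<psi> h1 = (h2 - h1) * J (s, X z) i k"
      using MVT2[of h1 h2 \<psi> "\<lambda>z. J (s, X z) i k"] D h by (smt (verit))
    have "\<bar>J (s, X z) i k\<bar> \<le> b" using b[OF s Xc] z h by auto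
    then show ?thesis using z \<open>h1 < h2\<close> by (simp add: abs_mult mult.commute mult_right_mono)
  qed simp
  have e: "\<psi> (x $ k) = G (s, x) $ i" by (simp add: \<psi>_def XX)
  have "\<bar>G (s, x) $ i\<bar> \<le> b * (x $ k)" using inc[of 0 "x $ k"] xk z0 e by simp
  moreover have "\<bar>G (s, x) $ i\<bar> \<le> b * (l - x $ k)" using inc[of "x $ k" l] xk z0 e by simp
  ultimately show ?thesis by (simp add: min_def)
qed

text \<open>The set integral of a nonintegrable function is 0, so comparing time integrals requires
  the dominating function to be integrable. Measurability in s comes from Fubini, boundedness from
  the compactness of [0, T] times the closed cube.\<close>

lemma grad_Lp_integrable:
  assumes "p \<ge> 1"
  shows "set_integrable lborel {0..T} (\<lambda>s. grad_Lp l p (u s))"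
proof -
  obtain b where b: "b \<ge> 0" "\<And>s x i k. 0 \<le> s \<Longrightarrow> s \<le> T \<Longrightarrow> x \<in> closure (cube l) \<Longrightarrow> \<bar>J (s, x) i k\<bar> \<le> b"
    using J_bounded by metis
  define S where "S = {0..T} \<times> (cube l :: (real^'n) set)"
  define M where "M z = (\<chi> i k. J z i k)" for z
  define b' where "b' = real CARD('n) * (real CARD('n) * b)"
  have Mb: "norm (M (s, x)) powr p \<le> b' powr p" if "s \<in> {0..T}" "x \<in> cube l" for s x
  proof (rule powr_mono2)
    show "norm (M (s, x)) \<le> b'" unfolding b'_def
      by (rule norm_matrix_le) (use b that in \<open>auto simp: M_def cube_closureI\<close>)
  qed (use assms in auto)
  have Ssub: "S \<subseteq> W" using sub closure_subset unfolding S_def by fastforce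
  have cM: "continuous_on S (\<lambda>z. norm (M z) powr p)"
    unfolding M_def
    by (intro continuous_on_powr' continuous_intros continuous_on_vec_lambda continuous_on_subset[OF cont_J Ssub])
      (use assms in auto)
  have Sb: "S \<in> sets borel" unfolding S_def by (intro borel_Times) auto
  have m: "(\<lambda>z. indicator S z *\<^sub>R (norm (M z) powr p)) \<in> borel_measurable (lborel \<Otimes>\<^sub>M lborel)"
    using borel_measurable_continuous_on_indicator[OF Sb cM] by (simp add: lborel_prod)
  define F where "F s = (\<integral>x. indicator S (s, x) *\<^sub>R (norm (M (s, x)) powr p) \<partial>lborel)" for s
  have Fm: "F \<in> borel_measurable lborel"
    unfolding F_def[abs_def] using m by (intro lborel.borel_measurable_lebesgue_integral) (simp add: case_prod_beta')
  have eq: "indicator {0..T} s *\<^sub>R grad_Lp l p (u s) = indicator {0..T} s *\<^sub>R (F s powr (1 / p))" for s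
  proof (cases "s \<in> {0..T}")
    case True
    have "(LINT x:cube l|lborel. norm (jacobian (u s) (at x)) powr p) = F s"
      unfolding F_def set_lebesgue_integral_def using True
      by (intro Bochner_Integration.integral_cong) (auto simp: S_def M_def jacobian_u indicator_def)
    then show ?thesis by (simp add: grad_Lp_def Lp_norm_def)
  qed simp
  have Fb: "F s \<le> b' powr p * l ^ CARD('n) \<and> 0 \<le> F s" if s: "s \<in> {0..T}" for s
  proof
    show "0 \<le> F s" unfolding F_def by (intro Bochner_Integration.integral_nonneg) auto
    have int: "integrable lborel (\<lambda>x::real^'n. indicator (cube l) x *\<^sub>R (b' powr p))"
      using l by (simp add: integrable_indicator_iff emeasure_cube)
    show "F s \<le> b' powr p * l ^ CARD('n)"
    proof (cases "integrable lborel (\<lambda>x. indicator S (s, x) *\<^sub>R (norm (M (s, x)) powr p))")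
      case True
      have "F s \<le> (\<integral>x. indicator (cube l :: (real^'n) set) x *\<^sub>R (b' powr p) \<partial>lborel)"
        unfolding F_def using Mb[OF s] s
        by (intro integral_mono[OF True int]) (auto simp: S_def indicator_def)
      also have "\<dots> = b' powr p * l ^ CARD('n)"
        using l by (simp add: measure_def emeasure_cube)
      finally show ?thesis .
    next
      case False
      \<comment> \<open>The integral takes its default value 0, so the bound holds here as
        well.\<close>
      then show ?thesis using l by (simp add: F_def not_integrable_integral_eq)
    qed
  qed
  show ?thesis unfolding set_integrable_def eq
  proof (rule Bochner_Integration.integrable_bound)
    show "integrable lborel (\<lambda>s. indicator {0..T} s *\<^sub>R ((b' powr p * l ^ CARD('n)) powr (1 / p)))"
      by (simp add: integrable_indicator_iff emeasure_lborel_Icc_eq)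
    show "(\<lambda>s. indicator {0..T} s *\<^sub>R (F s powr (1 / p))) \<in> borel_measurable lborel"
      using Fm by measurable
    show "AE s in lborel. norm (indicator {0..T} s *\<^sub>R (F s powr (1 / p)))
      \<le> norm (indicator {0..T} s *\<^sub>R ((b' powr p * l ^ CARD('n)) powr (1 / p)))"
    proof (rule AE_I2)
      fix s :: real
      show "norm (indicator {0..T} s *\<^sub>R (F s powr (1 / p)))
        \<le> norm (indicator {0..T} s *\<^sub>R ((b' powr p * l ^ CARD('n)) powr (1 / p)))"
        using Fb[of s] assms by (auto simp: indicator_def intro!: powr_mono2)
    qed
  qed
qed

lemma u_boundary_bound:
  assumes "0 \<le> T"
  obtains L where "L \<ge> 0" "\<And>s x i. 0 \<le> s \<Longrightarrow> s \<le> T \<Longrightarrow> x \<in> cube l \<Longrightarrow> \<bar>u s x $ i\<bar> \<le> L * min (x $ i) (l - x $ i)"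
proof -
  obtain b where b: "b \<ge> 0" "\<And>s x i k. 0 \<le> s \<Longrightarrow> s \<le> T \<Longrightarrow> x \<in> closure (cube l) \<Longrightarrow> \<bar>J (s, x) i k\<bar> \<le> b"
    using J_bounded by metis
  have "\<bar>u s x $ i\<bar> \<le> b * min (x $ i) (l - x $ i)" if "0 \<le> s" "s \<le> T" "x \<in> cube l" for s x i
    using G_boundary_bound[OF b(2) that(1,2), of x i i] that uG[of s x] by (simp add: cube_closureI)
  then show ?thesis using that b(1) by blast
qed

end

section \<open>Velocity fields cut off near the boundary\<close>

text \<open>Converts an excess of 1 in the p-th power integral into an additive constant in the
  norm.\<close>

lemma powr_p_le_add:
  fixes I :: real
  assumes "I \<ge> 0" "p \<ge> 1" shows "(I + 1) powr (1 / p) \<le> 2 * (I powr (1 / p) + 1)"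
proof -
  have e: "0 \<le> 1 / p" "1 / p \<le> 1" using assms(2) by auto
  have "(I + 1) powr (1 / p) \<le> (2 * max I 1) powr (1 / p)"
    using assms e by (intro powr_mono2) linarith+
  also have "\<dots> = 2 powr (1 / p) * (max I 1) powr (1 / p)" by (rule powr_mult)
  also have "\<dots> \<le> 2 powr 1 * (max I 1) powr (1 / p)"
    using e by (intro mult_right_mono powr_mono) auto
  also have "(max I 1) powr (1 / p) \<le> I powr (1 / p) + 1"
    by (simp add: max_def)
  finally show ?thesis by simp
qed

lemma has_derivative_vec:
  fixes f :: "'n::finite \<Rightarrow> 'a::real_normed_vector \<Rightarrow> real"
  assumes "\<And>i. (f i has_derivative f' i) (at x)"
  shows "((\<lambda>x. \<chi> i. f i x) has_derivative (\<lambda>w. \<chi> i. f' i w)) (at x)"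
  using assms by (subst has_derivative_componentwise_within) (auto simp: Basis_vec_def inner_axis)

locale cut_velocity = smooth_velocity l u W G for l u W and G :: "real \<times> (real^'n) \<Rightarrow> real^'n" +
  fixes C e :: real and \<phi> \<phi>1 \<phi>2 :: "real \<Rightarrow> real"
  assumes C: "C \<ge> 1" and e: "0 < e" "4 * e < l" and cut: "cutoff_map C l e \<phi> \<phi>1 \<phi>2"
begin

lemma cm: "\<And>j. Ck_on j UNIV \<phi>" "\<And>j. Ck_on j UNIV \<phi>1"
    "\<And>x. (\<phi> has_real_derivative \<phi>1 x) (at x)" "\<And>x. (\<phi>1 has_real_derivative \<phi>2 x) (at x)"
    "\<And>x. 0 \<le> \<phi> x" "\<And>x. \<phi> x \<le> l"
    "\<And>x. 2 * e \<le> x \<Longrightarrow> x \<le> l - 2 * e \<Longrightarrow> \<phi> x = x"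
    "\<And>x. 2 * e \<le> x \<Longrightarrow> x \<le> l - 2 * e \<Longrightarrow> \<phi>1 x = 1"
    "\<And>x. 2 * e \<le> x \<Longrightarrow> x \<le> l - 2 * e \<Longrightarrow> \<phi>2 x = 0"
    "\<And>x. x \<le> e \<Longrightarrow> \<phi> x = 0" "\<And>x. x \<ge> l - e \<Longrightarrow> \<phi> x = l"
    "\<And>x. \<bar>\<phi>1 x\<bar> \<le> C" "\<And>x. \<bar>\<phi>2 x\<bar> * min (\<phi> x) (l - \<phi> x) \<le> C"
  using cut unfolding cutoff_map_def by blast+

text \<open>0 and l bound the values of \<open>\<phi>\<close>, so a point where one of them is
  attained is an extremum.\<close>

lemma \<phi>1_zero: assumes "\<phi> x = 0 \<or> \<phi> x = l" shows "\<phi>1 x = 0"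
proof (cases "\<phi> x = 0")
  case True
  then show ?thesis using DERIV_local_min[OF cm(3), of 1 x] cm(5) by auto
next
  case False
  then show ?thesis using DERIV_local_max[OF cm(3), of 1 x] cm(6) assms by auto
qed

definition \<Phi> :: "real^'n \<Rightarrow> real^'n" where "\<Phi> y = (\<chi> i. \<phi> (y $ i))"

text \<open>Piola transform: the pull-back by \<open>\<Phi>\<close> as a flux, hence again divergence free.\<close>
definition \<omega> :: "real \<Rightarrow> real^'n \<Rightarrow> real^'n" where
  "\<omega> s y = (\<chi> i. (\<Prod>j\<in>UNIV - {i}. \<phi>1 (y $ j)) * G (s, \<Phi> y) $ i)"

text \<open>Entry (i, k) of the Jacobian of \<open>\<omega> s\<close>. The first summand is zero for
  k = i because component i of \<open>\<omega>\<close> omits the factor with index i.\<close>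

definition E :: "real \<Rightarrow> real^'n \<Rightarrow> 'n \<Rightarrow> 'n \<Rightarrow> real" where
  "E s y i k = (if k = i then 0 else \<phi>2 (y $ k) * (\<Prod>j\<in>UNIV - {i} - {k}. \<phi>1 (y $ j))) * G (s, \<Phi> y) $ i
    + (\<Prod>j\<in>UNIV - {i}. \<phi>1 (y $ j)) * (\<phi>1 (y $ k) * J (s, \<Phi> y) i k)"

lemma \<Phi>_closure: "\<Phi> y \<in> closure (cube l)"
  by (simp add: mem_closure_cube[OF l] \<Phi>_def cm)

lemma \<Phi>W: "s \<ge> 0 \<Longrightarrow> (s, \<Phi> y) \<in> W"
  by (rule memW[OF _ \<Phi>_closure])

lemma coord_deriv:
  assumes "(f has_real_derivative f') (at (y $ i))"
  shows "((\<lambda>y::real^'n. f (y $ i)) has_derivative (\<lambda>w. f' * w $ i)) (at y)"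
  using has_derivative_compose[OF bounded_linear_imp_has_derivative[OF bounded_linear_vec_nth] , of f "(*) f'" y i] assms
  by (simp add: has_field_derivative_def)

lemma \<Phi>_deriv: "(\<Phi> has_derivative (\<lambda>w. \<chi> i. \<phi>1 (y $ i) * w $ i)) (at y)"
  unfolding \<Phi>_def[abs_def]
  by (rule has_derivative_vec[OF coord_deriv]) (rule cm)

lemma \<omega>_deriv:
  assumes "s \<ge> 0"
  shows "\<exists>D. (\<omega> s has_derivative D) (at y) \<and> (\<forall>i k. D (axis k 1) $ i = E s y i k)"
proof -
  let ?g = "\<lambda>w. DG (s, \<Phi> y) (0, \<chi> m. \<phi>1 (y $ m) * w $ m)"
  let ?P = "\<lambda>i y. \<Prod>j\<in>UNIV - {i}. \<phi>1 (y $ j)"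
  let ?P' = "\<lambda>i w. \<Sum>k\<in>UNIV - {i}. (\<phi>2 (y $ k) * w $ k) * (\<Prod>j\<in>UNIV - {i} - {k}. \<phi>1 (y $ j))"
  have g: "((\<lambda>y. G (s, \<Phi> y)) has_derivative ?g) (at y)"
    using has_derivative_compose[OF \<Phi>_deriv G_space_deriv[OF \<Phi>W[OF assms]]] .
  have gi: "((\<lambda>y. G (s, \<Phi> y) $ i) has_derivative (\<lambda>w. ?g w $ i)) (at y)" for i
    by (rule bounded_linear.has_derivative[OF bounded_linear_vec_nth g])
  have P: "(?P i has_derivative ?P' i) (at y)" for i
    by (rule has_derivative_prod) (rule coord_deriv[OF cm(4)])
  define D where "D w = (\<chi> i. ?P i y * (?g w $ i) + ?P' i w * G (s, \<Phi> y) $ i)" for w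
  have "(\<omega> s has_derivative D) (at y)"
    unfolding \<omega>_def[abs_def] D_def[abs_def]
    by (rule has_derivative_vec) (rule has_derivative_mult[OF P gi])
  moreover have "D (axis k 1) $ i = E s y i k" for i k
  proof -
    interpret A: bounded_linear "DG (s, \<Phi> y)"
      using DG[OF \<Phi>W[OF assms]] by (rule has_derivative_bounded_linear)
    have "(\<chi> m. \<phi>1 (y $ m) * axis k 1 $ m) = \<phi>1 (y $ k) *\<^sub>R (axis k 1 :: real^'n)"
      by (simp add: vec_eq_iff axis_def)
    then have "?g (axis k 1) = \<phi>1 (y $ k) *\<^sub>R DG (s, \<Phi> y) (0, axis k 1)"
      using A.scaleR[of "\<phi>1 (y $ k)" "(0, axis k 1)"] by simp
    then have 1: "?g (axis k 1) $ i = \<phi>1 (y $ k) * J (s, \<Phi> y) i k" by (simp add: J_def)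
    have "?P' i (axis k 1) = (\<Sum>m\<in>UNIV - {i}. if m = k then \<phi>2 (y $ k) * (\<Prod>j\<in>UNIV - {i} - {k}. \<phi>1 (y $ j)) else 0)"
      by (rule sum.cong) (auto simp: axis_def)
    also have "\<dots> = (if k = i then 0 else \<phi>2 (y $ k) * (\<Prod>j\<in>UNIV - {i} - {k}. \<phi>1 (y $ j)))"
      by (simp add: sum.delta)
    finally show ?thesis unfolding D_def E_def by (simp add: 1)
  qed
  ultimately show ?thesis by blast
qed

lemma \<omega>_differentiable: "s \<ge> 0 \<Longrightarrow> \<omega> s differentiable (at y)"
  using \<omega>_deriv differentiable_def by blast

lemma jacobian_\<omega>: "s \<ge> 0 \<Longrightarrow> jacobian (\<omega> s) (at y) = (\<chi> i k. E s y i k)"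
  using \<omega>_deriv[of s y] has_derivative_jacobianI[of "\<omega> s" _ y] by (auto simp: vec_eq_iff)

text \<open>Every diagonal entry carries the full product of the \<open>\<phi>1\<close>, so the
  trace is this product times the divergence of the velocity at \<open>\<Phi> y\<close>. The
  divergence vanishes if \<open>\<Phi> y\<close> is in the open cube, and the product vanishes if
  \<open>\<Phi> y\<close> is on the boundary.\<close>

lemma trace_E: "s \<ge> 0 \<Longrightarrow> (\<Sum>k\<in>UNIV. E s y k k) = 0"
proof -
  assume s: "s \<ge> 0"
  have "E s y k k = (\<Prod>j\<in>UNIV. \<phi>1 (y $ j)) * J (s, \<Phi> y) k k" for k
    unfolding E_def by (simp add: prod.remove[of UNIV k "\<lambda>j. \<phi>1 (y $ j)"])
  then have eq: "(\<Sum>k\<in>UNIV. E s y k k) = (\<Prod>j\<in>UNIV. \<phi>1 (y $ j)) * (\<Sum>k\<in>UNIV. J (s, \<Phi> y) k k)"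
    by (simp add: sum_distrib_left)
  show ?thesis
  proof (cases "\<Phi> y \<in> cube l")
    case True
    then show ?thesis using eq trace_J[OF s True] by simp
  next
    case False
    then obtain j where "\<not> (0 < \<phi> (y $ j) \<and> \<phi> (y $ j) < l)" by (auto simp: cube_def \<Phi>_def)
    then have "\<phi> (y $ j) = 0 \<or> \<phi> (y $ j) = l" using cm(5,6)[of "y $ j"] by linarith
    then have "\<phi>1 (y $ j) = 0" by (rule \<phi>1_zero)
    then have "(\<Prod>j\<in>UNIV. \<phi>1 (y $ j)) = 0" by (intro prod_zero) auto
    then show ?thesis using eq by simp
  qed
qed

text \<open>The bound does not involve e: the factor \<open>\<phi>2 (y $ k)\<close>, of size 1/e,
  meets G at distance at most min(\<open>\<phi>\<close>, l - \<open>\<phi>\<close>) from a face, and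
  the last clause of \<open>cutoff_map\<close> bounds the product.\<close>

lemma E_bound:
  assumes b: "\<And>s x i k. 0 \<le> s \<Longrightarrow> s \<le> T \<Longrightarrow> x \<in> closure (cube l) \<Longrightarrow> \<bar>J (s, x) i k\<bar> \<le> b"
    and "b \<ge> 0" and s: "0 \<le> s" "s \<le> T"
  shows "\<bar>E s y i k\<bar> \<le> 2 * (C ^ CARD('n) * (C * b))"
proof -
  have P: "\<bar>\<Prod>j\<in>A. \<phi>1 (y $ j)\<bar> \<le> C ^ CARD('n)" for A by (rule abs_prod_le_power[OF cm(12) C])
  have Cn: "0 \<le> C ^ CARD('n)" using C by simp
  have "\<bar>\<phi>2 (y $ k) * G (s, \<Phi> y) $ i\<bar> \<le> C * b"
  proof -
    have "\<bar>G (s, \<Phi> y) $ i\<bar> \<le> b * min (\<phi> (y $ k)) (l - \<phi> (y $ k))"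
      using G_boundary_bound[OF b s \<Phi>_closure, of y i k] by (simp add: \<Phi>_def)
    then have "\<bar>\<phi>2 (y $ k)\<bar> * \<bar>G (s, \<Phi> y) $ i\<bar> \<le> \<bar>\<phi>2 (y $ k)\<bar> * (b * min (\<phi> (y $ k)) (l - \<phi> (y $ k)))"
      by (intro mult_left_mono) auto
    also have "\<dots> = b * (\<bar>\<phi>2 (y $ k)\<bar> * min (\<phi> (y $ k)) (l - \<phi> (y $ k)))" by simp
    also have "\<dots> \<le> b * C" using cm(13) assms(2) by (intro mult_left_mono) auto
    finally show ?thesis by (simp add: abs_mult mult.commute)
  qed
  then have "\<bar>\<Prod>j\<in>UNIV - {i} - {k}. \<phi>1 (y $ j)\<bar> * \<bar>\<phi>2 (y $ k) * G (s, \<Phi> y) $ i\<bar> \<le> C ^ CARD('n) * (C * b)"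
    using P Cn by (intro mult_mono) auto
  then have 1: "\<bar>(if k = i then 0 else \<phi>2 (y $ k) * (\<Prod>j\<in>UNIV - {i} - {k}. \<phi>1 (y $ j))) * G (s, \<Phi> y) $ i\<bar> \<le> C ^ CARD('n) * (C * b)"
    using Cn C assms(2) by (auto simp: abs_mult mult_ac)
  have "\<bar>\<phi>1 (y $ k) * J (s, \<Phi> y) i k\<bar> \<le> C * b"
    unfolding abs_mult using C cm(12) b[OF s \<Phi>_closure] by (intro mult_mono) auto
  then have 2: "\<bar>(\<Prod>j\<in>UNIV - {i}. \<phi>1 (y $ j)) * (\<phi>1 (y $ k) * J (s, \<Phi> y) i k)\<bar> \<le> C ^ CARD('n) * (C * b)"
    unfolding abs_mult[of "prod _ _"] using P Cn by (intro mult_mono) auto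
  show ?thesis unfolding E_def using 1 2 by linarith
qed

lemma \<Phi>_core: "(\<And>i. 2 * e \<le> y $ i \<and> y $ i \<le> l - 2 * e) \<Longrightarrow> \<Phi> y = y"
  by (simp add: \<Phi>_def cm vec_eq_iff)

lemma E_core: "(\<And>i. 2 * e \<le> y $ i \<and> y $ i \<le> l - 2 * e) \<Longrightarrow> E s y i k = J (s, y) i k"
  by (simp add: E_def cm \<Phi>_core)

lemma \<omega>_core: "s \<ge> 0 \<Longrightarrow> (\<And>i. 2 * e \<le> y $ i \<and> y $ i \<le> l - 2 * e) \<Longrightarrow> \<omega> s y = u s y"
  using uG[of s y] \<Phi>_closure[of y] by (simp add: \<omega>_def cm \<Phi>_core vec_eq_iff)

lemma \<omega>_zero: "s \<ge> 0 \<Longrightarrow> y $ i \<le> e \<or> y $ i \<ge> l - e \<Longrightarrow> \<omega> s y = 0"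
  using G_frontier[OF _ \<Phi>_closure, of s y i] cm(10)[of "y $ i"] cm(11)[of "y $ i"]
  by (auto simp: \<omega>_def vec_eq_iff \<Phi>_def)

text \<open>Reaches beyond the cube on purpose: for x in the cube and a < 1, the point x / a may
  have coordinates larger than l.\<close>

lemma jacobian_\<omega>_zero:
  assumes "s \<ge> 0" "y $ i > l - e"
  shows "jacobian (\<omega> s) (at y) = 0"
proof -
  have "open {y::real^'n. y $ i > l - e}" by (intro open_Collect_less continuous_intros)
  then have "jacobian (\<omega> s) (at y) = jacobian (\<lambda>y. 0) (at y)"
    using assms \<omega>_zero[OF assms(1)] \<omega>_differentiable[OF assms(1)]
    by (intro jacobian_cong_open[of "{y. y $ i > l - e}"]) (auto intro: less_imp_le)
  also have "\<dots> = 0" by (simp add: jacobian_def matrix_def vec_eq_iff)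
  finally show ?thesis .
qed

lemma Ck_on_\<Phi>: "open S \<Longrightarrow> Ck_on k S f \<Longrightarrow> Ck_on k S (\<lambda>x. \<Phi> (f x))"
  unfolding \<Phi>_def by (intro Ck_on_vec Ck_on_compose_UNIV[OF _ _ cm(1)] Ck_on_component)

text \<open>Stated for general f and g so that the stopped time and the dilated position can be
  inserted.\<close>

lemma Ck_on_\<omega>:
  fixes f :: "'a::real_normed_vector \<Rightarrow> real" and g :: "'a \<Rightarrow> real^'n"
  assumes S: "open S" and f: "Ck_on k S f" and g: "Ck_on k S g" and sub: "\<And>x. x \<in> S \<Longrightarrow> (f x, \<Phi> (g x)) \<in> W"
  shows "Ck_on k S (\<lambda>x. \<omega> (f x) (g x))"
proof -
  have "Ck_on k S (\<lambda>x. (f x, \<Phi> (g x)))"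
  proof -
    have "(\<lambda>x. (f x, \<Phi> (g x))) = (\<lambda>x. (f x, 0) + (0, \<Phi> (g x)))" by auto
    moreover have "Ck_on k S (\<lambda>x. (f x, 0 :: real^'n))"
      by (rule Ck_on_bounded_linear[OF S _ f]) (intro bounded_linear_Pair bounded_linear_ident bounded_linear_zero)
    moreover have "Ck_on k S (\<lambda>x. (0 :: real, \<Phi> (g x)))"
      by (rule Ck_on_bounded_linear[OF S _ Ck_on_\<Phi>[OF S g]]) (intro bounded_linear_Pair bounded_linear_ident bounded_linear_zero)
    ultimately show ?thesis by (simp only: Ck_on_add[OF S])
  qed
  then have "Ck_on k S (\<lambda>x. G (f x, \<Phi> (g x)))"
    by (intro Ck_on_compose[OF S oW _ _ smG]) (use sub in auto)
  then show ?thesis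
    unfolding \<omega>_def
    by (intro Ck_on_vec Ck_on_mult Ck_on_prod Ck_on_compose_UNIV[OF _ _ cm(2)] Ck_on_component S g)
qed

lemma core_outside:
  assumes "y \<in> cube l" "y \<notin> cube l - cbox (\<chi> i. 2 * e) (\<chi> i. l - 2 * e)"
  shows "2 * e \<le> y $ i \<and> y $ i \<le> l - 2 * e"
  using assms by (simp add: mem_box_cart)

text \<open>In the core the Jacobian of \<open>\<omega> s\<close> is that of the velocity, in the
  layer its norm is at most b'. The layer is so thin that it adds at most 1 to the integral of the
  p-th power. The substitution y = x / a contributes a^n, hence a^(n/p) after the root.\<close>

lemma grad_\<omega>_integral:
  fixes p a b :: real
  defines "b' \<equiv> real CARD('n) * (real CARD('n) * (2 * (C ^ CARD('n) * (C * b))))"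
  assumes b: "\<And>s x i k. 0 \<le> s \<Longrightarrow> s \<le> T \<Longrightarrow> x \<in> closure (cube l) \<Longrightarrow> \<bar>J (s, x) i k\<bar> \<le> b"
    and b0: "b \<ge> 0" and s: "0 \<le> s" "s \<le> T" and p: "p \<ge> 1"
    and small: "b' powr p * measure lborel (cube l - cbox (\<chi> i. 2 * e) ((\<chi> i. l - 2 * e)::real^'n)) \<le> 1"
    and a: "0 < a" "a < 1"
  shows "Lp_norm p (cube l) (\<lambda>x. jacobian (\<omega> s) (at ((1 / a) *\<^sub>R x))) \<le> a powr (real CARD('n) / p) * (2 * (grad_Lp l p (u s) + 1))"
proof -
  let ?n = "CARD('n)"
  define Y where "Y = cube l - cbox (\<chi> i. 2 * e) ((\<chi> i. l - 2 * e)::real^'n)"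
  define q where "q y = norm (jacobian (\<omega> s) (at y)) powr p" for y
  have q0: "0 \<le> q y" for y by (simp add: q_def)
  have "Ck_on (Suc 0) UNIV (\<omega> s)"
    using Ck_on_\<omega>[OF open_UNIV Ck_on_const[OF open_UNIV] Ck_on_ident[OF open_UNIV], of s "Suc 0"] \<Phi>W[OF s(1)] by simp
  then have "continuous_on UNIV (\<lambda>y. norm (jacobian (\<omega> s) (at y)))"
    by (intro continuous_intros Ck_1_jacobian)
  then have cq: "continuous_on UNIV q"
    unfolding q_def[abs_def] using p by (intro continuous_on_powr' continuous_on_const) auto
  have [measurable]: "q \<in> borel_measurable borel" by (rule borel_measurable_continuous_onI[OF cq])
  have iq: "set_integrable lborel (cube l) q" by (rule set_integrable_cube_continuous[OF l cq])
  \<comment> \<open>The dilated cube is larger than the cube; in the difference q vanishes, so the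
    integral reduces to the original cube.\<close>
  have qzero: "q y = 0" if y: "a *\<^sub>R y \<in> cube l" "y \<notin> cube l" for y
  proof -
    have "0 < y $ i" for i using y(1) a by (auto simp: cube_def zero_less_mult_iff)
    then obtain i where "y $ i \<ge> l" using y(2) by (auto simp: cube_def not_less)
    then have "jacobian (\<omega> s) (at y) = 0" using e by (intro jacobian_\<omega>_zero[OF s(1), of _ i]) auto
    then show ?thesis using p by (simp add: q_def)
  qed
  have cs: "y \<in> cube l \<Longrightarrow> a *\<^sub>R y \<in> cube l" for y :: "real^'n"
    using cube_scale_iff[OF a(1), of y l] cube_mono[of "a * l" l] a l by auto
  have "(LINT x:cube l|lborel. norm (jacobian (\<omega> s) (at ((1 / a) *\<^sub>R x))) powr p)
    = (\<integral>x. indicator (cube l) x * q ((1 / a) *\<^sub>R x) \<partial>lborel)"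
    by (simp add: set_lebesgue_integral_def q_def)
  also have "\<dots> = a ^ ?n * (\<integral>x. indicator (cube l) (0 + a *\<^sub>R x) * q ((1 / a) *\<^sub>R (0 + a *\<^sub>R x)) \<partial>lborel)"
    by (rule integral_scale) (use a in auto)
  also have "(\<integral>x. indicator (cube l) (0 + a *\<^sub>R x) * q ((1 / a) *\<^sub>R (0 + a *\<^sub>R x)) \<partial>lborel) = (LINT x:cube l|lborel. q x)"
    unfolding set_lebesgue_integral_def
    by (rule Bochner_Integration.integral_cong) (use a qzero cs in \<open>auto simp: indicator_def\<close>)
  finally have eq: "(LINT x:cube l|lborel. norm (jacobian (\<omega> s) (at ((1 / a) *\<^sub>R x))) powr p) = a ^ ?n * (LINT x:cube l|lborel. q x)" .
  define I where "I = (LINT x:cube l|lborel. norm (jacobian (u s) (at x)) powr p)"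
  have I0: "I \<ge> 0" unfolding I_def set_lebesgue_integral_def by (intro Bochner_Integration.integral_nonneg) auto
  define r where "r x = norm ((\<chi> i k. J (s, x) i k) :: real^'n^'n) powr p" for x
  have ssub: "(\<lambda>x. (s, x)) ` closure (cube l) \<subseteq> W" using memW[OF s(1)] by auto
  have "continuous_on (closure (cube l)) r"
    unfolding r_def[abs_def]
    by (intro continuous_on_powr' continuous_on_norm continuous_on_vec_lambda continuous_on_const
        continuous_on_compose2[OF cont_J _ ssub] continuous_on_Pair continuous_on_id) (use p in auto)
  then have "set_integrable lborel (closure (cube l)) r"
    unfolding set_integrable_def by (intro borel_integrable_compact) (simp_all add: closure_cube[OF l])
  then have ir: "set_integrable lborel (cube l) r"
    by (rule set_integrable_subset) (auto intro: cube_closureI)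
  have Ir: "(LINT x:cube l|lborel. r x) = I"
    unfolding I_def by (rule set_lebesgue_integral_cong) (auto simp: r_def jacobian_u[OF s(1)])
  have Ym: "Y \<in> sets borel" unfolding Y_def by simp
  have Yfin: "emeasure lborel Y < \<infinity>"
    by (rule le_less_trans[OF emeasure_mono[of _ "cube l"]]) (use l in \<open>auto simp: Y_def emeasure_cube\<close>)
  have Yeq: "(\<lambda>x. indicator (cube l) x *\<^sub>R indicator Y x) = (indicator Y :: real^'n \<Rightarrow> real)"
    by (auto simp: indicator_def Y_def)
  have iY: "set_integrable lborel (cube l) (\<lambda>x. indicator Y x :: real)"
    unfolding set_integrable_def Yeq using Ym Yfin by (simp add: integrable_indicator_iff)
  have YI: "(LINT x:cube l|lborel. (indicator Y x :: real)) = measure lborel Y"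
    unfolding set_lebesgue_integral_def Yeq using Ym by simp
  have "(LINT x:cube l|lborel. q x) \<le> (LINT x:cube l|lborel. r x + b' powr p * indicator Y x)"
  proof (rule set_integral_mono[OF iq])
    show "set_integrable lborel (cube l) (\<lambda>x. r x + b' powr p * indicator Y x)"
      by (intro set_integral_add(1) set_integrable_mult_right ir iY)
  next
    fix y :: "real^'n" assume y: "y \<in> cube l"
    show "q y \<le> r y + b' powr p * indicator Y y"
    proof (cases "y \<in> Y")
      case False
      then have "E s y i k = J (s, y) i k" for i k
        using core_outside[OF y] unfolding Y_def by (intro E_core) blast
      then show ?thesis using False by (simp add: q_def r_def jacobian_\<omega>[OF s(1)])
    next
      case True
      have "norm (jacobian (\<omega> s) (at y)) \<le> b'"
        unfolding b'_def jacobian_\<omega>[OF s(1)] by (rule norm_matrix_le) (simp add: E_bound[OF b b0 s])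
      then have "q y \<le> b' powr p" unfolding q_def using p by (intro powr_mono2) auto
      then show ?thesis using True by (simp add: r_def add_increasing)
    qed
  qed
  also have "\<dots> = I + b' powr p * measure lborel Y"
    using ir iY by (simp add: set_integral_add(2) Ir YI)
  also have "\<dots> \<le> I + 1" using small by (simp add: Y_def)
  finally have qI: "(LINT x:cube l|lborel. q x) \<le> I + 1" .
  have q00: "0 \<le> (LINT x:cube l|lborel. q x)"
    unfolding set_lebesgue_integral_def using q0 by (intro Bochner_Integration.integral_nonneg) auto
  have "Lp_norm p (cube l) (\<lambda>x. jacobian (\<omega> s) (at ((1 / a) *\<^sub>R x))) = (a ^ ?n * (LINT x:cube l|lborel. q x)) powr (1 / p)"
    unfolding Lp_norm_def eq ..
  also have "\<dots> \<le> (a ^ ?n * (I + 1)) powr (1 / p)"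
    using qI q00 a p by (intro powr_mono2 mult_left_mono) auto
  also have "\<dots> = (a ^ ?n) powr (1 / p) * (I + 1) powr (1 / p)"
    by (rule powr_mult)
  also have "(a ^ ?n) powr (1 / p) = a powr (real ?n / p)"
    using a by (simp add: powr_powr flip: powr_realpow)
  also have "a powr (real ?n / p) * (I + 1) powr (1 / p) \<le> a powr (real ?n / p) * (2 * (I powr (1 / p) + 1))"
    by (intro mult_left_mono powr_p_le_add I0 p) auto
  also have "I powr (1 / p) = grad_Lp l p (u s)"
    by (simp add: I_def grad_Lp_def Lp_norm_def)
  finally show ?thesis .
qed

end

section \<open>Rescaled solutions\<close>

text \<open>Equals t up to T and T + 2 from T + 1 on. A smooth change of the time variable respects
  the transport equation, so what counts is the agreement with t up to T and the range, which stays
  below T + 2 and is positive at positive times if T >= 0.\<close>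

definition time_stop :: "real \<Rightarrow> real \<Rightarrow> real" where
  "time_stop T t = t + (T + 2 - t) * smooth_step (t - T)"

lemma Ck_on_time_stop: "Ck_on k UNIV (time_stop T)"
  unfolding time_stop_def[abs_def]
  by (intro Ck_on_intros Ck_on_compose_UNIV[OF _ _ Ck_on_smooth_step] open_UNIV)

lemma time_stop_eq: "t \<le> T \<Longrightarrow> time_stop T t = t"
  by (simp add: time_stop_def smooth_step_0)

lemma time_stop_between: "min t (T + 2) \<le> time_stop T t" "time_stop T t \<le> T + 2"
proof -
  show "min t (T + 2) \<le> time_stop T t"
  proof (cases "t \<le> T + 2")
    case True
    then show ?thesis using smooth_step_range(1)[of "t - T"] by (simp add: time_stop_def min_def)
  next
    case False
    then show ?thesis by (simp add: time_stop_def smooth_step_1)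
  qed
  show "time_stop T t \<le> T + 2"
  proof (cases "t \<le> T + 2")
    case True
    then have "(T + 2 - t) * smooth_step (t - T) \<le> (T + 2 - t) * 1"
      using smooth_step_range by (intro mult_left_mono) auto
    then show ?thesis by (simp add: time_stop_def)
  next
    case False
    then show ?thesis by (simp add: time_stop_def smooth_step_1)
  qed
qed

text \<open>At the end point t = T the value follows from continuity of the derivative.\<close>

lemma deriv_time_stop: "t \<le> T \<Longrightarrow> deriv (time_stop T) t = 1"
proof -
  assume t: "t \<le> T"
  have 1: "deriv (time_stop T) s = 1" if "s < T" for s
    using deriv_on_open[of "{..<T}" s "time_stop T" "\<lambda>s. s"] that time_stop_eq by auto
  have "continuous_on UNIV (deriv (time_stop T))"
    using smooth_deriv(2)[OF Ck_on_time_stop, of 0 T] by simp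
  from continuous_eq_extend(1)[OF this, of T 1] 1 t show ?thesis by (cases "t = T") auto
qed

lemma continuous_on_local:
  assumes "\<And>x. x \<in> S \<Longrightarrow> \<exists>U. open U \<and> x \<in> U \<and> continuous_on (S \<inter> U) f"
  shows "continuous_on S f"
  unfolding continuous_on_def
proof
  fix x assume x: "x \<in> S"
  obtain U where U: "open U" "x \<in> U" "continuous_on (S \<inter> U) f" using assms[OF x] by blast
  have "at x within S = at x within (S \<inter> U)" by (rule at_within_nhd[OF U(2,1)]) auto
  then show "(f \<longlongrightarrow> f x) (at x within S)"
    using U(2,3) x by (simp add: continuous_on_def)
qed

lemma jacobian_dilation:
  fixes f :: "real^'n \<Rightarrow> real^'m"
  assumes "f differentiable (at (c *\<^sub>R x))"
  shows "jacobian (\<lambda>x. b *\<^sub>R f (c *\<^sub>R x)) (at x) = (b * c) *\<^sub>R jacobian f (at (c *\<^sub>R x))"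
proof -
  obtain D where D: "(f has_derivative D) (at (c *\<^sub>R x))" using assms by (auto simp: differentiable_def)
  have "((\<lambda>x. c *\<^sub>R x) has_derivative (\<lambda>w. c *\<^sub>R w)) (at x)" by (auto intro!: derivative_eq_intros)
  from has_derivative_scaleR_right[OF has_derivative_compose[OF this D]]
  have "((\<lambda>x. b *\<^sub>R f (c *\<^sub>R x)) has_derivative (\<lambda>w. b *\<^sub>R D (c *\<^sub>R w))) (at x)" .
  moreover have "D (c *\<^sub>R w) = c *\<^sub>R D w" for w
    using D has_derivative_linear linear_scale by blast
  ultimately show ?thesis by (simp add: has_derivative_jacobianI[OF D] has_derivative_jacobianI vec_eq_iff)
qed

lemma rescale_eq:
  fixes f :: "real^'n \<Rightarrow> real"
  assumes "a > 0" "\<And>x. f x \<noteq> 0 \<Longrightarrow> x \<in> cube l"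
  shows "rescale l a f = (\<lambda>x. f ((1 / a) *\<^sub>R x))"
proof
  fix x :: "real^'n"
  have "(1 / a) *\<^sub>R x \<in> cube l \<Longrightarrow> x \<in> cube (a * l)"
    using cube_scale_iff[OF assms(1), of "(1 / a) *\<^sub>R x" l] assms(1) by simp
  then show "rescale l a f x = f ((1 / a) *\<^sub>R x)" using assms(2)[of "(1 / a) *\<^sub>R x"] by (auto simp: rescale_def)
qed

lemma mean_zero_data_rescale:
  fixes f :: "real^'n \<Rightarrow> real"
  assumes f: "f \<in> mean_zero_data l" and a: "0 < a" "a < 1" and l: "l > 0"
  shows "rescale l a f \<in> mean_zero_data l"
proof -
  have sm: "Ck_on k UNIV f" for k using f by (simp add: mean_zero_data_def smooth_on_UNIV)
  have K: "compact (closure {x. f x \<noteq> 0})" "closure {x. f x \<noteq> 0} \<subseteq> cube l"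
    and I: "(LINT x:cube l|lborel. f x) = 0" using f by (auto simp: mean_zero_data_def)
  have r: "rescale l a f = (\<lambda>x. f ((1 / a) *\<^sub>R x))"
  proof (rule rescale_eq[OF a(1)])
    fix x assume "f x \<noteq> 0"
    then have "x \<in> closure {x. f x \<noteq> 0}" by (intro subsetD[OF closure_subset]) simp
    then show "x \<in> cube l" by (rule subsetD[OF K(2)])
  qed
  have "Ck_on k UNIV (rescale l a f)" for k
    unfolding r by (intro Ck_on_compose_UNIV[OF _ _ sm] Ck_on_scaleR_const Ck_on_ident open_UNIV)
  moreover have supp: "closure {x. rescale l a f x \<noteq> 0} = (\<lambda>x. a *\<^sub>R x) ` closure {x. f x \<noteq> 0}"
  proof -
    have "{x. rescale l a f x \<noteq> 0} = (\<lambda>x. a *\<^sub>R x) ` {x. f x \<noteq> 0}"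
    proof
      show "{x. rescale l a f x \<noteq> 0} \<subseteq> (\<lambda>x. a *\<^sub>R x) ` {x. f x \<noteq> 0}"
      proof
        fix x assume "x \<in> {x. rescale l a f x \<noteq> 0}"
        then show "x \<in> (\<lambda>x. a *\<^sub>R x) ` {x. f x \<noteq> 0}"
          using a by (intro image_eqI[of _ _ "(1 / a) *\<^sub>R x"]) (auto simp: r)
      qed
    qed (use a in \<open>auto simp: r\<close>)
    then show ?thesis by (simp add: closure_scaleR)
  qed
  moreover have "compact ((\<lambda>x. a *\<^sub>R x) ` closure {x. f x \<noteq> 0})" using K(1) by (rule compact_scaling)
  moreover have "(\<lambda>x. a *\<^sub>R x) ` closure {x. f x \<noteq> 0} \<subseteq> cube l"
  proof -
    have "(\<lambda>x. a *\<^sub>R x) ` closure {x. f x \<noteq> 0} \<subseteq> cube (a * l)"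
      using K(2) cube_scale_iff[OF a(1), of _ l] by auto
    also have "\<dots> \<subseteq> cube l" using a l by (intro cube_mono) simp
    finally show ?thesis .
  qed
  moreover have "(LINT x:cube l|lborel. rescale l a f x) = 0"
  proof -
    have "continuous_on (cube l) f" using sm[of 0] by (auto intro: continuous_on_subset[of UNIV])
    from integral_rescale_mult[OF l a this continuous_on_const[of UNIV 1]] I show ?thesis by simp
  qed
  ultimately show ?thesis by (simp add: mean_zero_data_def smooth_on_UNIV del: compact_closure)
qed

lemma mean_zero_data_core:
  fixes f :: "real^'n \<Rightarrow> real"
  assumes "f \<in> mean_zero_data l"
  obtains d where "d > 0" "\<And>x i. f x \<noteq> 0 \<Longrightarrow> d \<le> x $ i \<and> d \<le> l - x $ i"
proof -
  have K: "compact (closure {x. f x \<noteq> 0})" "closure {x. f x \<noteq> 0} \<subseteq> cube l"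
    using assms by (auto simp: mean_zero_data_def)
  have "closed (- cube l :: (real^'n) set)" by (simp add: open_cube closed_Compl)
  from separate_compact_closed[OF K(1) this] K(2) obtain d where d: "d > 0"
    "\<And>x y. x \<in> closure {x. f x \<noteq> 0} \<Longrightarrow> y \<in> - cube l \<Longrightarrow> d \<le> dist x y" by blast
  have "d \<le> x $ i \<and> d \<le> l - x $ i" if "f x \<noteq> 0" for x i
  proof -
    have x: "x \<in> closure {x. f x \<noteq> 0}" using that by (intro subsetD[OF closure_subset]) simp
    then have xc: "0 < x $ i" "x $ i < l" using K(2) by (auto simp: cube_def)
    \<comment> \<open>The two projections of x along direction i to opposite faces lie outside the
      open cube, so d bounds both x $ i and l - x $ i from below.\<close>
    have "(x - (x $ i) *\<^sub>R axis i 1) $ i = 0" "(x + (l - x $ i) *\<^sub>R axis i 1) $ i = l" by simp_all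
    then have "x - (x $ i) *\<^sub>R axis i 1 \<in> - cube l" "x + (l - x $ i) *\<^sub>R axis i 1 \<in> - cube l"
      unfolding cube_def by (metis (mono_tags, lifting) ComplI less_irrefl mem_Collect_eq)+
    from d(2)[OF x this(1)] d(2)[OF x this(2)] xc show ?thesis by (simp add: dist_norm)
  qed
  then show ?thesis using that d(1) by blast
qed

section \<open>Support and supremum of solutions\<close>

context smooth_velocity
begin

text \<open>Applies the maximum principle to \<open>\<theta>\<close> and to its negative; a single
  exponential factor then serves all of [0, T].\<close>

lemma transport_solution_max:
  assumes sol: "transport_solution l u \<theta>0 \<theta>" and x: "x \<in> cube l" and s: "0 \<le> s" "s \<le> T"
    and L: "L \<ge> 0" "\<And>s x i. 0 \<le> s \<Longrightarrow> s \<le> T \<Longrightarrow> x \<in> cube l \<Longrightarrow> \<bar>u s x $ i\<bar> \<le> L * min (x $ i) (l - x $ i)"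
  shows "\<exists>y\<in>cube l. (\<forall>i. y $ i \<le> x $ i * exp (2 * L * T) \<and> l - y $ i \<le> (l - x $ i) * exp (2 * L * T)) \<and> \<bar>\<theta> s x\<bar> \<le> \<bar>\<theta>0 y\<bar>"
proof -
  have m: "r * exp (2 * L * s) \<le> r * exp (2 * L * T)" if "r \<ge> 0" for r
    using that s L(1) by (intro mult_left_mono) (auto intro: mult_left_mono)
  have xx: "0 \<le> x $ i" "0 \<le> l - x $ i" for i using x by (auto simp: cube_def less_imp_le)
  have Ls: "\<And>r x i. 0 \<le> r \<Longrightarrow> r \<le> s \<Longrightarrow> x \<in> cube l \<Longrightarrow> \<bar>u r x $ i\<bar> \<le> L * min (x $ i) (l - x $ i)"
    using L(2) s by simp
  obtain y1 where y1: "y1 \<in> cube l" "\<And>i. y1 $ i \<le> x $ i * exp (2 * L * s) \<and> l - y1 $ i \<le> (l - x $ i) * exp (2 * L * s)"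
    "\<theta> s x \<le> \<theta>0 y1"
    using transport_max_principle[OF sol L(1) s(1) Ls x] by blast
  obtain y2 where y2: "y2 \<in> cube l" "\<And>i. y2 $ i \<le> x $ i * exp (2 * L * s) \<and> l - y2 $ i \<le> (l - x $ i) * exp (2 * L * s)"
    "- \<theta> s x \<le> - \<theta>0 y2"
    using transport_max_principle[OF transport_solution_minus[OF sol] L(1) s(1) Ls x] by blast
  have "\<bar>\<theta> s x\<bar> \<le> \<bar>\<theta>0 y1\<bar> \<or> \<bar>\<theta> s x\<bar> \<le> \<bar>\<theta>0 y2\<bar>" using y1(3) y2(3) by linarith
  then show ?thesis
  proof
    assume "\<bar>\<theta> s x\<bar> \<le> \<bar>\<theta>0 y1\<bar>"
    then show ?thesis using y1(1,2) m[OF xx(1)] m[OF xx(2)] by (meson order_trans)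
  next
    assume "\<bar>\<theta> s x\<bar> \<le> \<bar>\<theta>0 y2\<bar>"
    then show ?thesis using y2(1,2) m[OF xx(1)] m[OF xx(2)] by (meson order_trans)
  qed
qed

text \<open>The maximum principle supplies a point y with |\<open>\<theta> s x\<close>| <=
  |\<open>\<theta>0 y\<close>| whose distances to the faces are at most exp(2 L T) times those of x.
  If x is closer than \<open>\<eta>\<close> = d exp(-2 L T) to a face, then y is closer than d to
  it, where the datum vanishes.\<close>

lemma transport_solution_support:
  assumes sol: "transport_solution l u \<theta>0 \<theta>" and \<theta>0: "\<theta>0 \<in> mean_zero_data l" and T: "T \<ge> 0"
  obtains \<eta> where "\<eta> > 0"
    "\<And>s x i. 0 \<le> s \<Longrightarrow> s \<le> T \<Longrightarrow> x \<in> cube l \<Longrightarrow> x $ i < \<eta> \<or> x $ i > l - \<eta> \<Longrightarrow> \<theta> s x = 0"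
proof -
  obtain L where L: "L \<ge> 0" "\<And>s x i. 0 \<le> s \<Longrightarrow> s \<le> T \<Longrightarrow> x \<in> cube l \<Longrightarrow> \<bar>u s x $ i\<bar> \<le> L * min (x $ i) (l - x $ i)"
    using u_boundary_bound[OF T] by metis
  obtain d where d: "d > 0" "\<And>x i. \<theta>0 x \<noteq> 0 \<Longrightarrow> d \<le> x $ i \<and> d \<le> l - x $ i"
    using mean_zero_data_core[OF \<theta>0] by metis
  define \<eta> where "\<eta> = d / exp (2 * L * T)"
  have "\<theta> s x = 0" if s: "0 \<le> s" "s \<le> T" and x: "x \<in> cube l" "x $ i < \<eta> \<or> x $ i > l - \<eta>" for s x i
  proof -
    obtain y where y: "\<And>i. y $ i \<le> x $ i * exp (2 * L * T) \<and> l - y $ i \<le> (l - x $ i) * exp (2 * L * T)"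
      "\<bar>\<theta> s x\<bar> \<le> \<bar>\<theta>0 y\<bar>"
      using transport_solution_max[OF sol x(1) s L] by blast
    have "x $ i * exp (2 * L * T) < d \<or> (l - x $ i) * exp (2 * L * T) < d"
      using x(2) by (auto simp: \<eta>_def field_simps)
    then have "y $ i < d \<or> l - y $ i < d" using y(1)[of i] by linarith
    then have "\<theta>0 y = 0" using d(2)[of y i] by linarith
    then show ?thesis using y(2) by simp
  qed
  moreover have "\<eta> > 0" using d(1) by (simp add: \<eta>_def)
  ultimately show ?thesis using that by blast
qed

lemma transport_solution_bounded:
  assumes sol: "transport_solution l u \<theta>0 \<theta>" and \<theta>0: "\<And>x. \<bar>\<theta>0 x\<bar> \<le> M" and s: "0 \<le> s" and x: "x \<in> cube l"
  shows "\<bar>\<theta> s x\<bar> \<le> M"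
proof -
  obtain L where L: "L \<ge> 0" "\<And>r x i. 0 \<le> r \<Longrightarrow> r \<le> s \<Longrightarrow> x \<in> cube l \<Longrightarrow> \<bar>u r x $ i\<bar> \<le> L * min (x $ i) (l - x $ i)"
    using u_boundary_bound[OF s] by metis
  obtain y where "\<bar>\<theta> s x\<bar> \<le> \<bar>\<theta>0 y\<bar>"
    using transport_solution_max[OF sol x s order_refl L] by blast
  then show ?thesis using \<theta>0[of y] by linarith
qed

end

section \<open>The rescaled velocity field and its explicit solution\<close>

context cut_velocity
begin

text \<open>The factor a matches the dilation of space and cancels the 1/a that differentiation in x
  produces; \<open>deriv (time_stop T) t\<close> is the speed of the new clock.\<close>

definition v :: "real \<Rightarrow> real \<Rightarrow> real \<Rightarrow> real^'n \<Rightarrow> real^'n" where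
  "v T a t x = (deriv (time_stop T) t * a) *\<^sub>R \<omega> (time_stop T t) ((1 / a) *\<^sub>R x)"

lemma time_stop_nonneg: "0 \<le> T \<Longrightarrow> 0 \<le> t \<Longrightarrow> 0 \<le> time_stop T t"
  using time_stop_between(1)[of t T] by linarith

lemma jacobian_v:
  assumes "0 \<le> T" "0 \<le> t" "a > 0"
  shows "jacobian (v T a t) (at x) = deriv (time_stop T) t *\<^sub>R jacobian (\<omega> (time_stop T t)) (at ((1 / a) *\<^sub>R x))"
  unfolding v_def[abs_def]
  using jacobian_dilation[OF \<omega>_differentiable[OF time_stop_nonneg[OF assms(1,2)]], of "deriv (time_stop T) t * a" "1 / a" x] assms(3)
  by simp

lemma admissible_v:
  assumes T: "0 \<le> T" and a: "0 < a" "a < 1"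
  shows "admissible_velocity l (v T a)"
  unfolding admissible_velocity_def
proof (intro conjI allI impI ballI)
  let ?f = "\<lambda>z::real \<times> (real^'n). time_stop T (fst z)" and ?g = "\<lambda>z::real \<times> (real^'n). (1 / a) *\<^sub>R snd z"
  define W' where "W' = (\<lambda>z. (?f z, \<Phi> (?g z))) -` W"
  have smf: "Ck_on k UNIV ?f" for k
    by (intro Ck_on_compose_UNIV[OF _ _ Ck_on_time_stop] Ck_on_linear open_UNIV bounded_linear_fst)
  have smg: "Ck_on k UNIV ?g" for k
    by (intro Ck_on_scaleR_const Ck_on_linear open_UNIV bounded_linear_snd)
  have "continuous_on UNIV (\<lambda>z. (?f z, \<Phi> (?g z)))"
    using smf[of 0] Ck_on_\<Phi>[OF open_UNIV smg, of 0] by (intro continuous_on_Pair) auto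
  then have oW': "open W'" unfolding W'_def by (rule open_vimage[OF oW])
  have "Ck_on k W' (\<lambda>z. v T a (fst z) (snd z))" for k
    unfolding v_def
  proof (intro Ck_on_scaleR Ck_on_mult Ck_on_const oW')
    show "Ck_on k W' (\<lambda>z. deriv (time_stop T) (fst z))"
      by (intro Ck_on_compose_UNIV[OF _ _ smooth_deriv(2)[OF Ck_on_time_stop]] Ck_on_linear oW' bounded_linear_fst)
    show "Ck_on k W' (\<lambda>z. \<omega> (?f z) (?g z))"
      by (rule Ck_on_\<omega>[OF oW' Ck_on_subset[OF smf] Ck_on_subset[OF smg]]) (auto simp: W'_def)
  qed
  moreover have "{0..} \<times> closure (cube l) \<subseteq> W'"
    using \<Phi>W time_stop_nonneg[OF T] by (auto simp: W'_def)
  ultimately show "smooth_on ({0..} \<times> closure (cube l)) (\<lambda>(t, x). v T a t x)"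
    unfolding smooth_on_def using oW'
    by (intro exI[of _ W'] exI[of _ "\<lambda>z. v T a (fst z) (snd z)"]) auto
next
  fix t :: real and x :: "real^'n" assume "0 \<le> t" "x \<in> cube l"
  then show "divergence (v T a t) x = 0"
    using trace_E[OF time_stop_nonneg[OF T, of t], of "(1 / a) *\<^sub>R x"] time_stop_nonneg[OF T, of t]
    by (simp add: divergence_def jacobian_v[OF T _ a(1)] jacobian_\<omega> trace_def flip: sum_distrib_left)
next
  fix t :: real and x :: "real^'n" assume t: "0 \<le> t" and x: "x \<in> frontier (cube l)"
  have "x \<in> closure (cube l)" "x \<notin> cube l"
    using x by (auto simp: frontier_def interior_open[OF open_cube])
  then obtain i where "x $ i \<le> 0 \<or> x $ i \<ge> l" by (auto simp: cube_def not_less)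
  \<comment> \<open>A boundary point has a coordinate that is at most 0 or at least l. Dividing by a
    < 1 moves it no closer to the core, so \<open>\<omega>\<close> vanishes there.\<close>
  moreover have "l \<le> (1 / a) * l" using a l by (simp add: field_simps)
  moreover have "x $ i \<ge> l \<Longrightarrow> (1 / a) * l \<le> (1 / a) * x $ i" using a by (intro mult_left_mono) auto
  ultimately have "((1 / a) *\<^sub>R x) $ i \<le> e \<or> ((1 / a) *\<^sub>R x) $ i \<ge> l - e"
    using a e by (auto simp: divide_nonpos_pos intro: order_trans[of _ 0])
  then show "v T a t x = 0"
    using \<omega>_zero[OF time_stop_nonneg[OF T t]] by (simp add: v_def)
qed

text \<open>Two open sets cover space-time because 2 e < \<open>\<eta>\<close>. On A the dilated
  point is in the core, where \<open>\<omega>\<close> is the original velocity, and the chain rule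
  multiplies the whole equation by the speed of the clock. On N the dilated point is closer than
  \<open>\<eta>\<close> to a face or outside the cube, and the candidate is zero for t >= 0. The
  clock stops at T + 2, hence the time range of the support condition.\<close>

lemma v_solution:
  assumes T: "0 \<le> T" and a: "0 < a" "a < 1" and sol: "transport_solution l u \<theta>0 \<theta>"
    and \<eta>: "2 * e < \<eta>"
      "\<And>s x i. 0 \<le> s \<Longrightarrow> s \<le> T + 2 \<Longrightarrow> x \<in> cube l \<Longrightarrow> x $ i < \<eta> \<or> x $ i > l - \<eta> \<Longrightarrow> \<theta> s x = 0"
  shows "transport_solution l (v T a) (rescale l a \<theta>0) (\<lambda>t. rescale l a (\<theta> (time_stop T t)))"
proof -
  let ?\<tau> = "time_stop T"
  let ?g = "\<lambda>z::real \<times> (real^'n). (1 / a) *\<^sub>R snd z"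
  define \<Theta> where "\<Theta> t = rescale l a (\<theta> (?\<tau> t))" for t
  define A where "A = ?g -` box (\<chi> i. 2 * e) (\<chi> i. l - 2 * e)"
  define N where "N = - (?g -` cbox (\<chi> i. \<eta>) (\<chi> i. l - \<eta>))"
  have cont: "continuous_on ({0..} \<times> cube l) (\<lambda>(t, x). \<theta> t x)"
    using sol by (simp add: transport_solution_def)
  have oA: "open A" unfolding A_def by (intro open_vimage open_box continuous_intros)
  have oN: "open N" unfolding N_def by (intro open_Compl closed_vimage closed_cbox continuous_intros)
  have AN: "z \<in> A \<or> z \<in> N" for z
  proof (rule disjCI)
    assume "z \<notin> N"
    then have "\<eta> \<le> ?g z $ i \<and> ?g z $ i \<le> l - \<eta>" for i by (simp add: N_def mem_box_cart)
    then have "2 * e < ?g z $ i \<and> ?g z $ i < l - 2 * e" for i using \<eta>(1) by (smt (verit))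
    then show "z \<in> A" by (simp add: A_def mem_box_cart)
  qed
  have coreA: "2 * e < ?g z $ i \<and> ?g z $ i < l - 2 * e" if "z \<in> A" for z i
    using that unfolding A_def by (simp add: mem_box_cart)
  have cubeA: "?g z \<in> cube l" if "z \<in> A" for z
  proof -
    have "0 < ?g z $ i \<and> ?g z $ i < l" for i using coreA[OF that, of i] e by linarith
    then show ?thesis by (simp add: cube_def)
  qed
  have \<Theta>A: "\<Theta> t x = \<theta> (?\<tau> t) ((1 / a) *\<^sub>R x)" if "(t, x) \<in> A" for t x
    using cubeA[OF that] cube_scale_iff[OF a(1), of "(1 / a) *\<^sub>R x" l] a by (simp add: \<Theta>_def rescale_def)
  have \<Theta>N: "\<Theta> t x = 0" if tx: "(t, x) \<in> N" "t \<ge> 0" for t x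
  proof (cases "x \<in> cube (a * l)")
    case True
    then have "(1 / a) *\<^sub>R x \<in> cube l" using cube_scale_iff[OF a(1), of "(1 / a) *\<^sub>R x" l] a by simp
    moreover obtain i where "((1 / a) *\<^sub>R x) $ i < \<eta> \<or> ((1 / a) *\<^sub>R x) $ i > l - \<eta>"
      using tx(1) by (auto simp: N_def mem_box_cart not_le)
    ultimately show ?thesis
      using \<eta>(2)[OF time_stop_nonneg[OF T tx(2)] time_stop_between(2)] by (auto simp: \<Theta>_def rescale_def)
  qed (simp add: \<Theta>_def rescale_def)
  have \<tau>d: "(?\<tau> has_real_derivative deriv ?\<tau> t) (at t)" for t by (rule smooth_deriv(1)[OF Ck_on_time_stop])
  have c\<tau>: "continuous_on UNIV ?\<tau>" using Ck_on_time_stop[of 0 T] by simp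
  show ?thesis
    unfolding transport_solution_def \<Theta>_def[symmetric]
  proof (intro conjI allI impI ballI)
    show "continuous_on ({0..} \<times> cube l) (\<lambda>(t, x). \<Theta> t x)"
    proof (rule continuous_on_local)
      fix z :: "real \<times> (real^'n)" assume "z \<in> {0..} \<times> cube l"
      have 1: "continuous_on ({0..} \<times> cube l \<inter> A) (\<lambda>(t, x). \<Theta> t x)"
      proof -
        have "continuous_on ({0..} \<times> cube l \<inter> A) (\<lambda>z. (?\<tau> (fst z), ?g z))"
          by (intro continuous_on_Pair continuous_on_compose2[OF c\<tau> continuous_on_fst[OF continuous_on_id]]
              continuous_intros) auto
        then have "continuous_on ({0..} \<times> cube l \<inter> A) (\<lambda>z. (\<lambda>(t, x). \<theta> t x) (?\<tau> (fst z), ?g z))"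
          by (rule continuous_on_compose2[OF cont]) (use cubeA time_stop_nonneg[OF T] in auto)
        then show ?thesis
          by (rule continuous_on_eq) (auto simp: \<Theta>A)
      qed
      have 2: "continuous_on ({0..} \<times> cube l \<inter> N) (\<lambda>(t, x). \<Theta> t x)"
        by (rule continuous_on_eq[OF continuous_on_const[of _ 0]]) (auto simp: \<Theta>N)
      show "\<exists>U. open U \<and> z \<in> U \<and> continuous_on ({0..} \<times> cube l \<inter> U) (\<lambda>(t, x). \<Theta> t x)"
        using AN[of z] 1 2 oA oN by blast
    qed
  next
    fix x :: "real^'n" assume "x \<in> cube l"
    show "\<Theta> 0 x = rescale l a \<theta>0 x"
    proof (cases "x \<in> cube (a * l)")
      case True
      then have "(1 / a) *\<^sub>R x \<in> cube l" using cube_scale_iff[OF a(1), of "(1 / a) *\<^sub>R x" l] a by simp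
      then show ?thesis using sol T by (simp add: \<Theta>_def rescale_def time_stop_eq transport_solution_def)
    qed (simp add: \<Theta>_def rescale_def)
  next
    fix t :: real and x :: "real^'n" assume t: "t > 0" and x: "x \<in> cube l"
    have "\<exists>D. ((\<lambda>(s, y). \<Theta> s y) has_derivative D) (at (t, x)) \<and> D (1, 0) + D (0, v T a t x) = 0"
    proof (cases "(t, x) \<in> A")
      case True
      let ?y = "(1 / a) *\<^sub>R x"
      have yc: "?y \<in> cube l" using cubeA[OF True] by simp
      have \<tau>p: "?\<tau> t > 0" using time_stop_between(1)[of t T] t T by linarith
      obtain D where D: "((\<lambda>(s, y). \<theta> s y) has_derivative D) (at (?\<tau> t, ?y))"
        and eq: "deriv (\<lambda>s. \<theta> s ?y) (?\<tau> t) + u (?\<tau> t) ?y \<bullet> grad (\<theta> (?\<tau> t)) ?y = 0"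
        using sol \<tau>p yc unfolding transport_solution_def differentiable_def by blast
      interpret D: bounded_linear D using D by (rule has_derivative_bounded_linear)
      have eq': "D (1, 0) + D (0, u (?\<tau> t) ?y) = 0"
        using eq by (simp add: spacetime_derivs(2,4)[OF D])
      have "((\<lambda>z::real \<times> (real^'n). (?\<tau> (fst z), ?g z)) has_derivative (\<lambda>h. (deriv ?\<tau> t * fst h, ?g h))) (at (t, x))"
      proof (rule has_derivative_Pair)
        have "((\<lambda>z::real \<times> (real^'n). fst z) has_derivative fst) (at (t, x))" by (rule has_derivative_fst[OF has_derivative_ident])
        from has_derivative_compose[OF this, of ?\<tau> "(*) (deriv ?\<tau> t)"] \<tau>d[of t]
        show "((\<lambda>z::real \<times> (real^'n). ?\<tau> (fst z)) has_derivative (\<lambda>h. deriv ?\<tau> t * fst h)) (at (t, x))"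
          by (simp add: has_field_derivative_def)
        show "(?g has_derivative ?g) (at (t, x))"
          by (intro has_derivative_scaleR_right has_derivative_snd has_derivative_ident)
      qed
      from has_derivative_compose[OF this, of "\<lambda>(s, y). \<theta> s y" D] D
      have "((\<lambda>z. \<theta> (?\<tau> (fst z)) (?g z)) has_derivative (\<lambda>h. D (deriv ?\<tau> t * fst h, ?g h))) (at (t, x))"
        by simp
      then have D': "((\<lambda>(s, y). \<Theta> s y) has_derivative (\<lambda>h. D (deriv ?\<tau> t * fst h, ?g h))) (at (t, x))"
        by (rule has_derivative_transform_within_open[OF _ oA True]) (auto simp: \<Theta>A)
      have core: "2 * e \<le> ?y $ i \<and> ?y $ i \<le> l - 2 * e" for i
        using coreA[OF True, of i] by (simp add: less_imp_le)
      have "?g (0, v T a t x) = deriv ?\<tau> t *\<^sub>R u (?\<tau> t) ?y"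
        using a \<omega>_core[OF less_imp_le[OF \<tau>p] core] by (simp add: v_def)
      then have "D (0, ?g (0, v T a t x)) = deriv ?\<tau> t *\<^sub>R D (0, u (?\<tau> t) ?y)"
        using D.scaleR[of "deriv ?\<tau> t" "(0, u (?\<tau> t) ?y)"] by simp
      moreover have "D (deriv ?\<tau> t, 0) = deriv ?\<tau> t *\<^sub>R D (1, 0)"
        using D.scaleR[of "deriv ?\<tau> t" "(1, 0)"] by simp
      ultimately have "D (deriv ?\<tau> t, 0) + D (0, ?g (0, v T a t x)) = deriv ?\<tau> t * (D (1, 0) + D (0, u (?\<tau> t) ?y))"
        by (simp add: distrib_left)
      then show ?thesis using D' eq' by (intro exI[of _ "\<lambda>h. D (deriv ?\<tau> t * fst h, ?g h)"]) simp
    next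
      case False
      \<comment> \<open>\<open>\<Theta>N\<close> speaks about t >= 0; intersecting with positive
        times gives an open set on which the candidate is zero.\<close>
      then have N: "(t, x) \<in> N \<inter> {0<..} \<times> UNIV" using AN t by auto
      have oN': "open (N \<inter> {0<..} \<times> UNIV)" using oN by (intro open_Int open_Times) auto
      have "((\<lambda>(s, y). \<Theta> s y) has_derivative (\<lambda>h. 0)) (at (t, x))"
        by (rule has_derivative_transform_within_open[OF has_derivative_const[of 0] oN' N]) (auto simp: \<Theta>N)
      then show ?thesis by (intro exI[of _ "\<lambda>h. 0"]) simp
    qed
    then obtain D where D: "((\<lambda>(s, y). \<Theta> s y) has_derivative D) (at (t, x))" "D (1, 0) + D (0, v T a t x) = 0"
      by blast
    then show "(\<lambda>(s, y). \<Theta> s y) differentiable at (t, x)" by (auto simp: differentiable_def)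
    show "deriv (\<lambda>s. \<Theta> s x) t + v T a t x \<bullet> grad (\<Theta> t) x = 0"
      using D(2) by (simp add: spacetime_derivs(2,4)[OF D(1)])
  qed
qed

lemma grad_Lp_v:
  assumes "0 \<le> t" "t \<le> T" "0 < a"
  shows "grad_Lp l p (v T a t) = Lp_norm p (cube l) (\<lambda>x. jacobian (\<omega> t) (at ((1 / a) *\<^sub>R x)))"
  using assms by (simp add: grad_Lp_def jacobian_v deriv_time_stop time_stop_eq)

end

section \<open>The lower bound\<close>

lemma admissible_smooth_velocity:
  assumes "l > 0" "admissible_velocity l u"
  obtains W G where "smooth_velocity l u W G"
proof -
  have adm: "smooth_on ({0..} \<times> closure (cube l)) (\<lambda>(t, x). u t x)"
    "\<forall>t\<ge>0. \<forall>x\<in>cube l. divergence (u t) x = 0" "\<forall>t\<ge>0. \<forall>x\<in>frontier (cube l). u t x = 0"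
    using assms(2) unfolding admissible_velocity_def by simp_all
  from adm(1) obtain W G where WG: "open W" "{0..} \<times> closure (cube l) \<subseteq> W" "\<forall>k. Ck_on k W G"
    "\<forall>z\<in>{0..} \<times> closure (cube l). (\<lambda>(t, x). u t x) z = G z"
    unfolding smooth_on_def by (elim exE conjE)
  have "smooth_velocity l u W G"
  proof
    show "u s x = G (s, x)" if "s \<ge> 0" "x \<in> closure (cube l)" for s x
      using bspec[OF WG(4), of "(s, x)"] that by simp
  qed (use assms(1) WG(1-3) adm(2,3) in simp_all)
  then show ?thesis by (rule that)
qed

text \<open>The width e of the modified layer is chosen after T, the velocity and the solution; it
  does not enter the conclusion, where its only trace is the summand T beside the time
  integral.\<close>

lemma rescaled_lower_bound:
  fixes u :: "real \<Rightarrow> real^'n \<Rightarrow> real^'n" and \<theta>0 :: "real^'n \<Rightarrow> real"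
  assumes l: "l > 0" and c0: "c0 > 0" and p: "1 \<le> p"
    and lower_bound: "\<And>u \<theta>0 \<theta> t.
      admissible_velocity l u \<Longrightarrow> \<theta>0 \<in> mean_zero_data l \<Longrightarrow>
      transport_solution l u \<theta>0 \<theta> \<Longrightarrow> t \<ge> 0 \<Longrightarrow>
      Hm1_norm l (\<theta> t) \<ge>
        ereal (B \<theta>0 * exp (- c0 / l powr (real CARD('n) / p) *
          (LINT s:{0..t}|lborel. grad_Lp l p (u s))))"
    and \<theta>0: "\<theta>0 \<in> mean_zero_data l" and adm: "admissible_velocity l u"
    and sol: "transport_solution l u \<theta>0 \<theta>" and T: "T \<ge> 0" and a: "0 < a" "a < 1"
    and Bpos: "B (rescale l a \<theta>0) \<ge> 0"
  shows "Hm1_norm l (rescale l a (\<theta> T)) \<ge> ereal (B (rescale l a \<theta>0) *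
    exp (- c0 / l powr (real CARD('n) / p) *
      (a powr (real CARD('n) / p) * (2 * ((LINT s:{0..T}|lborel. grad_Lp l p (u s)) + T)))))"
proof -
  let ?n = "CARD('n)"
  obtain W G where "smooth_velocity l u W G" using admissible_smooth_velocity[OF l adm] .
  then interpret smooth_velocity l u W G .
  have T2: "T + 2 \<ge> 0" using T by simp
  obtain \<eta> where \<eta>: "\<eta> > 0"
    "\<And>s x i. 0 \<le> s \<Longrightarrow> s \<le> T + 2 \<Longrightarrow> x \<in> cube l \<Longrightarrow> x $ i < \<eta> \<or> x $ i > l - \<eta> \<Longrightarrow> \<theta> s x = 0"
    using transport_solution_support[OF sol \<theta>0 T2] by metis
  obtain b where b: "b \<ge> 0" "\<And>s x i k. 0 \<le> s \<Longrightarrow> s \<le> T \<Longrightarrow> x \<in> closure (cube l) \<Longrightarrow> \<bar>J (s, x) i k\<bar> \<le> b"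
    using J_bounded by metis
  obtain C where C: "C \<ge> (1::real)"
    and cut: "\<And>l e. 0 < e \<Longrightarrow> 4 * e < l \<Longrightarrow> \<exists>\<phi> \<phi>1 \<phi>2. cutoff_map C l e \<phi> \<phi>1 \<phi>2"
    using cutoff_map_exists by metis
  define b' where "b' = real ?n * (real ?n * (2 * (C ^ ?n * (C * b))))"
  define Q where "Q = b' powr p * (2 * real ?n * l ^ (?n - 1))"
  have Q: "Q \<ge> 0" using l by (simp add: Q_def)
  \<comment> \<open>The first bound gives 4 e < l, the second puts the modified layer where
    \<open>\<theta>\<close> vanishes up to time T + 2, and the third makes the layer add at most 1
    to the integral of the p-th power of the gradient.\<close>
  define e where "e = min (l / 8) (min (\<eta> / 4) (1 / (2 * (Q + 1))))"
  have e: "0 < e" "4 * e < l" and e\<eta>: "2 * e < \<eta>" using l \<eta>(1) Q by (auto simp: e_def)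
  have eQ: "Q * (2 * e) \<le> 1"
  proof -
    have "Q * (2 * e) \<le> (Q + 1) * (2 * (1 / (2 * (Q + 1))))"
      using Q e(1) by (intro mult_mono) (auto simp: e_def)
    also have "\<dots> = 1" using Q by (simp add: divide_simps)
    finally show ?thesis .
  qed
  obtain \<phi> \<phi>1 \<phi>2 where "cutoff_map C l e \<phi> \<phi>1 \<phi>2" using cut[OF e(1,2)] by blast
  then interpret cut_velocity l u W G C e \<phi> \<phi>1 \<phi>2
    using C e(1,2) by unfold_locales
  have "b' powr p * measure lborel (cube l - cbox (\<chi> i. 2 * e) ((\<chi> i. l - 2 * e)::real^'n))
    \<le> b' powr p * (2 * real ?n * l ^ (?n - 1) * (2 * e))"
    using measure_layer[of "2 * e" l, where 'n='n] e by (intro mult_left_mono) auto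
  also have "\<dots> \<le> 1" using eQ by (simp add: Q_def mult_ac)
  finally have small: "b' powr p * measure lborel (cube l - cbox (\<chi> i. 2 * e) ((\<chi> i. l - 2 * e)::real^'n)) \<le> 1" .
  let ?A = "a powr (real ?n / p)"
  have gv: "grad_Lp l p (v T a s) \<le> ?A * (2 * (grad_Lp l p (u s) + 1))" if "s \<in> {0..T}" for s
  proof -
    have s: "0 \<le> s" "s \<le> T" using that by auto
    show ?thesis
      unfolding grad_Lp_v[OF s a(1)]
      by (rule grad_\<omega>_integral[OF b(2) b(1) s p small[unfolded b'_def] a])
  qed
  have g0: "0 \<le> grad_Lp l p w" for w :: "real^'n \<Rightarrow> real^'n" by (simp add: grad_Lp_def Lp_norm_def)
  note iu = grad_Lp_integrable[OF p, of T]
  have i1: "set_integrable lborel {0..T} (\<lambda>s. 1 :: real)"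
    unfolding set_integrable_def by (simp add: integrable_indicator_iff emeasure_lborel_Icc_eq)
  have iR: "set_integrable lborel {0..T} (\<lambda>s. ?A * (2 * (grad_Lp l p (u s) + 1)))"
    by (intro set_integrable_mult_right set_integral_add(1) iu i1)
  have IR: "(LINT s:{0..T}|lborel. ?A * (2 * (grad_Lp l p (u s) + 1)))
    = ?A * (2 * ((LINT s:{0..T}|lborel. grad_Lp l p (u s)) + T))"
  proof -
    have "(LINT s:{0..T}|lborel. (1::real)) = T" using T by (simp add: set_lebesgue_integral_def)
    then show ?thesis
      unfolding set_integral_mult_right set_integral_add(2)[OF iu i1] by simp
  qed
  have Iv: "(LINT s:{0..T}|lborel. grad_Lp l p (v T a s)) \<le> ?A * (2 * ((LINT s:{0..T}|lborel. grad_Lp l p (u s)) + T))"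
  proof (cases "set_integrable lborel {0..T} (\<lambda>s. grad_Lp l p (v T a s))")
    case True
    have "(LINT s:{0..T}|lborel. grad_Lp l p (v T a s)) \<le> (LINT s:{0..T}|lborel. ?A * (2 * (grad_Lp l p (u s) + 1)))"
      by (rule set_integral_mono[OF True iR gv])
    then show ?thesis unfolding IR .
  next
    case False
    \<comment> \<open>A nonintegrable integrand has integral 0 by convention, and the right side is
      nonnegative.\<close>
    then have "(LINT s:{0..T}|lborel. grad_Lp l p (v T a s)) = 0"
      unfolding set_integrable_def set_lebesgue_integral_def by (rule not_integrable_integral_eq)
    moreover have "0 \<le> (LINT s:{0..T}|lborel. grad_Lp l p (u s))"
      unfolding set_lebesgue_integral_def using g0 by (intro Bochner_Integration.integral_nonneg) auto
    ultimately show ?thesis using T by simp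
  qed
  have "ereal (B (rescale l a \<theta>0) * exp (- c0 / l powr (real ?n / p) *
      (?A * (2 * ((LINT s:{0..T}|lborel. grad_Lp l p (u s)) + T)))))
    \<le> ereal (B (rescale l a \<theta>0) * exp (- c0 / l powr (real ?n / p) * (LINT s:{0..T}|lborel. grad_Lp l p (v T a s))))"
  proof -
    have "- c0 / l powr (real ?n / p) \<le> 0" using c0 by simp
    then have "- c0 / l powr (real ?n / p) * (?A * (2 * ((LINT s:{0..T}|lborel. grad_Lp l p (u s)) + T)))
      \<le> - c0 / l powr (real ?n / p) * (LINT s:{0..T}|lborel. grad_Lp l p (v T a s))"
      by (rule mult_left_mono_neg[OF Iv])
    then show ?thesis using Bpos unfolding ereal_less_eq by (intro mult_left_mono) auto
  qed
  also have "\<dots> \<le> Hm1_norm l (rescale l a (\<theta> (time_stop T T)))"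
    by (rule lower_bound[OF admissible_v[OF T a] mean_zero_data_rescale[OF \<theta>0 a l] v_solution[OF T a sol e\<eta> \<eta>(2)] T])
  finally show ?thesis by (simp add: time_stop_eq)
qed

text \<open>Absorbs the error term into half of Z and solves for H.\<close>

lemma lower_bound_of_split_estimate:
  fixes H Z M \<delta> K :: real
  assumes "K > 0" "0 < \<delta>" "Z \<le> K * (H / \<delta> + M * sqrt \<delta>)" "K * (M * sqrt \<delta>) \<le> Z / 2"
  shows "Z * \<delta> / (2 * K) \<le> H"
proof -
  have "Z / 2 \<le> K * (H / \<delta>)" using assms(3)[unfolded distrib_left] assms(4) by linarith
  then have "Z / 2 * \<delta> \<le> K * H" using assms(2) by (simp add: field_simps)
  then show ?thesis using assms(1) by (simp add: field_simps)
qed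

theorem proposition5p1:
  fixes l p c0 \<gamma> :: real
    and B :: "(real^'n \<Rightarrow> real) \<Rightarrow> real"
  assumes "CARD('n) \<ge> 2" and "l > 0" and "c0 > 0"
    and "1 \<le> p" and "p \<le> real CARD('n)"
    and lower_bound: "\<And>u \<theta>0 \<theta> t.
      admissible_velocity l u \<Longrightarrow> \<theta>0 \<in> mean_zero_data l \<Longrightarrow>
      transport_solution l u \<theta>0 \<theta> \<Longrightarrow> t \<ge> 0 \<Longrightarrow>
      Hm1_norm l (\<theta> t) \<ge>
        ereal (B \<theta>0 * exp (- c0 / l powr (real CARD('n) / p) *
          (LINT s:{0..t}|lborel. grad_Lp l p (u s))))"
    and B_homogeneous: "\<And>\<theta>0 A. \<theta>0 \<in> mean_zero_data l \<Longrightarrow> A > 0 \<Longrightarrow>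
      B (\<lambda>x. A * \<theta>0 x) = A * B \<theta>0"
    and B_rescale: "\<And>\<theta>0 a. \<theta>0 \<in> mean_zero_data l \<Longrightarrow> 0 < a \<Longrightarrow> a < 1 \<Longrightarrow>
      B (rescale l a \<theta>0) = a powr (- \<gamma>) * B \<theta>0"
  shows "\<forall>\<theta>0 u \<theta>.
    \<theta>0 \<in> mean_zero_data l \<longrightarrow> B \<theta>0 > 0 \<longrightarrow>
    admissible_velocity l u \<longrightarrow>
    Limsup at_top (\<lambda>t. ereal (1 / t * (LINT s:{0..t}|lborel. grad_Lp l p (u s)))) < \<infinity> \<longrightarrow>
    transport_solution l u \<theta>0 \<theta> \<longrightarrow>
    algebraic_lower_bound (\<lambda>t. Hm1_norm l (\<theta> t))"
proof (intro allI impI)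
  fix \<theta>0 :: "real^'n \<Rightarrow> real" and u :: "real \<Rightarrow> real^'n \<Rightarrow> real^'n" and \<theta> :: "real \<Rightarrow> real^'n \<Rightarrow> real"
  assume \<theta>0: "\<theta>0 \<in> mean_zero_data l" and B0: "B \<theta>0 > 0" and adm: "admissible_velocity l u"
    and ls: "Limsup at_top (\<lambda>t. ereal (1 / t * (LINT s:{0..t}|lborel. grad_Lp l p (u s)))) < \<infinity>"
    and sol: "transport_solution l u \<theta>0 \<theta>"
  let ?n = "CARD('n)"
  obtain W G where "smooth_velocity l u W G" using admissible_smooth_velocity[OF assms(2) adm] .
  then interpret smooth_velocity l u W G .
  have "Limsup at_top (\<lambda>t. ereal (1 / t * (LINT s:{0..t}|lborel. grad_Lp l p (u s)))) \<noteq> \<infinity>"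
    using ls by (rule less_imp_neq)
  then obtain R :: real where "Limsup at_top (\<lambda>t. ereal (1 / t * (LINT s:{0..t}|lborel. grad_Lp l p (u s)))) < ereal R"
    unfolding less_PInf_Ex_of_nat by blast
  then have "eventually (\<lambda>t. ereal (1 / t * (LINT s:{0..t}|lborel. grad_Lp l p (u s))) < ereal R) at_top"
    by (rule Limsup_lessD)
  then obtain t1 where t1: "\<And>t. t \<ge> t1 \<Longrightarrow> 1 / t * (LINT s:{0..t}|lborel. grad_Lp l p (u s)) < R"
    by (auto simp: eventually_at_top_linorder)
  obtain K \<delta>0 where K: "K > 0" "\<delta>0 > 0"
    and interp: "\<And>(f::real^'n \<Rightarrow> real) M a \<delta> H. continuous_on (cube l) f \<Longrightarrow> (\<And>x. x \<in> cube l \<Longrightarrow> \<bar>f x\<bar> \<le> M) \<Longrightarrow> M \<ge> 0 \<Longrightarrow>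
      0 < a \<Longrightarrow> a < 1 \<Longrightarrow> 0 < \<delta> \<Longrightarrow> \<delta> < \<delta>0 \<Longrightarrow> (LINT x:cube l|lborel. f x) = 0 \<Longrightarrow>
      Hm1_norm l f \<le> ereal H \<Longrightarrow> H \<ge> 0 \<Longrightarrow>
      Hm1_norm l (rescale l a f) \<le> ereal (K * sqrt (a ^ ?n) * (H / \<delta> + M * sqrt \<delta>))"
    using Hm1_norm_rescale_le[OF assms(2), where 'n='n] by metis
  obtain M where M: "M > 0" "\<And>x. \<bar>\<theta>0 x\<bar> \<le> M"
  proof -
    have "compact (closure {x. \<theta>0 x \<noteq> 0})" "\<forall>k. Ck_on k UNIV \<theta>0"
      using \<theta>0 by (simp_all add: mean_zero_data_def smooth_on_UNIV del: compact_closure)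
    moreover from this(2) have "continuous_on UNIV \<theta>0" by (metis Ck_on.simps(1))
    then have "continuous_on (closure {x. \<theta>0 x \<noteq> 0}) \<theta>0" by (rule continuous_on_subset) simp
    ultimately have "bounded (\<theta>0 ` closure {x. \<theta>0 x \<noteq> 0})"
      by (intro compact_imp_bounded compact_continuous_image)
    then obtain r where r: "\<And>x. x \<in> closure {x. \<theta>0 x \<noteq> 0} \<Longrightarrow> \<bar>\<theta>0 x\<bar> \<le> r" by (auto simp: bounded_iff)
    have "\<bar>\<theta>0 x\<bar> \<le> \<bar>r\<bar> + 1" for x
    proof (cases "\<theta>0 x = 0")
      case False
      then have "x \<in> closure {x. \<theta>0 x \<noteq> 0}" by (intro subsetD[OF closure_subset]) simp
      then show ?thesis using r[of x] by linarith
    qed simp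
    then show ?thesis using that[of "\<bar>r\<bar> + 1"] by auto
  qed
  \<comment> \<open>Chosen such that a^(-\<open>\<gamma>\<close>) = a^(n/2) T^m for a = T^(-p/n),
    where a^(n/2) is the factor of the rescaling estimate.\<close>
  define m where "m = p / ?n * (\<gamma> + ?n / 2)"
  define c where "c = c0 / l powr (real ?n / p)"
  \<comment> \<open>The rescaled lower bound without its power of a: the time integral for the
    rescaled field is at most (1/T) 2 (R T + T) = 2 (R + 1).\<close>
  define \<beta> where "\<beta> = B \<theta>0 * exp (- c * (2 * (R + 1)))"
  \<comment> \<open>The first bound makes the error K M sqrt \<open>\<delta>\<close> at most half of
    the main term; the other two give \<open>\<delta>\<close> <= q^2 <= q <
    \<open>\<delta>0\<close>.\<close>
  define q where "q = min (\<beta> / (2 * K * M)) (min 1 (\<delta>0 / 2))"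
  have \<beta>: "\<beta> > 0" using B0 by (simp add: \<beta>_def)
  have q: "q > 0" "q \<le> 1" "q \<le> \<delta>0 / 2" "q \<le> \<beta> / (2 * K * M)" using \<beta> K M by (auto simp: q_def)
  have c: "c > 0" using assms(2,3) by (simp add: c_def)
  have np: "real ?n > 0" "p > 0" using assms(4) by auto
  \<comment> \<open>T > 1 ensures a < 1 and T^(-|m|) <= 1; from \<open>t1\<close> on the averaged
    gradient norm is below R.\<close>
  have main: "ereal (\<beta> * q\<^sup>2 / (2 * K) * T powr (- (3 * \<bar>m\<bar>))) \<le> Hm1_norm l (\<theta> T)" if T: "T \<ge> max 2 t1" for T
  proof -
    have T1: "T > 1" "T \<ge> 0" "T \<ge> t1" using T by auto
    define a where "a = T powr (- (p / ?n))"
    have a: "0 < a" "a < 1"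
      using T1 np by (auto simp: a_def powr_less_one)
    have aA: "a powr (real ?n / p) = 1 / T"
    proof -
      have "- (p / real ?n) * (real ?n / p) = - 1" using np by simp
      then show ?thesis unfolding a_def powr_powr using T1 by (simp add: powr_minus_divide)
    qed
    have Brs: "B (rescale l a \<theta>0) = a powr (- \<gamma>) * B \<theta>0" by (rule B_rescale[OF \<theta>0 a])
    have "ereal (a powr (- \<gamma>) * \<beta>) \<le> Hm1_norm l (rescale l a (\<theta> T))"
    proof -
      have "(LINT s:{0..T}|lborel. grad_Lp l p (u s)) \<le> R * T"
        using t1[OF T1(3)] T1 by (simp add: field_simps)
      then have "1 / T * (2 * ((LINT s:{0..T}|lborel. grad_Lp l p (u s)) + T)) \<le> 2 * (R + 1)"
        using T1 by (simp add: field_simps)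
      then have "- c * (2 * (R + 1)) \<le> - c * (1 / T * (2 * ((LINT s:{0..T}|lborel. grad_Lp l p (u s)) + T)))"
        using c by (intro mult_left_mono_neg) auto
      then have "B (rescale l a \<theta>0) * exp (- c * (2 * (R + 1)))
        \<le> B (rescale l a \<theta>0) * exp (- c * (1 / T * (2 * ((LINT s:{0..T}|lborel. grad_Lp l p (u s)) + T))))"
        using B0 unfolding Brs by (intro mult_left_mono) auto
      then have "ereal (B (rescale l a \<theta>0) * exp (- c * (2 * (R + 1))))
        \<le> ereal (B (rescale l a \<theta>0) * exp (- c0 / l powr (real ?n / p) *
          (a powr (real ?n / p) * (2 * ((LINT s:{0..T}|lborel. grad_Lp l p (u s)) + T)))))"
        unfolding aA c_def minus_divide_left ereal_less_eq .
      also have "\<dots> \<le> Hm1_norm l (rescale l a (\<theta> T))"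
      proof (rule rescaled_lower_bound[where B=B, OF assms(2,3,4) _ \<theta>0 adm sol T1(2) a])
        show "0 \<le> B (rescale l a \<theta>0)" using B0 by (simp add: Brs)
      qed (rule lower_bound)
      finally show ?thesis by (simp add: Brs \<beta>_def mult.assoc)
    qed
    note low = this
    show ?thesis
    proof (cases "(LINT x:cube l|lborel. \<theta> T x) = 0 \<and> Hm1_norm l (\<theta> T) < \<infinity>")
      case False
      then have "Hm1_norm l (\<theta> T) = \<infinity>" using Hm1_norm_infinite by fastforce
      then show ?thesis by simp
    next
      case True
      obtain H where H: "Hm1_norm l (\<theta> T) = ereal H" "H \<ge> 0"
        using True Hm1_norm_nonneg[of l "\<theta> T"] by (cases "Hm1_norm l (\<theta> T)") auto
      have ct: "continuous_on (cube l) (\<theta> T)"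
      proof -
        have 1: "continuous_on ({0..} \<times> cube l) (\<lambda>(t, x). \<theta> t x)"
          using sol by (simp add: transport_solution_def)
        have 2: "continuous_on (cube l) (Pair T)"
          by (rule continuous_on_Pair[OF continuous_on_const continuous_on_id])
        have "continuous_on (cube l) (\<lambda>x. (\<lambda>(t, x). \<theta> t x) (T, x))"
          by (rule continuous_on_compose2[OF 1 2]) (use T1 in auto)
        then show ?thesis by simp
      qed
      \<comment> \<open>The square makes sqrt \<open>\<delta>\<close> a multiple of T^(-|m|). The
        absolute value treats both signs of m at once, since T^(-|m|) is at most 1 and at most
        T^m.\<close>
      define \<delta> where "\<delta> = (q * T powr (- \<bar>m\<bar>))\<^sup>2"
      have Tm: "0 < T powr (- \<bar>m\<bar>)" "T powr (- \<bar>m\<bar>) \<le> 1" using T1 by (auto simp: powr_le_one_le ge_one_powr_ge_zero powr_minus divide_simps)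
      have sd: "sqrt \<delta> = q * T powr (- \<bar>m\<bar>)" using q Tm by (simp add: \<delta>_def)
      have qT: "q * T powr (- \<bar>m\<bar>) \<le> q" using q Tm by (simp add: mult_left_le)
      have d: "0 < \<delta>" "\<delta> < \<delta>0"
      proof -
        show "0 < \<delta>" using q Tm by (simp add: \<delta>_def)
        have "\<delta> \<le> q\<^sup>2" unfolding \<delta>_def using qT q Tm by (intro power_mono) auto
        also have "\<dots> \<le> q" using q by (simp add: power2_eq_square mult_left_le)
        finally show "\<delta> < \<delta>0" using q K by linarith
      qed
      have "ereal (a powr (- \<gamma>) * \<beta>) \<le> ereal (K * sqrt (a ^ ?n) * (H / \<delta> + M * sqrt \<delta>))"
        by (rule order_trans[OF low interp[OF ct _ less_imp_le[OF M(1)] a d _ _ H(2)]])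
          (use transport_solution_bounded[OF sol M(2) T1(2)] True H in auto)
      then have 1: "a powr (- \<gamma>) * \<beta> \<le> sqrt (a ^ ?n) * (K * (H / \<delta> + M * sqrt \<delta>))" by (simp add: mult_ac)
      have sq: "sqrt (a ^ ?n) = a powr (?n / 2)"
        using a by (simp add: powr_half_sqrt_powr powr_realpow)
      define Z where "Z = T powr m * \<beta>"
      have "a powr (- \<gamma>) = a powr (?n / 2) * T powr m"
      proof -
        have "T powr m = a powr (- (\<gamma> + ?n / 2))"
          unfolding a_def powr_powr m_def by (simp only: minus_mult_minus)
        then show ?thesis by (simp add: powr_add[symmetric])
      qed
      then have "a powr (?n / 2) * Z \<le> a powr (?n / 2) * (K * (H / \<delta> + M * sqrt \<delta>))"
        using 1 unfolding sq Z_def by (simp add: mult.assoc)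
      then have 2: "Z \<le> K * (H / \<delta> + M * sqrt \<delta>)" using a by simp
      have Tmm: "T powr (- \<bar>m\<bar>) \<le> T powr m" using T1 by (intro powr_mono) auto
      have "K * M * q \<le> \<beta> / 2"
        using mult_left_mono[OF q(4), of "K * M"] K M by simp
      then have "K * M * q * T powr (- \<bar>m\<bar>) \<le> \<beta> / 2 * T powr (- \<bar>m\<bar>)"
        by (rule mult_right_mono) (use Tm in simp)
      then have "K * (M * sqrt \<delta>) \<le> \<beta> / 2 * T powr (- \<bar>m\<bar>)" by (simp only: sd mult.assoc)
      also have "\<dots> \<le> Z / 2" using Tmm \<beta> by (simp add: Z_def mult.commute)
      finally have 3: "K * (M * sqrt \<delta>) \<le> Z / 2" .
      \<comment> \<open>One factor T^(-|m|) comes from the lower bound for Z and two from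
        \<open>\<delta>\<close>, hence the exponent 3 |m|.\<close>
      have "\<beta> * q\<^sup>2 / (2 * K) * T powr (- (3 * \<bar>m\<bar>)) = (T powr (- \<bar>m\<bar>) * \<beta>) * \<delta> / (2 * K)"
      proof -
        have "T powr (- (3 * \<bar>m\<bar>)) = T powr (- \<bar>m\<bar>) * (T powr (- \<bar>m\<bar>))\<^sup>2"
          by (simp add: power2_eq_square powr_add[symmetric])
        then show ?thesis by (simp add: \<delta>_def power_mult_distrib mult_ac)
      qed
      also have "\<dots> \<le> Z * \<delta> / (2 * K)"
        using Tmm \<beta> d K unfolding Z_def by (intro divide_right_mono mult_right_mono) auto
      also have "\<dots> \<le> H" by (rule lower_bound_of_split_estimate[OF K(1) d(1) 2 3])
      finally show ?thesis by (simp add: H)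
    qed
  qed
  show "algebraic_lower_bound (\<lambda>t. Hm1_norm l (\<theta> t))"
    unfolding algebraic_lower_bound_def
  proof (intro exI conjI allI impI)
    show "\<beta> * q\<^sup>2 / (2 * K) > 0" using \<beta> q K by simp
    show "3 * \<bar>m\<bar> \<ge> 0" "max 2 t1 > 0" by auto
  qed (rule main)
qed

end
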